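(* Let $M$ be a smooth finite-dimensional manifold, $V$ a Banach space, $\mathcal G=(\psi,U)$ and $\tilde{\mathcal G}=(\tilde\psi,\tilde U)$ two gauges on $M$, and $\mathbf y=(y,y^\dagger)\in CRP_{\mathbf X}(M)$. The map $$\boldsymbol\alpha_s=(\alpha_s,\alpha_s^\dagger)\longmapsto\tilde{\boldsymbol\alpha}_s:=\left(\alpha_s,\;\alpha_s^\dagger+\alpha_sS^{\tilde U,U}_{y_s}(y_s^\dagger\otimes I)\right)$$ is a bijection from $CRP_y^U(M,V)$ to $CRP_y^{\tilde U}(M,V)$ such that $$\int\langle\boldsymbol\alpha,d\mathbf y^{\mathcal G}\rangle=\int\langle\tilde{\boldsymbol\alpha},d\mathbf y^{\tilde{\mathcal G}}\rangle.$$
   Context: Rough paths. $W=\mathbb R^k$, $T>0$, $1\le p<3$, $\Delta_{[0,T]}=\{(s,t):0\le s\le t\le T\}$. A control is a continuous $\omega:\Delta_{[0,T]}\to[0,\infty)$ with $\omega(s,s)=0$ and $\omega(s,t)+\omega(t,u)\le\omega(s,u)$ for $s\le t\le u$. $\mathbf X=(x,\mathbb X)$ is a fixed weak-geometric $p$-rough path with control $\omega$: $x:[0,T]\to W$ and $\mathbb X:\Delta_{[0,T]}\to W\otimes W$ are continuous and, with $x_{s,t}:=x_t-x_s$, one has $\mathbb X_{s,u}=\mathbb X_{s,t}+\mathbb X_{t,u}+x_{s,t}\otimes x_{t,u}$ for $s\le t\le u$, $|x_{s,t}|\le\omega(s,t)^{1/p}$, $|\mathbb X_{s,t}|\le\omega(s,t)^{2/p}$,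 and the symmetric part of $\mathbb X_{s,t}$ equals $\frac12x_{s,t}\otimes x_{s,t}$. $F_{s,t}\approx_iG_{s,t}$ means: there are $C<\infty$, $\delta>0$ (with $\delta$ small enough that all expressions are defined) such that $|F_{s,t}-G_{s,t}|\le C\omega(s,t)^{i/p}$ for all $0\le s\le t\le T$ with $t-s\le\delta$; for values in spaces built from $T_{y_s}M$ the norm is the (operator) norm from any fixed Riemannian metric on $M$. $CRP_{\mathbf X}(V)$: continuous pairs $(z,z^\dagger)$, $z:[0,T]\to V$, $z^\dagger:[0,T]\to L(W,V)$, for which there is $C$ with $|z_t-z_s-z_s^\dagger x_{s,t}|\le C\omega(s,t)^{2/p}$ and $|z_t^\dagger-z_s^\dagger|\le C\omega(s,t)^{1/p}$ for all $0\le s\le t\le T$. Gauges. A diagonal domain is an open $\mathcal D\subseteq M\times M$ containing the diagonal. A logarithm is a smooth $\psi:\mathcal D\to TM$ with $\psi(m,n)\in T_mM$, $\psi(m,m)=0_m$, and differential of $\psi(m,\cdot)$ at $m$ equal to the identity of $T_mM$. A parallelism is a smooth map $(n,m)\in\mathcal D\mapsto U(n,m)\in L(T_mM,T_nM)$ with $U(m,m)=I$. A gauge is a pair $(\psi,U)$ of these with common domain $\mathcal D$. $CRP_{\mathbf X}(M)$: continuous pairs $(y,y^\dagger)$, $y:[0,T]\to M$, $y_s^\dagger\in L(W,T_{y_s}M)$, with $\psi(y_s,y_t)\approx_2y_s^\dagger x_{s,t}$ and $U(y_s,y_t)y_t^\dagger\approx_1y_s^\dagger$ (this does not depend on the gauge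 chosen). $CRP_y^U(M,V)$: pairs $(\alpha,\alpha^\dagger)$ with $\alpha_s\in L(T_{y_s}M,V)$, $\alpha_s^\dagger\in L(W\otimes T_{y_s}M,V)$, $\alpha_t\circ U(y_t,y_s)-\alpha_s-\alpha_s^\dagger(x_{s,t}\otimes(\cdot))\approx_20$ and $\alpha_t^\dagger\circ(I\otimes U(y_t,y_s))-\alpha_s^\dagger\approx_10$. Compatibility tensor. For parallelisms $\tilde U,U$: $S_m^{\tilde U,U}[v\otimes w]:=v\left[n\mapsto U(n,m)^{-1}\tilde U(n,m)w\right]$ (derivative at $m$ in direction $v$ of a $T_mM$-valued function), $v,w\in T_mM$. For a gauge $\mathcal G=(\psi,U)$: $S^{\mathcal G}:=S^{U^\psi,U}$ where $U^\psi(m,n):=$ differential of $\psi(m,\cdot)$ at $n$, viewed as a map $T_nM\to T_mM$. Integral. For $\boldsymbol\alpha\in CRP_y^U(M,V)$, $\int\langle\boldsymbol\alpha,d\mathbf y^{\mathcal G}\rangle$ is the unique $(z,z^\dagger)\in CRP_{\mathbf X}(V)$ with $z_0=0$, $z_s^\dagger=\alpha_s\circ y_s^\dagger$ and $z_t-z_s\approx_3\alpha_s\left(\psi(y_s,y_t)+S^{\mathcal G}_{y_s}((y_s^\dagger\otimes y_s^\dagger)\mathbb X_{s,t})\right)+\alpha_s^\dagger(I\otimes y_s^\dagger)\mathbb X_{s,t}$. *)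

theory Defs
  imports "HOL-Analysis.Analysis" "HOL-Library.Function_Algebras"
begin

section \<open>Smooth maps between open subsets of Euclidean spaces\<close>

text \<open>For open S and finite-dimensional 'a this is the usual notion: all iterated directional
  derivatives exist and are continuous.\<close>

primrec Ck_on :: "nat \<Rightarrow> 'a::euclidean_space set \<Rightarrow> ('a \<Rightarrow> 'b::real_normed_vector) \<Rightarrow> bool" where
  "Ck_on 0 S f \<longleftrightarrow> continuous_on S f"
| "Ck_on (Suc k) S f \<longleftrightarrow>
     f differentiable_on S \<and> (\<forall>v. Ck_on k S (\<lambda>x. frechet_derivative f (at x) v))"

definition smooth_on :: "'a::euclidean_space set \<Rightarrow> ('a \<Rightarrow> 'b::real_normed_vector) \<Rightarrow> bool" where
  "smooth_on S f \<longleftrightarrow> (\<forall>k. Ck_on k S f)"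


section \<open>Smooth manifolds and tangent vectors\<close>

text \<open>The manifold is the whole type 'm (Hausdorff and second countable by its sort), with a smooth
  atlas A. A chart is a pair of its domain and its coordinate map; the values of the coordinate map
  outside the domain are irrelevant.\<close>

type_synonym ('m, 'e) chart = "'m set \<times> ('m \<Rightarrow> 'e)"

definition cinv :: "('m, 'e) chart \<Rightarrow> 'e \<Rightarrow> 'm" where
  "cinv c = inv_into (fst c) (snd c)"

definition crange :: "('m, 'e) chart \<Rightarrow> 'e set" where
  "crange c = snd c ` fst c"

definition smooth_atlas ::
  "('m::{t2_space,second_countable_topology}, 'e::euclidean_space) chart set \<Rightarrow> bool" where
  "smooth_atlas A \<longleftrightarrow>
     (\<forall>c\<in>A. open (fst c) \<and> open (crange c) \<and> homeomorphism (fst c) (crange c) (snd c) (cinv c)) \<and>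
     (\<Union>c\<in>A. fst c) = UNIV \<and>
     (\<forall>c\<in>A. \<forall>c'\<in>A. smooth_on (snd c ` (fst c \<inter> fst c')) (snd c' \<circ> cinv c))"

text \<open>A tangent vector at m is given by its coordinate vectors in all charts around m, related by
  the differentials of the transition maps; the entries at all other indices are set to 0. The
  vector space structure is pointwise.\<close>

type_synonym ('m, 'e) tvec = "('m, 'e) chart \<Rightarrow> 'e"

instantiation "fun" :: (type, real_vector) real_vector
begin

definition scaleR_fun :: "real \<Rightarrow> ('a \<Rightarrow> 'b) \<Rightarrow> 'a \<Rightarrow> 'b" where
  "scaleR_fun r f = (\<lambda>x. r *\<^sub>R f x)"

instance
  by standard (simp_all add: scaleR_fun_def plus_fun_def fun_eq_iff algebra_simps)

end

definition charts_at :: "('m, 'e) chart set \<Rightarrow> 'm \<Rightarrow> ('m, 'e) chart set" where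
  "charts_at A m = {c \<in> A. m \<in> fst c}"

definition tangent_space ::
  "('m, 'e::euclidean_space) chart set \<Rightarrow> 'm \<Rightarrow> ('m, 'e) tvec set" where
  "tangent_space A m =
     {v. (\<forall>c. c \<notin> charts_at A m \<longrightarrow> v c = 0) \<and>
         (\<forall>c\<in>charts_at A m. \<forall>c'\<in>charts_at A m.
            v c' = frechet_derivative (snd c' \<circ> cinv c) (at (snd c m)) (v c))}"

text \<open>The tangent vector at m with coordinates e in the chart c.\<close>

definition coord_vec ::
  "('m, 'e::euclidean_space) chart set \<Rightarrow> ('m, 'e) chart \<Rightarrow> 'm \<Rightarrow> 'e \<Rightarrow> ('m, 'e) tvec" where
  "coord_vec A c m e = (\<lambda>c'. if c' \<in> charts_at A m
      then frechet_derivative (snd c' \<circ> cinv c) (at (snd c m)) e else 0)"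

definition tangent_linear ::
  "('m, 'e::euclidean_space) chart set \<Rightarrow> 'm \<Rightarrow> (('m, 'e) tvec \<Rightarrow> 'b::real_vector) \<Rightarrow> bool" where
  "tangent_linear A m f \<longleftrightarrow>
     (\<forall>v\<in>tangent_space A m. \<forall>w\<in>tangent_space A m. f (v + w) = f v + f w) \<and>
     (\<forall>r. \<forall>v\<in>tangent_space A m. f (r *\<^sub>R v) = r *\<^sub>R f v)"

text \<open>Derivative v[h] of a function h at m in the direction v. By the chain rule the chart around m
  that is selected does not matter.\<close>

definition dir_deriv ::
  "('m, 'e::euclidean_space) chart set \<Rightarrow> 'm \<Rightarrow> ('m, 'e) tvec \<Rightarrow> ('m \<Rightarrow> 'b::real_normed_vector) \<Rightarrow> 'b"
  where
  "dir_deriv A m v h =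
     (let c = (SOME c. c \<in> charts_at A m) in frechet_derivative (h \<circ> cinv c) (at (snd c m)) (v c))"

text \<open>The same for h with values in one fixed tangent space (its base point may differ from m),
  taken componentwise.\<close>

definition tangent_deriv ::
  "('m, 'e::euclidean_space) chart set \<Rightarrow> 'm \<Rightarrow> ('m, 'e) tvec \<Rightarrow> ('m \<Rightarrow> ('m, 'e) tvec) \<Rightarrow> ('m, 'e) tvec"
  where
  "tangent_deriv A m v h = (\<lambda>c'. dir_deriv A m v (\<lambda>n. h n c'))"

definition riemannian_metric ::
  "('m, 'e::euclidean_space) chart set \<Rightarrow> ('m \<Rightarrow> ('m, 'e) tvec \<Rightarrow> ('m, 'e) tvec \<Rightarrow> real) \<Rightarrow> bool" where
  "riemannian_metric A g \<longleftrightarrow>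
     (\<forall>m. \<forall>v\<in>tangent_space A m.
        tangent_linear A m (g m v) \<and>
        (\<forall>w\<in>tangent_space A m. g m v w = g m w v) \<and>
        (v \<noteq> 0 \<longrightarrow> g m v v > 0)) \<and>
     (\<forall>c\<in>A. \<forall>e e'. smooth_on (crange c)
        (\<lambda>a. g (cinv c a) (coord_vec A c (cinv c a) e) (coord_vec A c (cinv c a) e')))"

definition tnorm :: "('m \<Rightarrow> ('m, 'e) tvec \<Rightarrow> ('m, 'e) tvec \<Rightarrow> real) \<Rightarrow> 'm \<Rightarrow> ('m, 'e) tvec \<Rightarrow> real" where
  "tnorm g m v = sqrt (g m v v)"


section \<open>Gauges\<close>

definition diagonal_domain :: "('m::topological_space \<times> 'm) set \<Rightarrow> bool" where
  "diagonal_domain D \<longleftrightarrow> open D \<and> (\<forall>m. (m, m) \<in> D)"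

text \<open>The coordinate expression of D on the product chart of c and c'.\<close>

definition coord_domain ::
  "('m \<times> 'm) set \<Rightarrow> ('m, 'e) chart \<Rightarrow> ('m, 'e) chart \<Rightarrow> ('e \<times> 'e) set" where
  "coord_domain D c c' = {(a, b). a \<in> crange c \<and> b \<in> crange c' \<and> (cinv c a, cinv c' b) \<in> D}"

text \<open>Smoothness into the tangent bundle is expressed in the bundle chart induced by c; the base
  point component of the logarithm is the (smooth) first projection.\<close>

definition logarithm ::
  "('m::topological_space, 'e::euclidean_space) chart set \<Rightarrow> ('m \<times> 'm) set \<Rightarrow>
   ('m \<Rightarrow> 'm \<Rightarrow> ('m, 'e) tvec) \<Rightarrow> bool" where
  "logarithm A D \<psi> \<longleftrightarrow>
     (\<forall>m n. (m, n) \<in> D \<longrightarrow> \<psi> m n \<in> tangent_space A m) \<and>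
     (\<forall>c\<in>A. \<forall>c'\<in>A. smooth_on (coord_domain D c c') (\<lambda>(a, b). \<psi> (cinv c a) (cinv c' b) c)) \<and>
     (\<forall>m. \<psi> m m = 0) \<and>
     (\<forall>m. \<forall>v\<in>tangent_space A m. tangent_deriv A m v (\<psi> m) = v)"

text \<open>U n m maps the tangent space at m to the one at n; smoothness is that of the matrix
  coefficients in charts.\<close>

definition parallelism ::
  "('m::topological_space, 'e::euclidean_space) chart set \<Rightarrow> ('m \<times> 'm) set \<Rightarrow>
   ('m \<Rightarrow> 'm \<Rightarrow> ('m, 'e) tvec \<Rightarrow> ('m, 'e) tvec) \<Rightarrow> bool" where
  "parallelism A D U \<longleftrightarrow>
     (\<forall>n m. (n, m) \<in> D \<longrightarrow>
        tangent_linear A m (U n m) \<and> U n m ` tangent_space A m \<subseteq> tangent_space A n) \<and>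
     (\<forall>c\<in>A. \<forall>c'\<in>A. \<forall>e. smooth_on (coord_domain D c c')
        (\<lambda>(a, b). U (cinv c a) (cinv c' b) (coord_vec A c' (cinv c' b) e) c)) \<and>
     (\<forall>m. \<forall>v\<in>tangent_space A m. U m m v = v)"

definition manifold_gauge ::
  "('m::topological_space, 'e::euclidean_space) chart set \<Rightarrow> ('m \<times> 'm) set \<Rightarrow>
   ('m \<Rightarrow> 'm \<Rightarrow> ('m, 'e) tvec) \<Rightarrow> ('m \<Rightarrow> 'm \<Rightarrow> ('m, 'e) tvec \<Rightarrow> ('m, 'e) tvec) \<Rightarrow> bool" where
  "manifold_gauge A D \<psi> U \<longleftrightarrow> diagonal_domain D \<and> logarithm A D \<psi> \<and> parallelism A D U"

text \<open>\<open>compat A U' U m v w\<close> is the compatibility tensor of the parallelisms U', U at m,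
  evaluated on the elementary tensor of v and w.\<close>

definition compat ::
  "('m, 'e::euclidean_space) chart set \<Rightarrow> ('m \<Rightarrow> 'm \<Rightarrow> ('m, 'e) tvec \<Rightarrow> ('m, 'e) tvec) \<Rightarrow>
   ('m \<Rightarrow> 'm \<Rightarrow> ('m, 'e) tvec \<Rightarrow> ('m, 'e) tvec) \<Rightarrow> 'm \<Rightarrow> ('m, 'e) tvec \<Rightarrow> ('m, 'e) tvec \<Rightarrow> ('m, 'e) tvec"
  where
  "compat A U' U m v w =
     tangent_deriv A m v (\<lambda>n. inv_into (tangent_space A m) (U n m) (U' n m w))"

definition log_parallelism ::
  "('m, 'e::euclidean_space) chart set \<Rightarrow> ('m \<Rightarrow> 'm \<Rightarrow> ('m, 'e) tvec) \<Rightarrow>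
   'm \<Rightarrow> 'm \<Rightarrow> ('m, 'e) tvec \<Rightarrow> ('m, 'e) tvec" where
  "log_parallelism A \<psi> m n v = tangent_deriv A n v (\<psi> m)"

definition gauge_compat ::
  "('m, 'e::euclidean_space) chart set \<Rightarrow> ('m \<Rightarrow> 'm \<Rightarrow> ('m, 'e) tvec) \<Rightarrow>
   ('m \<Rightarrow> 'm \<Rightarrow> ('m, 'e) tvec \<Rightarrow> ('m, 'e) tvec) \<Rightarrow> 'm \<Rightarrow> ('m, 'e) tvec \<Rightarrow> ('m, 'e) tvec \<Rightarrow> ('m, 'e) tvec"
  where
  "gauge_compat A \<psi> U = compat A (log_parallelism A \<psi>) U"


section \<open>Rough paths\<close>

definition simplex2 :: "real \<Rightarrow> (real \<times> real) set" where
  "simplex2 T = {(s, t). 0 \<le> s \<and> s \<le> t \<and> t \<le> T}"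

definition rp_control :: "real \<Rightarrow> (real \<Rightarrow> real \<Rightarrow> real) \<Rightarrow> bool" where
  "rp_control T \<omega> \<longleftrightarrow>
     continuous_on (simplex2 T) (\<lambda>(s, t). \<omega> s t) \<and>
     (\<forall>(s, t)\<in>simplex2 T. 0 \<le> \<omega> s t) \<and>
     (\<forall>s\<in>{0..T}. \<omega> s s = 0) \<and>
     (\<forall>s t u. 0 \<le> s \<and> s \<le> t \<and> t \<le> u \<and> u \<le> T \<longrightarrow> \<omega> s t + \<omega> t u \<le> \<omega> s u)"

text \<open>Elements of the tensor square of W are matrices, with the Hilbert-Schmidt norm.\<close>

definition tensor :: "real^'k \<Rightarrow> real^'k \<Rightarrow> real^'k^'k" where
  "tensor a b = (\<chi> i j. a $ i * b $ j)"

text \<open>The linear map on the tensor square of W induced by a bilinear map B.\<close>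

definition tensor_lift ::
  "(real^'k \<Rightarrow> real^'k \<Rightarrow> 'b::real_vector) \<Rightarrow> real^'k^'k \<Rightarrow> 'b" where
  "tensor_lift B X = (\<Sum>i\<in>UNIV. \<Sum>j\<in>UNIV. (X $ i $ j) *\<^sub>R B (axis i 1) (axis j 1))"

definition weak_geometric_rough_path ::
  "real \<Rightarrow> real \<Rightarrow> (real \<Rightarrow> real \<Rightarrow> real) \<Rightarrow> (real \<Rightarrow> real^'k) \<Rightarrow> (real \<Rightarrow> real \<Rightarrow> real^'k^'k) \<Rightarrow> bool"
  where
  "weak_geometric_rough_path T p \<omega> x XX \<longleftrightarrow>
     rp_control T \<omega> \<and>
     continuous_on {0..T} x \<and>
     continuous_on (simplex2 T) (\<lambda>(s, t). XX s t) \<and>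
     (\<forall>s t u. 0 \<le> s \<and> s \<le> t \<and> t \<le> u \<and> u \<le> T \<longrightarrow>
        XX s u = XX s t + XX t u + tensor (x t - x s) (x u - x t)) \<and>
     (\<forall>(s, t)\<in>simplex2 T.
        norm (x t - x s) \<le> \<omega> s t powr (1 / p) \<and>
        norm (XX s t) \<le> \<omega> s t powr (2 / p) \<and>
        (1 / 2) *\<^sub>R (XX s t + transpose (XX s t)) = (1 / 2) *\<^sub>R tensor (x t - x s) (x t - x s))"

text \<open>\<open>approx T p \<omega> i dfd bnd\<close> is the relation of order i between two-parameter expressions F and G:
  \<open>dfd s t\<close> says that the expressions are defined at s, t, and \<open>bnd s t K\<close> says that the
  (operator) norm of the difference of F and G at s, t is at most K. For operator norms, bnd is
  spelled out as a bound on the values at all arguments.\<close>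

definition approx ::
  "real \<Rightarrow> real \<Rightarrow> (real \<Rightarrow> real \<Rightarrow> real) \<Rightarrow> nat \<Rightarrow>
   (real \<Rightarrow> real \<Rightarrow> bool) \<Rightarrow> (real \<Rightarrow> real \<Rightarrow> real \<Rightarrow> bool) \<Rightarrow> bool" where
  "approx T p \<omega> i dfd bnd \<longleftrightarrow>
     (\<exists>C. \<exists>\<delta>>0. \<forall>s t. 0 \<le> s \<and> s \<le> t \<and> t \<le> T \<and> t - s \<le> \<delta> \<longrightarrow>
        dfd s t \<and> bnd s t (C * \<omega> s t powr (real i / p)))"


section \<open>Controlled rough paths\<close>

text \<open>Functions on [0, T] are represented by extensional functions on the reals, so that equality
  of (and bijections between) spaces of such functions have their usual meaning.\<close>

definition crp_vec ::
  "real \<Rightarrow> real \<Rightarrow> (real \<Rightarrow> real \<Rightarrow> real) \<Rightarrow> (real \<Rightarrow> real^'k) \<Rightarrow>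
   ((real \<Rightarrow> 'v::banach) \<times> (real \<Rightarrow> (real^'k) \<Rightarrow>\<^sub>L 'v)) set" where
  "crp_vec T p \<omega> x =
     {(z, z'). z \<in> extensional {0..T} \<and> z' \<in> extensional {0..T} \<and>
        continuous_on {0..T} z \<and> continuous_on {0..T} z' \<and>
        (\<exists>C. \<forall>(s, t)\<in>simplex2 T.
           norm (z t - z s - blinfun_apply (z' s) (x t - x s)) \<le> C * \<omega> s t powr (2 / p) \<and>
           norm (z' t - z' s) \<le> C * \<omega> s t powr (1 / p))}"

text \<open>Controlled rough paths on the manifold. The condition is independent of the gauge and is
  required for some gauge. Continuity of y' is continuity in the charts of the bundle of linear maps
  from W into the tangent spaces.\<close>

definition crp_manifold ::
  "('m::topological_space, 'e::euclidean_space) chart set \<Rightarrow>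
   ('m \<Rightarrow> ('m, 'e) tvec \<Rightarrow> ('m, 'e) tvec \<Rightarrow> real) \<Rightarrow>
   real \<Rightarrow> real \<Rightarrow> (real \<Rightarrow> real \<Rightarrow> real) \<Rightarrow> (real \<Rightarrow> real^'k) \<Rightarrow>
   ((real \<Rightarrow> 'm) \<times> (real \<Rightarrow> real^'k \<Rightarrow> ('m, 'e) tvec)) set" where
  "crp_manifold A g T p \<omega> x =
     {(y, y'). continuous_on {0..T} y \<and>
        (\<forall>s\<in>{0..T}. linear (y' s) \<and> range (y' s) \<subseteq> tangent_space A (y s)) \<and>
        (\<forall>c\<in>A. \<forall>w. continuous_on {s \<in> {0..T}. y s \<in> fst c} (\<lambda>s. y' s w c)) \<and>
        (\<exists>D \<psi> U. manifold_gauge A D \<psi> U \<and>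
           approx T p \<omega> 2 (\<lambda>s t. (y s, y t) \<in> D)
             (\<lambda>s t K. tnorm g (y s) (\<psi> (y s) (y t) - y' s (x t - x s)) \<le> K) \<and>
           approx T p \<omega> 1 (\<lambda>s t. (y s, y t) \<in> D)
             (\<lambda>s t K. \<forall>w. tnorm g (y s) (U (y s) (y t) (y' t w) - y' s w) \<le> K * norm w))}"

text \<open>Controlled rough paths along y with values in V, for the parallelism U with domain D. Linear
  maps from the tensor product of W and a tangent space to V are represented as bilinear maps.\<close>

definition crp_along ::
  "('m::topological_space, 'e::euclidean_space) chart set \<Rightarrow>
   ('m \<Rightarrow> ('m, 'e) tvec \<Rightarrow> ('m, 'e) tvec \<Rightarrow> real) \<Rightarrow>
   real \<Rightarrow> real \<Rightarrow> (real \<Rightarrow> real \<Rightarrow> real) \<Rightarrow> (real \<Rightarrow> real^'k) \<Rightarrow> (real \<Rightarrow> 'm) \<Rightarrow>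
   ('m \<times> 'm) set \<Rightarrow> ('m \<Rightarrow> 'm \<Rightarrow> ('m, 'e) tvec \<Rightarrow> ('m, 'e) tvec) \<Rightarrow>
   ((real \<Rightarrow> ('m, 'e) tvec \<Rightarrow> 'v::banach) \<times> (real \<Rightarrow> real^'k \<Rightarrow> ('m, 'e) tvec \<Rightarrow> 'v)) set" where
  "crp_along A g T p \<omega> x y D U =
     {(\<alpha>, \<alpha>'). \<alpha> \<in> extensional {0..T} \<and> \<alpha>' \<in> extensional {0..T} \<and>
        (\<forall>s\<in>{0..T}.
           \<alpha> s \<in> extensional (tangent_space A (y s)) \<and> tangent_linear A (y s) (\<alpha> s) \<and>
           (\<forall>w. \<alpha>' s w \<in> extensional (tangent_space A (y s)) \<and> tangent_linear A (y s) (\<alpha>' s w)) \<and>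
           (\<forall>v\<in>tangent_space A (y s). linear (\<lambda>w. \<alpha>' s w v))) \<and>
        approx T p \<omega> 2 (\<lambda>s t. (y t, y s) \<in> D)
          (\<lambda>s t K. \<forall>v\<in>tangent_space A (y s).
             norm (\<alpha> t (U (y t) (y s) v) - \<alpha> s v - \<alpha>' s (x t - x s) v) \<le> K * tnorm g (y s) v) \<and>
        approx T p \<omega> 1 (\<lambda>s t. (y t, y s) \<in> D)
          (\<lambda>s t K. \<forall>w. \<forall>v\<in>tangent_space A (y s).
             norm (\<alpha>' t w (U (y t) (y s) v) - \<alpha>' s w v) \<le> K * norm w * tnorm g (y s) v)}"

definition is_rough_integral ::
  "('m, 'e::euclidean_space) chart set \<Rightarrow>
   real \<Rightarrow> real \<Rightarrow> (real \<Rightarrow> real \<Rightarrow> real) \<Rightarrow> (real \<Rightarrow> real^'k) \<Rightarrow> (real \<Rightarrow> real \<Rightarrow> real^'k^'k) \<Rightarrow>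
   (real \<Rightarrow> 'm) \<times> (real \<Rightarrow> real^'k \<Rightarrow> ('m, 'e) tvec) \<Rightarrow>
   ('m \<times> 'm) set \<Rightarrow> ('m \<Rightarrow> 'm \<Rightarrow> ('m, 'e) tvec) \<Rightarrow>
   ('m \<Rightarrow> 'm \<Rightarrow> ('m, 'e) tvec \<Rightarrow> ('m, 'e) tvec) \<Rightarrow>
   (real \<Rightarrow> ('m, 'e) tvec \<Rightarrow> 'v::banach) \<times> (real \<Rightarrow> real^'k \<Rightarrow> ('m, 'e) tvec \<Rightarrow> 'v) \<Rightarrow>
   (real \<Rightarrow> 'v) \<times> (real \<Rightarrow> (real^'k) \<Rightarrow>\<^sub>L 'v) \<Rightarrow> bool" where
  "is_rough_integral A T p \<omega> x XX = (\<lambda>(y, y') D \<psi> U (\<alpha>, \<alpha>') (z, z').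
     (z, z') \<in> crp_vec T p \<omega> x \<and>
     z 0 = 0 \<and>
     (\<forall>s\<in>{0..T}. \<forall>w. blinfun_apply (z' s) w = \<alpha> s (y' s w)) \<and>
     approx T p \<omega> 3 (\<lambda>s t. (y s, y t) \<in> D)
       (\<lambda>s t K. norm (z t - z s -
          (\<alpha> s (\<psi> (y s) (y t)
                + tensor_lift (\<lambda>a b. gauge_compat A \<psi> U (y s) (y' s a) (y' s b)) (XX s t))
           + tensor_lift (\<lambda>a b. \<alpha>' s a (y' s b)) (XX s t))) \<le> K))"

definition rough_integral ::
  "('m, 'e::euclidean_space) chart set \<Rightarrow>
   real \<Rightarrow> real \<Rightarrow> (real \<Rightarrow> real \<Rightarrow> real) \<Rightarrow> (real \<Rightarrow> real^'k) \<Rightarrow> (real \<Rightarrow> real \<Rightarrow> real^'k^'k) \<Rightarrow>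
   (real \<Rightarrow> 'm) \<times> (real \<Rightarrow> real^'k \<Rightarrow> ('m, 'e) tvec) \<Rightarrow>
   ('m \<times> 'm) set \<Rightarrow> ('m \<Rightarrow> 'm \<Rightarrow> ('m, 'e) tvec) \<Rightarrow>
   ('m \<Rightarrow> 'm \<Rightarrow> ('m, 'e) tvec \<Rightarrow> ('m, 'e) tvec) \<Rightarrow>
   (real \<Rightarrow> ('m, 'e) tvec \<Rightarrow> 'v::banach) \<times> (real \<Rightarrow> real^'k \<Rightarrow> ('m, 'e) tvec \<Rightarrow> 'v) \<Rightarrow>
   (real \<Rightarrow> 'v) \<times> (real \<Rightarrow> (real^'k) \<Rightarrow>\<^sub>L 'v)" where
  "rough_integral A T p \<omega> x XX yy D \<psi> U \<alpha>\<alpha> = (THE zz. is_rough_integral A T p \<omega> x XX yy D \<psi> U \<alpha>\<alpha> zz)"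

text \<open>The map of controlled rough paths along y from the parallelism U to the parallelism U'.\<close>

definition change_parallelism ::
  "('m, 'e::euclidean_space) chart set \<Rightarrow> real \<Rightarrow>
   (real \<Rightarrow> 'm) \<times> (real \<Rightarrow> real^'k \<Rightarrow> ('m, 'e) tvec) \<Rightarrow>
   ('m \<Rightarrow> 'm \<Rightarrow> ('m, 'e) tvec \<Rightarrow> ('m, 'e) tvec) \<Rightarrow>
   ('m \<Rightarrow> 'm \<Rightarrow> ('m, 'e) tvec \<Rightarrow> ('m, 'e) tvec) \<Rightarrow>
   (real \<Rightarrow> ('m, 'e) tvec \<Rightarrow> 'v::banach) \<times> (real \<Rightarrow> real^'k \<Rightarrow> ('m, 'e) tvec \<Rightarrow> 'v) \<Rightarrow>
   (real \<Rightarrow> ('m, 'e) tvec \<Rightarrow> 'v) \<times> (real \<Rightarrow> real^'k \<Rightarrow> ('m, 'e) tvec \<Rightarrow> 'v)" where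
  "change_parallelism A T = (\<lambda>(y, y') U U' (\<alpha>, \<alpha>').
     (\<alpha>, \<lambda>s\<in>{0..T}. \<lambda>w. \<lambda>v\<in>tangent_space A (y s).
            \<alpha>' s w v + \<alpha> s (compat A U' U (y s) (y' s w) v)))"

end

theory Submission
  imports Defs
begin

text \<open>Everything is local in time, so one may work in a single chart. There a parallelism is a matrix
  U(a, b) with U(b, b) = I, and the compatibility tensor of U' and U at m is the difference of
  the derivatives of U' and U in the first variable at (m, m). Expanding U(y_t, y_s)^{-1} U'(y_t, y_s) to
  first order in y_t - y_s, which is y'_s x_{s,t} up to order 2, shows that adding the compatibility
  tensor to the Gubinelli derivative passes from the relations for U to those for U'; exchanging U and
  U' inverts the map since the tensor is antisymmetric in the two parallelisms.

  For the integral, the differential of the logarithm in its second variable is itself a parallelism, so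
  the compatibility tensors of the two gauges and of U', U add up to the difference of the mixed second
  derivatives of the two logarithms on the diagonal. These are symmetric and equal to minus the pure
  second derivatives in the second variable. Since the symmetric part of XX is half the square of the
  increment, their contraction with XX cancels the second order Taylor difference of the logarithms up to
  order 3. Hence both integrals are characterised by the same property, and no existence or uniqueness
  result for rough integrals enters.\<close>

section \<open>Quantitative calculus of smooth maps\<close>

text \<open>The difficulty is uniformity. One constant must serve all close s \<le> t, although
  \<open>y\<close> is merely continuous in time and the components of a controlled path along
  \<open>y\<close> come with no continuity or boundedness at all. Hence each estimate in a chart is
  proved with a single constant on a whole neighbourhood of a diagonal point (a0, a0), pulled back
  to times through the filter \<open>near_diag\<close>, and the local constants are merged by
  compactness of the diagonal of [0, T]. Smallness of the coordinate increment comes from continuity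
  of \<open>y\<close>; its order in the control then comes from inverting a logarithm near the
  diagonal. Boundedness of controlled paths along \<open>y\<close> is derived from their own
  relations. Operator norms appear as bounds with a factor \<open>norm e\<close> for every vector
  \<open>e\<close>; by linearity they follow from bounds at finitely many basis vectors.\<close>

lemma frechet_derivative_cong_open:
  assumes "open S" "x \<in> S" "\<And>z. z \<in> S \<Longrightarrow> f z = g z"
  shows "frechet_derivative f (at x) = frechet_derivative g (at x)"
proof -
  have "(f has_derivative D) (at x) \<longleftrightarrow> (g has_derivative D) (at x)" for D
    using assms has_derivative_transform_within_open[of f D x UNIV S g]
      has_derivative_transform_within_open[of g D x UNIV S f] by auto
  \<comment> \<open>\<open>frechet_derivative\<close> chooses among the derivatives at the point;
    both functions have the same ones, so the choices agree even if there are none.\<close>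
  then show ?thesis by (simp add: frechet_derivative_def)
qed

lemma Ck_on_cong:
  assumes "open S" "\<And>z. z \<in> S \<Longrightarrow> f z = g z"
  shows "Ck_on k S f \<longleftrightarrow> Ck_on k S g"
  using assms(2)
proof (induction k arbitrary: f g)
  case 0
  then show ?case by (simp cong: continuous_on_cong)
next
  case (Suc k)
  have "f differentiable_on S \<longleftrightarrow> g differentiable_on S"
    unfolding differentiable_on_def differentiable_def
    using Suc.prems has_derivative_transform[of _ S f g] has_derivative_transform[of _ S g f] by metis
  moreover have "Ck_on k S (\<lambda>x. frechet_derivative f (at x) v)
      = Ck_on k S (\<lambda>x. frechet_derivative g (at x) v)" for v
    by (rule Suc.IH) (simp add: frechet_derivative_cong_open[OF assms(1) _ Suc.prems])
  ultimately show ?case by simp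
qed

lemma smooth_on_cong:
  "open S \<Longrightarrow> (\<And>z. z \<in> S \<Longrightarrow> f z = g z) \<Longrightarrow> smooth_on S f \<longleftrightarrow> smooth_on S g"
  unfolding smooth_on_def using Ck_on_cong by blast

lemma smooth_on_continuous: "smooth_on S f \<Longrightarrow> continuous_on S f"
  unfolding smooth_on_def using Ck_on.simps(1) by blast

lemma smooth_on_has_derivative:
  assumes "open S" "smooth_on S f" "x \<in> S"
  shows "(f has_derivative frechet_derivative f (at x)) (at x)"
proof -
  have "Ck_on (Suc 0) S f" using assms by (simp only: smooth_on_def)
  then have "f differentiable (at x)"
    using assms(1,3) differentiable_on_eq_differentiable_at by auto
  then show ?thesis by (simp add: frechet_derivative_works)
qed

lemma smooth_on_frechet_derivative:
  assumes "smooth_on S f"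
  shows "smooth_on S (\<lambda>x. frechet_derivative f (at x) v)"
  unfolding smooth_on_def
proof
  fix k
  have "Ck_on (Suc k) S f" using assms by (simp only: smooth_on_def)
  then show "Ck_on k S (\<lambda>x. frechet_derivative f (at x) v)" by simp
qed

text \<open>The bridge from directional derivatives to operator norms: \<open>Ck_on\<close> controls
  one direction at a time, and the finitely many basis directions bound all others.\<close>

lemma norm_linear_basis_le:
  fixes f :: "'a::euclidean_space \<Rightarrow> 'b::real_normed_vector"
  assumes "linear f"
  shows "norm (f v) \<le> (\<Sum>i\<in>Basis. norm (f i)) * norm v"
proof -
  have "f v = f (\<Sum>i\<in>Basis. (v \<bullet> i) *\<^sub>R i)" by (simp add: euclidean_representation)
  also have "\<dots> = (\<Sum>i\<in>Basis. (v \<bullet> i) *\<^sub>R f i)"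
    by (simp add: linear_sum[OF assms] linear_scale[OF assms])
  also have "norm \<dots> \<le> (\<Sum>i\<in>Basis. norm (f i) * norm v)"
    by (rule sum_norm_le) (simp add: mult.commute[of _ "norm v"] mult_right_mono Basis_le_norm)
  finally show ?thesis by (simp add: sum_distrib_right)
qed

definition first_order_bounds ::
  "('a::real_normed_vector \<Rightarrow> 'b::real_normed_vector) \<Rightarrow> 'a set \<Rightarrow> real \<Rightarrow> bool" where
  "first_order_bounds f B L \<longleftrightarrow> 0 \<le> L \<and> (\<forall>x\<in>B. \<forall>y\<in>B. norm (f x - f y) \<le> L * norm (x - y)) \<and>
     (\<forall>x\<in>B. \<forall>v. norm (frechet_derivative f (at x) v) \<le> L * norm v)"

text \<open>The directional derivatives along the basis are continuous, hence bounded on a closed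
  ball; convexity of the ball turns this into a Lipschitz bound by the mean value
  inequality.\<close>

lemma smooth_on_first_order_bounds:
  fixes f :: "'a::euclidean_space \<Rightarrow> 'b::real_normed_vector"
  assumes "open S" "smooth_on S f" "z0 \<in> S"
  shows "\<exists>\<rho>>0. \<exists>L. ball z0 \<rho> \<subseteq> S \<and> first_order_bounds f (ball z0 \<rho>) L"
proof -
  obtain \<rho> where \<rho>: "\<rho> > 0" "cball z0 \<rho> \<subseteq> S"
    using assms(1,3) open_contains_cball by blast
  have "continuous_on (cball z0 \<rho>) (\<lambda>x. \<Sum>i\<in>Basis. norm (frechet_derivative f (at x) i))"
    using smooth_on_continuous[OF smooth_on_frechet_derivative[OF assms(2)]] \<rho>(2)
    by (intro continuous_intros) (meson continuous_on_subset)
  then have "compact ((\<lambda>x. \<Sum>i\<in>Basis. norm (frechet_derivative f (at x) i)) ` cball z0 \<rho>)"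
    by (rule compact_continuous_image) simp
  then have "bounded ((\<lambda>x. \<Sum>i\<in>Basis. norm (frechet_derivative f (at x) i)) ` cball z0 \<rho>)"
    by (rule compact_imp_bounded)
  then obtain L where L: "L > 0"
      "\<And>x. x \<in> cball z0 \<rho> \<Longrightarrow> \<bar>\<Sum>i\<in>Basis. norm (frechet_derivative f (at x) i)\<bar> \<le> L"
    unfolding bounded_pos ball_simps(9) real_norm_def by auto
  have D: "(f has_derivative frechet_derivative f (at x)) (at x)" if "x \<in> ball z0 \<rho>" for x
    by (rule smooth_on_has_derivative[OF assms(1,2)]) (use \<rho>(2) that in \<open>auto simp: subset_iff\<close>)
  have b: "norm (frechet_derivative f (at x) v) \<le> L * norm v" if "x \<in> ball z0 \<rho>" for x v
  proof -
    have "norm (frechet_derivative f (at x) v)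
        \<le> (\<Sum>i\<in>Basis. norm (frechet_derivative f (at x) i)) * norm v"
      by (rule norm_linear_basis_le) (rule has_derivative_linear[OF D[OF that]])
    also have "\<dots> \<le> L * norm v" using L(2)[of x] that by (intro mult_right_mono) auto
    finally show ?thesis .
  qed
  have "norm (f x - f y) \<le> L * norm (x - y)" if "x \<in> ball z0 \<rho>" "y \<in> ball z0 \<rho>" for x y
  proof (rule differentiable_bound[OF convex_ball[of z0 \<rho>] _ _ that])
    show "(f has_derivative frechet_derivative f (at x)) (at x within ball z0 \<rho>)"
      if "x \<in> ball z0 \<rho>" for x
      using D that has_derivative_at_withinI by blast
    show "onorm (frechet_derivative f (at x)) \<le> L" if "x \<in> ball z0 \<rho>" for x
      using b that L(1) by (intro onorm_bound) auto
  qed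
  then have "first_order_bounds f (ball z0 \<rho>) L"
    using b L(1) by (simp add: first_order_bounds_def)
  moreover have "ball z0 \<rho> \<subseteq> S" using \<rho>(2) by auto
  ultimately show ?thesis using \<rho>(1) by blast
qed

definition second_order_bounds ::
  "('a::real_normed_vector \<Rightarrow> 'b::real_normed_vector) \<Rightarrow> 'a set \<Rightarrow> real \<Rightarrow> bool" where
  "second_order_bounds f B L \<longleftrightarrow> first_order_bounds f B L \<and> (\<forall>x\<in>B. \<forall>y\<in>B.
     norm (f y - f x - frechet_derivative f (at x) (y - x)) \<le> L * norm (y - x)^2 \<and>
     (\<forall>v. norm (frechet_derivative f (at x) v - frechet_derivative f (at y) v)
        \<le> L * norm (x - y) * norm v))"

text \<open>Each directional derivative along a basis vector is itself smooth, so its first order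
  bounds make the whole derivative Lipschitz, and the Taylor estimate follows.\<close>

lemma smooth_on_second_order_bounds:
  fixes f :: "'a::euclidean_space \<Rightarrow> 'b::real_normed_vector"
  assumes S: "open S" "smooth_on S f" "z0 \<in> S"
  shows "\<exists>\<rho>>0. \<exists>L. ball z0 \<rho> \<subseteq> S \<and> second_order_bounds f (ball z0 \<rho>) L"
proof -
  obtain L \<rho> where \<rho>: "\<rho> > 0" "ball z0 \<rho> \<subseteq> S" and first: "first_order_bounds f (ball z0 \<rho>) L"
    using smooth_on_first_order_bounds[OF S] by blast
  then have L: "L \<ge> 0" "\<rho> > 0" "ball z0 \<rho> \<subseteq> S"
    "\<And>x v. x \<in> ball z0 \<rho> \<Longrightarrow> norm (frechet_derivative f (at x) v) \<le> L * norm v"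
    "\<And>x y. x \<in> ball z0 \<rho> \<Longrightarrow> y \<in> ball z0 \<rho> \<Longrightarrow> norm (f x - f y) \<le> L * norm (x - y)"
    unfolding first_order_bounds_def by auto
  have "\<forall>i. \<exists>r M. r > 0 \<and> first_order_bounds (\<lambda>z. frechet_derivative f (at z) i) (ball z0 r) M"
    using smooth_on_first_order_bounds[OF S(1) smooth_on_frechet_derivative[OF S(2)] S(3)] by blast
  then obtain r M where M0: "\<forall>i. r i > 0 \<and>
      first_order_bounds (\<lambda>z. frechet_derivative f (at z) i) (ball z0 (r i)) (M i)"
    unfolding choice_iff by blast
  then have M: "\<And>i. M i \<ge> 0" "\<And>i. r i > 0"
    "\<And>i x y. x \<in> ball z0 (r i) \<Longrightarrow> y \<in> ball z0 (r i) \<Longrightarrow>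
      norm (frechet_derivative f (at x) i - frechet_derivative f (at y) i) \<le> M i * norm (x - y)"
    unfolding first_order_bounds_def by auto
  define R where "R = Min (insert \<rho> (r ` (Basis :: 'a set)))"
  define N where "N = L + (\<Sum>i\<in>(Basis::'a set). M i)"
  have R: "R > 0" "R \<le> \<rho>" "\<And>i. i \<in> Basis \<Longrightarrow> R \<le> r i"
    unfolding R_def using L M by (auto simp del: Min_insert simp: Min_gr_iff intro: Min_le)
  have sM: "0 \<le> (\<Sum>i\<in>(Basis::'a set). M i)" by (simp add: M sum_nonneg)
  have NL: "L \<le> N" "N \<ge> 0" using L sM by (auto simp: N_def)
  have sub: "ball z0 R \<subseteq> ball z0 \<rho>" using R by auto
  have D: "(f has_derivative frechet_derivative f (at x)) (at x)" if "x \<in> ball z0 R" for x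
    using smooth_on_has_derivative[OF S(1,2)] L(3) sub that by blast
  have Lip: "norm (frechet_derivative f (at x) v - frechet_derivative f (at y) v) \<le> N * norm (x - y) * norm v"
    if "x \<in> ball z0 R" "y \<in> ball z0 R" for x y v
  proof -
    let ?g = "\<lambda>v. frechet_derivative f (at x) v - frechet_derivative f (at y) v"
    have "linear ?g"
      using D that has_derivative_linear linear_compose_sub by blast
    then have "norm (?g v) \<le> (\<Sum>i\<in>Basis. norm (?g i)) * norm v"
      by (rule norm_linear_basis_le)
    also have "\<dots> \<le> (\<Sum>i\<in>Basis. M i * norm (x - y)) * norm v"
      using M(3) R(3) that by (intro mult_right_mono sum_mono) fastforce+
    also have "\<dots> = (\<Sum>i\<in>(Basis::'a set). M i) * norm (x - y) * norm v"
      by (simp add: sum_distrib_right)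
    also have "\<dots> \<le> N * norm (x - y) * norm v"
      using L by (intro mult_right_mono) (auto simp: N_def)
    finally show ?thesis .
  qed
  have tay: "norm (f y - f x - frechet_derivative f (at x) (y - x)) \<le> N * norm (y - x)^2"
    if "x \<in> ball z0 R" "y \<in> ball z0 R" for x y
  proof -
    have cs: "closed_segment x y \<subseteq> ball z0 R"
      using that by (simp add: closed_segment_subset)
    \<comment> \<open>On the segment the derivative differs from the one at \<open>x\<close> by at
      most \<open>N * norm (y - x)\<close>; the linearisation error is this bound times the
      length.\<close>
    have "norm (f y - f x - frechet_derivative f (at x) (y - x)) \<le> norm (y - x) * (N * norm (y - x))"
    proof (rule differentiable_bound_linearization[where S = "closed_segment x y"])
      show "x + t *\<^sub>R (y - x) \<in> closed_segment x y" if "t \<in> {0..1}" for t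
        using that unfolding closed_segment_def by (intro CollectI exI[of _ t]) (simp add: algebra_simps)
      show "(f has_derivative frechet_derivative f (at z)) (at z within closed_segment x y)"
        if "z \<in> closed_segment x y" for z
        using D cs that has_derivative_at_withinI by blast
      show "onorm (frechet_derivative f (at z) - frechet_derivative f (at x)) \<le> N * norm (y - x)"
        if "z \<in> closed_segment x y" for z
      proof (rule onorm_bound)
        fix v
        have "norm (z - x) \<le> norm (y - x)" using that segment_bound by blast
        then show "norm ((frechet_derivative f (at z) - frechet_derivative f (at x)) v)
            \<le> N * norm (y - x) * norm v"
          using Lip[of z x v] that cs \<open>x \<in> ball z0 R\<close> NL(2)
          by (auto intro!: order_trans[OF Lip] mult_right_mono mult_left_mono)
      qed (use NL in auto)
    qed auto
    then show ?thesis by (simp add: power2_eq_square ac_simps)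
  qed
  have b: "norm (frechet_derivative f (at x) v) \<le> N * norm v" if "x \<in> ball z0 R" for x v
    using L(4)[of x v] that sub NL(1) mult_right_mono[of L N "norm v"] by force
  have c: "norm (f x - f y) \<le> N * norm (x - y)" if "x \<in> ball z0 R" "y \<in> ball z0 R" for x y
    using L(5)[of x y] that sub NL(1) mult_right_mono[of L N "norm (x - y)"] by force
  have "second_order_bounds f (ball z0 R) N"
    using NL(2) b c Lip tay by (auto simp: second_order_bounds_def first_order_bounds_def)
  then show ?thesis using R(1) sub L(3) by blast
qed

text \<open>For families linear in \<open>e\<close> these are second order bounds for the
  operator-valued function sending z to \<open>\<lambda>e. f e z\<close>, with the operator norm
  spelled out by the factor \<open>norm e\<close>. The argument \<open>e\<close> comes first so that
  each member is an ordinary smooth function.\<close>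

definition family_bounds ::
  "('e::real_normed_vector \<Rightarrow> 'a::real_normed_vector \<Rightarrow> 'b::real_normed_vector) \<Rightarrow> 'a set \<Rightarrow> real \<Rightarrow> bool"
  where
  "family_bounds f B L \<longleftrightarrow> 0 \<le> L \<and> (\<forall>x\<in>B. \<forall>y\<in>B. \<forall>e.
     norm (f e x - f e y) \<le> L * norm (x - y) * norm e \<and>
     norm (f e y - f e x - frechet_derivative (f e) (at x) (y - x)) \<le> L * norm (y - x)^2 * norm e \<and>
     (\<forall>v. norm (frechet_derivative (f e) (at x) v) \<le> L * norm v * norm e \<and>
          norm (frechet_derivative (f e) (at x) v - frechet_derivative (f e) (at y) v)
            \<le> L * norm (x - y) * norm v * norm e))"

text \<open>Linearity in \<open>e\<close> holds on a neighbourhood of \<open>x\<close>, so it passes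
  to derivatives by the sum and scaling rules and uniqueness of the derivative.\<close>

lemma linear_frechet_derivative_family:
  fixes f :: "'e::real_normed_vector \<Rightarrow> 'a::euclidean_space \<Rightarrow> 'b::real_normed_vector"
  assumes S: "open S" "\<And>e. smooth_on S (f e)"
    and lin: "\<And>z. z \<in> S \<Longrightarrow> linear (\<lambda>e. f e z)" and x: "x \<in> S"
  shows "linear (\<lambda>e. frechet_derivative (f e) (at x) v)"
proof -
  have D: "(f e has_derivative frechet_derivative (f e) (at x)) (at x)" for e
    using smooth_on_has_derivative[OF S(1) S(2)] x by auto
  show ?thesis
  proof (rule linearI)
    fix e e' :: 'e and r :: real
    have "((\<lambda>z. f e z + f e' z) has_derivative
        (\<lambda>v. frechet_derivative (f e) (at x) v + frechet_derivative (f e') (at x) v)) (at x)"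
      by (intro has_derivative_add D)
    then have "(f (e + e') has_derivative
        (\<lambda>v. frechet_derivative (f e) (at x) v + frechet_derivative (f e') (at x) v)) (at x)"
      by (rule has_derivative_transform_within_open[OF _ S(1) x]) (simp add: linear_add[OF lin])
    then show "frechet_derivative (f (e + e')) (at x) v
        = frechet_derivative (f e) (at x) v + frechet_derivative (f e') (at x) v"
      by (metis frechet_derivative_at)
    have "((\<lambda>z. r *\<^sub>R f e z) has_derivative (\<lambda>v. r *\<^sub>R frechet_derivative (f e) (at x) v)) (at x)"
      by (intro has_derivative_scaleR_right D)
    then have "(f (r *\<^sub>R e) has_derivative (\<lambda>v. r *\<^sub>R frechet_derivative (f e) (at x) v)) (at x)"
      by (rule has_derivative_transform_within_open[OF _ S(1) x]) (simp add: linear_scale[OF lin])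
    then show "frechet_derivative (f (r *\<^sub>R e)) (at x) v = r *\<^sub>R frechet_derivative (f e) (at x) v"
      by (metis frechet_derivative_at)
  qed
qed

text \<open>Everything estimated is linear in \<open>e\<close>, including the derivatives, so second
  order bounds for the finitely many basis members suffice; their constants are added.\<close>

lemma smooth_family_bounds:
  fixes f :: "'e::euclidean_space \<Rightarrow> 'a::euclidean_space \<Rightarrow> 'b::real_normed_vector"
  assumes S: "open S" "z0 \<in> S" "\<And>e. smooth_on S (f e)"
    and lin: "\<And>z. z \<in> S \<Longrightarrow> linear (\<lambda>e. f e z)"
  shows "\<exists>\<rho>>0. \<exists>L. ball z0 \<rho> \<subseteq> S \<and> family_bounds f (ball z0 \<rho>) L"
proof -
  have "\<forall>i. \<exists>\<rho> L. \<rho> > 0 \<and> ball z0 \<rho> \<subseteq> S \<and> second_order_bounds (f i) (ball z0 \<rho>) L"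
    using smooth_on_second_order_bounds[OF S(1) S(3) S(2)] by blast
  then obtain \<rho> L where "\<forall>i. \<rho> i > 0 \<and> ball z0 (\<rho> i) \<subseteq> S \<and> second_order_bounds (f i) (ball z0 (\<rho> i)) (L i)"
    unfolding choice_iff by blast
  then have L: "\<And>i. L i \<ge> 0" "\<And>i. \<rho> i > 0" "\<And>i. ball z0 (\<rho> i) \<subseteq> S"
    "\<And>i x y. x \<in> ball z0 (\<rho> i) \<Longrightarrow> y \<in> ball z0 (\<rho> i) \<Longrightarrow> norm (f i x - f i y) \<le> L i * norm (x - y)"
    "\<And>i x y. x \<in> ball z0 (\<rho> i) \<Longrightarrow> y \<in> ball z0 (\<rho> i) \<Longrightarrow>
       norm (f i y - f i x - frechet_derivative (f i) (at x) (y - x)) \<le> L i * norm (y - x)^2"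
    "\<And>i x v. x \<in> ball z0 (\<rho> i) \<Longrightarrow> norm (frechet_derivative (f i) (at x) v) \<le> L i * norm v"
    "\<And>i x y v. x \<in> ball z0 (\<rho> i) \<Longrightarrow> y \<in> ball z0 (\<rho> i) \<Longrightarrow>
       norm (frechet_derivative (f i) (at x) v - frechet_derivative (f i) (at y) v) \<le> L i * norm (x - y) * norm v"
    unfolding second_order_bounds_def first_order_bounds_def by auto
  define R where "R = Min (\<rho> ` (Basis :: 'e set))"
  define N where "N = (\<Sum>i\<in>(Basis::'e set). L i)"
  have R: "R > 0" "\<And>i. i \<in> Basis \<Longrightarrow> R \<le> \<rho> i"
    using L by (auto simp: R_def Min_gr_iff intro: Min_le)
  have N: "N \<ge> 0" using L by (auto simp: N_def sum_nonneg)
  have RS: "ball z0 R \<subseteq> S"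
    using R(2) L(3) by (meson SOME_Basis order_trans subset_ball)
  note linD = linear_frechet_derivative_family[OF S(1,3) lin]
  have key: "norm (g e) \<le> N * K * norm e"
    if "linear g" "\<And>i. i \<in> Basis \<Longrightarrow> norm (g i) \<le> L i * K" for g :: "'e \<Rightarrow> 'b" and K e
  proof -
    have "norm (g e) \<le> (\<Sum>i\<in>Basis. norm (g i)) * norm e"
      by (rule norm_linear_basis_le) fact
    also have "\<dots> \<le> (\<Sum>i\<in>Basis. L i * K) * norm e"
      using that by (intro mult_right_mono sum_mono) auto
    finally show ?thesis by (simp add: N_def sum_distrib_right)
  qed
  have "family_bounds f (ball z0 R) N"
    unfolding family_bounds_def
  proof (intro conjI ballI allI N)
    fix x y e v
    assume xy: "x \<in> ball z0 R" "y \<in> ball z0 R"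
    then have xyS: "x \<in> S" "y \<in> S" using RS by auto
    have xy': "x \<in> ball z0 (\<rho> i)" "y \<in> ball z0 (\<rho> i)" if "i \<in> Basis" for i :: 'e
      using xy R(2)[OF that] by auto
    show "norm (f e x - f e y) \<le> N * norm (x - y) * norm e"
      by (rule key) (auto intro!: linear_compose_sub lin xyS L xy')
    show "norm (f e y - f e x - frechet_derivative (f e) (at x) (y - x)) \<le> N * (norm (y - x))\<^sup>2 * norm e"
      by (rule key) (auto intro!: linear_compose_sub lin linD xyS L xy')
    show "norm (frechet_derivative (f e) (at x) v) \<le> N * norm v * norm e"
      by (rule key) (auto intro!: linear_compose_sub lin linD xyS L xy')
    have "norm (frechet_derivative (f e) (at x) v - frechet_derivative (f e) (at y) v)
        \<le> N * (norm (x - y) * norm v) * norm e"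
      by (rule key) (use L(7) xy' in \<open>auto intro!: linear_compose_sub linD xyS simp: mult.assoc[symmetric]\<close>)
    then show "norm (frechet_derivative (f e) (at x) v - frechet_derivative (f e) (at y) v)
        \<le> N * norm (x - y) * norm v * norm e" by (simp add: mult.assoc)
  qed
  then show ?thesis using R(1) RS by blast
qed

section \<open>Symmetry of second derivatives and the normalised Taylor expansion\<close>

lemma linear_frechet_derivative:
  assumes "open S" "smooth_on S f" "x \<in> S"
  shows "linear (frechet_derivative f (at x))"
  using smooth_on_has_derivative[OF assms] has_derivative_linear by blast

text \<open>The mixed second difference is the increment along \<open>t *\<^sub>R w\<close> of the
  first difference along \<open>t *\<^sub>R v\<close>. First order Taylor bounds for the derivative
  leave an error of third order, which is enough to identify the second derivative after division by
  t^2.\<close>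

lemma smooth_on_second_difference:
  fixes f :: "'a::euclidean_space \<Rightarrow> 'b::real_normed_vector"
  assumes S: "open S" "smooth_on S f" "x \<in> S"
  shows "\<exists>\<tau>>0. \<exists>C. \<forall>t. 0 < t \<longrightarrow> t < \<tau> \<longrightarrow>
    norm (f (x + t *\<^sub>R v + t *\<^sub>R w) - f (x + t *\<^sub>R v) - f (x + t *\<^sub>R w) + f x
      - t^2 *\<^sub>R frechet_derivative (\<lambda>z. frechet_derivative f (at z) w) (at x) v) \<le> C * t^3"
proof -
  define F where "F = (\<lambda>e z. frechet_derivative f (at z) e)"
  have F: "smooth_on S (F e)" for e
    unfolding F_def by (rule smooth_on_frechet_derivative[OF S(2)])
  have linF: "linear (\<lambda>e. F e z)" if "z \<in> S" for z
    unfolding F_def using linear_frechet_derivative[OF S(1,2) that] .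
  obtain L \<rho> where L: "\<rho> > 0" "ball x \<rho> \<subseteq> S" "family_bounds F (ball x \<rho>) L"
    using smooth_family_bounds[OF S(1) S(3) F linF] by blast
  have linD: "linear (\<lambda>e. frechet_derivative (F e) (at x) v)" for v
    by (rule linear_frechet_derivative_family[OF S(1) F _ S(3)]) (rule linF)
  have L0: "L \<ge> 0" using L(3) by (simp add: family_bounds_def)
  define N where "N = norm v + norm w"
  \<comment> \<open>Keeps all corners of the parallelogram in the ball; the added 1 avoids division
    by 0 when \<open>v\<close> and \<open>w\<close> vanish.\<close>
  define \<tau> where "\<tau> = \<rho> / (N + 1)"
  have N: "N \<ge> 0" by (simp add: N_def)
  have \<tau>: "\<tau> > 0" using L N by (simp add: \<tau>_def)
  have main: "norm (f (x + t *\<^sub>R v + t *\<^sub>R w) - f (x + t *\<^sub>R v) - f (x + t *\<^sub>R w) + f x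
      - t^2 *\<^sub>R frechet_derivative (F w) (at x) v) \<le> (2 * L * N^2 * norm w) * t^3"
    if t: "0 < t" "t < \<tau>" for t
  proof -
    have tN: "t * N < \<rho>"
    proof -
      have "t * N \<le> t * (N + 1)" using t by simp
      also have "\<dots> < \<rho>" using t N by (simp add: \<tau>_def pos_less_divide_eq)
      finally show ?thesis .
    qed
    \<comment> \<open>The subtracted term uses the point \<open>z\<close> as a direction. It is
      linear in \<open>z\<close>, so its increment from \<open>x\<close> to
      \<open>x + t *\<^sub>R w\<close> is exactly t^2 times the second derivative.\<close>
    define k where "k z = f (z + t *\<^sub>R v) - f z - t *\<^sub>R frechet_derivative (F z) (at x) v" for z
    have seg: "norm (z - x) \<le> t * norm w" if "z \<in> closed_segment x (x + t *\<^sub>R w)" for z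
      using segment_bound(1)[OF that] t by simp
    have tvN: "t * norm v \<le> t * N" "t * norm w \<le> t * N" "t * norm w + t * norm v = t * N"
      using t by (auto simp: N_def algebra_simps)
    have n1: "norm (z - x) \<le> t * N" "norm (z + t *\<^sub>R v - x) \<le> t * N"
      if "z \<in> closed_segment x (x + t *\<^sub>R w)" for z
    proof -
      show "norm (z - x) \<le> t * N" using seg[OF that] tvN by linarith
      have "norm (z + t *\<^sub>R v - x) \<le> norm (z - x) + norm (t *\<^sub>R v)"
        by (metis add_diff_eq add.commute norm_triangle_ineq diff_add_eq)
      then show "norm (z + t *\<^sub>R v - x) \<le> t * N" using seg[OF that] t tvN by simp
    qed
    have inS: "z \<in> ball x \<rho>" "z + t *\<^sub>R v \<in> ball x \<rho>"
      if "z \<in> closed_segment x (x + t *\<^sub>R w)" for z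
      using n1[OF that] tN by (auto simp: dist_norm norm_minus_commute)
    have est: "norm (F h z - F h x - frechet_derivative (F h) (at x) (z - x)) \<le> L * (t * N)^2 * norm h"
      if "z \<in> ball x \<rho>" "norm (z - x) \<le> t * N" for z h
    proof -
      have "norm (F h z - F h x - frechet_derivative (F h) (at x) (z - x)) \<le> L * norm (z - x)^2 * norm h"
        using L(1,3) that by (simp add: family_bounds_def)
      also have "\<dots> \<le> L * (t * N)^2 * norm h"
        using that L0 by (intro mult_right_mono mult_left_mono power_mono) auto
      finally show ?thesis .
    qed
    have linx: "linear (frechet_derivative (F h) (at x))" for h
      using linear_frechet_derivative[OF S(1) F S(3)] .
    have "norm (k (x + t *\<^sub>R w) - k x) \<le> (2 * L * (t * N)^2) * norm ((x + t *\<^sub>R w) - x)"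
    proof (rule differentiable_bound[where S = "closed_segment x (x + t *\<^sub>R w)"
          and f' = "\<lambda>z h. F h (z + t *\<^sub>R v) - F h z - t *\<^sub>R frechet_derivative (F h) (at x) v"])
      fix z assume z: "z \<in> closed_segment x (x + t *\<^sub>R w)"
      have D: "(f has_derivative (\<lambda>h. F h z)) (at z)" if "z \<in> S" for z
        unfolding F_def using smooth_on_has_derivative[OF S(1,2) that] .
      have zS: "z \<in> S" "z + t *\<^sub>R v \<in> S" using inS[OF z] L(2) by blast+
      have "((\<lambda>z. z + t *\<^sub>R v) has_derivative (\<lambda>h. h)) (at z)"
        by (auto intro!: derivative_eq_intros)
      from has_derivative_compose[OF this D[OF zS(2)]]
      have "((\<lambda>z. f (z + t *\<^sub>R v)) has_derivative (\<lambda>h. F h (z + t *\<^sub>R v))) (at z)" .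
      moreover have "((\<lambda>z. frechet_derivative (F z) (at x) v) has_derivative
          (\<lambda>h. frechet_derivative (F h) (at x) v)) (at z)"
        by (rule linear_imp_has_derivative) (use linD in auto)
      ultimately have "(k has_derivative
          (\<lambda>h. F h (z + t *\<^sub>R v) - F h z - t *\<^sub>R frechet_derivative (F h) (at x) v)) (at z)"
        unfolding k_def by (intro has_derivative_diff has_derivative_scaleR_right D zS)
      then show "(k has_derivative
          (\<lambda>h. F h (z + t *\<^sub>R v) - F h z - t *\<^sub>R frechet_derivative (F h) (at x) v))
          (at z within closed_segment x (x + t *\<^sub>R w))"
        by (rule has_derivative_at_withinI)
      show "onorm (\<lambda>h. F h (z + t *\<^sub>R v) - F h z - t *\<^sub>R frechet_derivative (F h) (at x) v)
          \<le> 2 * L * (t * N)^2"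
      proof (rule onorm_bound)
        fix h
        \<comment> \<open>A difference of two first order Taylor remainders of \<open>F h\<close> at
          \<open>x\<close>, one for each end of the side \<open>t *\<^sub>R v\<close>; hence the
          factor 2.\<close>
        have "F h (z + t *\<^sub>R v) - F h z - t *\<^sub>R frechet_derivative (F h) (at x) v
          = (F h (z + t *\<^sub>R v) - F h x - frechet_derivative (F h) (at x) (z + t *\<^sub>R v - x))
            - (F h z - F h x - frechet_derivative (F h) (at x) (z - x))"
          by (simp add: linear_add[OF linx] linear_diff[OF linx] linear_scale[OF linx])
        also have "norm \<dots> \<le> L * (t * N)^2 * norm h + L * (t * N)^2 * norm h"
          by (intro norm_triangle_le_diff add_mono est inS n1 z)
        finally show "norm (F h (z + t *\<^sub>R v) - F h z - t *\<^sub>R frechet_derivative (F h) (at x) v)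
            \<le> 2 * L * (t * N)^2 * norm h" by (simp add: ac_simps)
      qed (use L0 in auto)
    qed (auto simp: convex_closed_segment)
    also have "k (x + t *\<^sub>R w) - k x = f (x + t *\<^sub>R v + t *\<^sub>R w) - f (x + t *\<^sub>R v) - f (x + t *\<^sub>R w) + f x
      - t^2 *\<^sub>R frechet_derivative (F w) (at x) v"
      using linear_add[OF linD] linear_scale[OF linD]
      by (simp add: k_def algebra_simps power2_eq_square)
    finally show ?thesis
      using t by (simp add: power_mult_distrib power2_eq_square power3_eq_cube ac_simps)
  qed
  show ?thesis
    using \<tau> main by (intro exI[of _ \<tau>] exI[of _ "2 * L * N^2 * norm w"]) (auto simp: F_def)
qed

text \<open>Schwarz's theorem: the second difference does not change when \<open>v\<close> and
  \<open>w\<close> are exchanged, so the two second derivatives differ by O(t) for all small t >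
  0.\<close>

lemma smooth_on_symmetric_second_derivative:
  fixes f :: "'a::euclidean_space \<Rightarrow> 'b::real_normed_vector"
  assumes S: "open S" "smooth_on S f" "x \<in> S"
  shows "frechet_derivative (\<lambda>z. frechet_derivative f (at z) w) (at x) v
    = frechet_derivative (\<lambda>z. frechet_derivative f (at z) v) (at x) w" (is "?A = ?B")
proof -
  obtain C \<tau> where 1: "\<tau> > 0" "\<forall>t. 0 < t \<longrightarrow> t < \<tau> \<longrightarrow>
    norm (f (x + t *\<^sub>R v + t *\<^sub>R w) - f (x + t *\<^sub>R v) - f (x + t *\<^sub>R w) + f x - t^2 *\<^sub>R ?A) \<le> C * t^3"
    using smooth_on_second_difference[OF S] by blast
  obtain C' \<tau>' where 2: "\<tau>' > 0" "\<forall>t. 0 < t \<longrightarrow> t < \<tau>' \<longrightarrow>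
    norm (f (x + t *\<^sub>R w + t *\<^sub>R v) - f (x + t *\<^sub>R w) - f (x + t *\<^sub>R v) + f x - t^2 *\<^sub>R ?B) \<le> C' * t^3"
    using smooth_on_second_difference[OF S] by blast
  have "norm (?A - ?B) \<le> (C + C') * t" if t: "0 < t" "t < min \<tau> \<tau>'" for t
  proof -
    have "t^2 * norm (?A - ?B) = norm (t^2 *\<^sub>R ?A - t^2 *\<^sub>R ?B)"
      by (simp flip: scaleR_diff_right)
    also have "\<dots> = norm ((f (x + t *\<^sub>R w + t *\<^sub>R v) - f (x + t *\<^sub>R w) - f (x + t *\<^sub>R v) + f x - t^2 *\<^sub>R ?B)
      - (f (x + t *\<^sub>R v + t *\<^sub>R w) - f (x + t *\<^sub>R v) - f (x + t *\<^sub>R w) + f x - t^2 *\<^sub>R ?A))"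
      by (simp add: algebra_simps)
    also have "\<dots> \<le> C' * t^3 + C * t^3"
      using 1(2)[rule_format, of t] 2(2)[rule_format, of t] t
      by (intro norm_triangle_le_diff[OF add_mono]) simp_all
    also have "\<dots> = t^2 * ((C + C') * t)" by (simp add: algebra_simps power2_eq_square power3_eq_cube)
    finally show ?thesis using t by simp
  qed
  then have "\<forall>\<^sub>F t in at_right 0. norm (?A - ?B) \<le> (C + C') * t"
    using 1 2 by (intro eventually_at_rightI[of 0 "min \<tau> \<tau>'"]) auto
  moreover have "((\<lambda>t. (C + C') * t) \<longlongrightarrow> (C + C') * 0) (at_right (0::real))"
    by (intro tendsto_intros)
  ultimately have "norm (?A - ?B) \<le> (C + C') * 0"
    by (intro tendsto_le[OF _ _ tendsto_const]) auto
  then show ?thesis by simp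
qed

text \<open>Differentiating the normalisation of \<open>\<phi>\<close> along
  the diagonal expresses the pure second derivative in the second variable, which is what the Taylor
  expansion needs, by the mixed one, which is what the compatibility tensor contains.\<close>

lemma normalized_mixed_derivative:
  fixes \<phi> :: "'e::euclidean_space \<times> 'e \<Rightarrow> 'e"
  assumes S: "open S" "smooth_on S \<phi>" "(a, a) \<in> S"
    and id: "\<And>b e. (b, b) \<in> S \<Longrightarrow> frechet_derivative \<phi> (at (b, b)) (0, e) = e"
  shows "frechet_derivative (\<lambda>z. frechet_derivative \<phi> (at z) (0, e)) (at (a, a)) (v, 0)
      = - frechet_derivative (\<lambda>z. frechet_derivative \<phi> (at z) (0, e)) (at (a, a)) (0, v)"
proof -
  let ?H = "\<lambda>z. frechet_derivative \<phi> (at z) (0, e)"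
  have D: "(?H has_derivative frechet_derivative ?H (at (a, a))) (at (a, a))"
    by (rule smooth_on_has_derivative[OF S(1) smooth_on_frechet_derivative[OF S(2)] S(3)])
  have "((\<lambda>b. ?H (b, b)) has_derivative (\<lambda>v. frechet_derivative ?H (at (a, a)) (v, v))) (at a)"
    by (rule has_derivative_compose[where f = "\<lambda>b. (b, b)" and g = ?H, simplified, OF _ D])
      (auto intro!: derivative_eq_intros)
  moreover have "open ((\<lambda>b. (b, b)) -` S)"
    by (intro open_vimage S continuous_intros)
  ultimately have "((\<lambda>b. e) has_derivative (\<lambda>v. frechet_derivative ?H (at (a, a)) (v, v))) (at a)"
    by (rule has_derivative_transform_within_open) (use S id in auto)
  from fun_cong[OF has_derivative_unique[OF this has_derivative_const], of v]
  have "frechet_derivative ?H (at (a, a)) (v, v) = 0" .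
  moreover have "frechet_derivative ?H (at (a, a)) (v, v)
      = frechet_derivative ?H (at (a, a)) (v, 0) + frechet_derivative ?H (at (a, a)) (0, v)"
    using linear_add[OF has_derivative_linear[OF D], of "(v, 0)" "(0, v)"] by simp
  ultimately show ?thesis by (simp add: eq_neg_iff_add_eq_0)
qed

text \<open>Up to sign the mixed derivative is the pure second derivative in the second variable,
  which is symmetric by Schwarz's theorem.\<close>

lemma normalized_mixed_derivative_symmetric:
  fixes \<phi> :: "'e::euclidean_space \<times> 'e \<Rightarrow> 'e"
  assumes S: "open S" "smooth_on S \<phi>" "(a, a) \<in> S"
    and id: "\<And>b e. (b, b) \<in> S \<Longrightarrow> frechet_derivative \<phi> (at (b, b)) (0, e) = e"
  shows "frechet_derivative (\<lambda>z. frechet_derivative \<phi> (at z) (0, e)) (at (a, a)) (v, 0)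
      = frechet_derivative (\<lambda>z. frechet_derivative \<phi> (at z) (0, v)) (at (a, a)) (e, 0)"
  using normalized_mixed_derivative[OF S id] smooth_on_symmetric_second_derivative[OF S]
  by metis

text \<open>Taylor's formula in the second variable only, based at (a, a): the value is 0, the first
  derivative is the identity, and the second derivative is rewritten as minus the mixed one.\<close>

lemma normalized_taylor:
  fixes \<phi> :: "'e::euclidean_space \<times> 'e \<Rightarrow> 'e"
  assumes S: "open S" "smooth_on S \<phi>" "(a0, a0) \<in> S"
    and zero: "\<And>b. (b, b) \<in> S \<Longrightarrow> \<phi> (b, b) = 0"
    and id: "\<And>b e. (b, b) \<in> S \<Longrightarrow> frechet_derivative \<phi> (at (b, b)) (0, e) = e"
  shows "\<exists>C\<ge>0. \<forall>\<^sub>F (a, b) in nhds (a0, a0). norm (\<phi> (a, b) - (b - a)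
    + (1/2) *\<^sub>R frechet_derivative (\<lambda>z. frechet_derivative \<phi> (at z) (0, b - a)) (at (a, a)) (b - a, 0))
      \<le> C * norm (b - a)^3"
proof -
  define H where "H = (\<lambda>e z. frechet_derivative \<phi> (at z) (0, e))"
  have H: "smooth_on S (H e)" for e
    unfolding H_def by (rule smooth_on_frechet_derivative[OF S(2)])
  have linH: "linear (\<lambda>e. H e z)" if "z \<in> S" for z
    unfolding H_def
    by (rule linear_compose[OF _ linear_frechet_derivative[OF S(1,2) that], unfolded o_def])
      (auto intro!: linearI)
  obtain L \<rho> where L: "\<rho> > 0" "ball (a0, a0) \<rho> \<subseteq> S" "family_bounds H (ball (a0, a0) \<rho>) L"
    using smooth_family_bounds[OF S(1) S(3) H linH] by blast
  have L0: "L \<ge> 0" using L(3) by (simp add: family_bounds_def)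
  have main: "norm (\<phi> (a, b) - (b - a) + (1/2) *\<^sub>R frechet_derivative (H (b - a)) (at (a, a)) (b - a, 0))
      \<le> L * norm (b - a)^3"
    \<comment> \<open>Half the radius: a pair whose two coordinates are closer than
      \<open>\<rho>/2\<close> to \<open>a0\<close> stays in the ball of radius \<rho>, so (a, a) and
      the whole segment to (a, b) lie in it.\<close>
    if ab: "(a, b) \<in> ball (a0, a0) (\<rho>/2)" for a b
  proof -
    define v where "v = b - a"
    define M where "M = frechet_derivative (H v) (at (a, a)) (v, 0)"
    have d: "dist a0 a < \<rho>/2" "dist a0 b < \<rho>/2"
      using ab dist_fst_le[of "(a0, a0)" "(a, b)"] dist_snd_le[of "(a0, a0)" "(a, b)"] by auto
    have inb: "(a, a + t *\<^sub>R v) \<in> ball (a0, a0) \<rho>" if "t \<in> {0..1}" for t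
    proof -
      have "a + t *\<^sub>R v \<in> closed_segment a b"
        using that unfolding v_def closed_segment_def by (intro CollectI exI[of _ t]) (simp add: algebra_simps)
      also have "\<dots> \<subseteq> ball a0 (\<rho>/2)" using d by (intro closed_segment_subset) auto
      finally have "dist a0 (a + t *\<^sub>R v) < \<rho>/2" by simp
      then have "dist (a0, a0) (a, a + t *\<^sub>R v) < \<rho>/2 + \<rho>/2"
        unfolding dist_Pair_Pair using d(1)
        by (intro le_less_trans[OF sqrt_sum_squares_le_sum] add_strict_mono) auto
      then show ?thesis by simp
    qed
    have aa: "(a, a) \<in> S" "(a, a) \<in> ball (a0, a0) \<rho>" using inb[of 0] L(2) by auto
    have lin: "linear (frechet_derivative (H v) (at (a, a)))"
      by (rule linear_frechet_derivative[OF S(1) H aa(1)])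
    \<comment> \<open>The remainder along the segment. Its derivative is the first order Taylor
      remainder of \<open>H v\<close> between (a, a) and (a, a + t v), because
      \<open>H v (a, a)\<close> is \<open>v\<close> and the derivative of \<open>H v\<close> in the
      direction (0, t v) is -t M.\<close>
    define r where "r t = \<phi> (a, a + t *\<^sub>R v) - t *\<^sub>R v + (t^2/2) *\<^sub>R M" for t :: real
    have "norm (r 1 - r 0) \<le> (L * norm v^3) * norm (1 - 0 :: real)"
    proof (rule differentiable_bound[where S = "{0..1}"
          and f' = "\<lambda>t h. h *\<^sub>R (H v (a, a + t *\<^sub>R v) - v + t *\<^sub>R M)"])
      fix t :: real assume t: "t \<in> {0..1}"
      then have S': "(a, a + t *\<^sub>R v) \<in> S" using inb L(2) by auto
      have "((\<lambda>t. \<phi> (a, a + t *\<^sub>R v)) has_derivative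
          (\<lambda>h. frechet_derivative \<phi> (at (a, a + t *\<^sub>R v)) (0, h *\<^sub>R v))) (at t within {0..1})"
      proof -
        have "((\<lambda>t. (a, a + t *\<^sub>R v)) has_derivative (\<lambda>h. (0, h *\<^sub>R v))) (at t within {0..1})"
          by (auto intro!: derivative_eq_intros)
        from has_derivative_compose[OF this smooth_on_has_derivative[OF S(1,2) S']] show ?thesis .
      qed
      moreover have "frechet_derivative \<phi> (at (a, a + t *\<^sub>R v)) (0, h *\<^sub>R v) = h *\<^sub>R H v (a, a + t *\<^sub>R v)" for h
        using linear_scale[OF linH[OF S']] by (simp add: H_def)
      ultimately show "(r has_derivative (\<lambda>h. h *\<^sub>R (H v (a, a + t *\<^sub>R v) - v + t *\<^sub>R M))) (at t within {0..1})"
        unfolding r_def by (auto intro!: derivative_eq_intros simp: algebra_simps)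
      have "frechet_derivative (H v) (at (a, a)) (0, t *\<^sub>R v) = - (t *\<^sub>R M)"
        using normalized_mixed_derivative[OF S(1,2) aa(1) id, of v v]
          linear_scale[OF lin, of t "(0, v)"]
        by (simp add: M_def H_def)
      then have e: "H v (a, a + t *\<^sub>R v) - v + t *\<^sub>R M
          = H v (a, a + t *\<^sub>R v) - H v (a, a) - frechet_derivative (H v) (at (a, a)) ((a, a + t *\<^sub>R v) - (a, a))"
        using id[OF aa(1)] by (simp add: H_def)
      have "norm (H v (a, a + t *\<^sub>R v) - v + t *\<^sub>R M) \<le> L * norm ((a, a + t *\<^sub>R v) - (a, a))^2 * norm v"
        unfolding e using L(3) inb[OF t] aa(2) unfolding family_bounds_def by blast
      also have "\<dots> = L * (t^2 * norm v^3)"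
        by (simp add: norm_prod_def power_mult_distrib power2_eq_square power3_eq_cube)
      also have "\<dots> \<le> L * (1 * norm v^3)"
        using t L0 by (intro mult_left_mono mult_right_mono power_le_one) auto
      finally show "onorm (\<lambda>h. h *\<^sub>R (H v (a, a + t *\<^sub>R v) - v + t *\<^sub>R M)) \<le> L * norm v^3"
        by (intro onorm_bound) (auto simp: L0 mult.commute[of _ "\<bar>_\<bar>"] intro: mult_left_mono)
    qed auto
    then show ?thesis using zero[OF aa(1)] by (simp add: r_def v_def M_def)
  qed
  have "\<forall>\<^sub>F z in nhds (a0, a0). z \<in> ball (a0, a0) (\<rho>/2)"
    using L(1) by (intro eventually_nhds_in_open) auto
  then show ?thesis using main L0
    by (intro exI[of _ L] conjI) (auto elim!: eventually_mono simp: H_def)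
qed

section \<open>Charts and tangent spaces\<close>

lemma scaleR_fun_apply [simp]: "(r *\<^sub>R f) x = r *\<^sub>R f x"
  by (simp add: scaleR_fun_def)

lemma sum_fun_apply: "(\<Sum>i\<in>I. f i) x = (\<Sum>i\<in>I. f i x)"
  by (induction I rule: infinite_finite_induct) auto

locale smooth_manifold =
  fixes A :: "('m::{t2_space,second_countable_topology}, 'e::euclidean_space) chart set"
  assumes atlas: "smooth_atlas A"
begin

lemma open_chart: "c \<in> A \<Longrightarrow> open (fst c)" "c \<in> A \<Longrightarrow> open (crange c)"
  and homeomorphism_chart: "c \<in> A \<Longrightarrow> homeomorphism (fst c) (crange c) (snd c) (cinv c)"
  using atlas by (auto simp: smooth_atlas_def)

lemma cinv_chart: "c \<in> A \<Longrightarrow> m \<in> fst c \<Longrightarrow> cinv c (snd c m) = m"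
  using homeomorphism_chart homeomorphism_apply1 by blast

lemma chart_cinv: "c \<in> A \<Longrightarrow> a \<in> crange c \<Longrightarrow> snd c (cinv c a) = a"
  using homeomorphism_chart homeomorphism_apply2 by blast

lemma chart_in_crange: "m \<in> fst c \<Longrightarrow> snd c m \<in> crange c"
  by (auto simp: crange_def)

lemma cinv_in_chart: "c \<in> A \<Longrightarrow> a \<in> crange c \<Longrightarrow> cinv c a \<in> fst c"
  by (auto simp: crange_def cinv_chart)

lemma continuous_chart: "c \<in> A \<Longrightarrow> continuous_on (fst c) (snd c)"
  and continuous_cinv: "c \<in> A \<Longrightarrow> continuous_on (crange c) (cinv c)"
  using homeomorphism_chart by (auto simp: homeomorphism_def)

lemma exists_chart: obtains c where "c \<in> charts_at A m"
proof -
  have "m \<in> (\<Union>c\<in>A. fst c)" using atlas by (simp add: smooth_atlas_def)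
  then show thesis using that by (auto simp: charts_at_def)
qed

lemma open_cinv_vimage:
  assumes "c \<in> A" "open N"
  shows "open {a \<in> crange c. cinv c a \<in> N}"
proof -
  have "open (crange c \<inter> cinv c -` N)"
    by (rule continuous_open_preimage[OF continuous_cinv open_chart(2) assms(2)]) (rule assms(1))+
  moreover have "crange c \<inter> cinv c -` N = {a \<in> crange c. cinv c a \<in> N}" by auto
  ultimately show ?thesis by simp
qed

lemma overlap_eq:
  assumes "c \<in> A"
  shows "snd c ` (fst c \<inter> N) = {a \<in> crange c. cinv c a \<in> N}"
proof (intro subset_antisym subsetI)
  fix a assume "a \<in> {a \<in> crange c. cinv c a \<in> N}"
  then have "cinv c a \<in> fst c \<inter> N" "a = snd c (cinv c a)"
    using assms by (auto simp: cinv_in_chart chart_cinv)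
  then show "a \<in> snd c ` (fst c \<inter> N)" by blast
qed (use assms in \<open>auto simp: cinv_chart chart_in_crange\<close>)

abbreviation transition_deriv :: "('m, 'e) chart \<Rightarrow> ('m, 'e) chart \<Rightarrow> 'm \<Rightarrow> 'e \<Rightarrow> 'e" where
  "transition_deriv c c' m \<equiv> frechet_derivative (snd c' \<circ> cinv c) (at (snd c m))"

lemma transition_has_derivative:
  assumes "c \<in> charts_at A m" "c' \<in> charts_at A m"
  shows "((snd c' \<circ> cinv c) has_derivative transition_deriv c c' m) (at (snd c m))"
proof (rule smooth_on_has_derivative)
  have c: "c \<in> A" "c' \<in> A" "m \<in> fst c" "m \<in> fst c'" using assms by (auto simp: charts_at_def)
  show "smooth_on (snd c ` (fst c \<inter> fst c')) (snd c' \<circ> cinv c)"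
    using atlas c by (simp add: smooth_atlas_def)
  show "open (snd c ` (fst c \<inter> fst c'))"
    unfolding overlap_eq[OF c(1)] by (rule open_cinv_vimage) (auto intro: c open_chart)
  show "snd c m \<in> snd c ` (fst c \<inter> fst c')" using c by blast
qed

lemma linear_transition:
  "c \<in> charts_at A m \<Longrightarrow> c' \<in> charts_at A m \<Longrightarrow> linear (transition_deriv c c' m)"
  using transition_has_derivative has_derivative_linear by blast

lemma eventually_cinv:
  assumes "c \<in> charts_at A m" "open N" "m \<in> N"
  shows "\<forall>\<^sub>F a in nhds (snd c m). a \<in> crange c \<and> cinv c a \<in> N"
proof -
  have c: "c \<in> A" "m \<in> fst c" using assms by (auto simp: charts_at_def)
  have "\<forall>\<^sub>F a in nhds (snd c m). a \<in> {a \<in> crange c. cinv c a \<in> N}"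
    by (rule eventually_nhds_in_open[OF open_cinv_vimage[OF c(1) assms(2)]])
      (use c assms(3) in \<open>auto simp: chart_in_crange cinv_chart\<close>)
  then show ?thesis by simp
qed

lemma has_derivative_transform_nhds:
  fixes f g :: "'a::real_normed_vector \<Rightarrow> 'b::real_normed_vector"
  assumes "(f has_derivative f') (at x)" "\<forall>\<^sub>F y in nhds x. g y = f y"
  shows "(g has_derivative f') (at x)"
proof -
  obtain S where "open S" "x \<in> S" "\<And>y. y \<in> S \<Longrightarrow> g y = f y"
    using assms(2) unfolding eventually_nhds by blast
  then show ?thesis
    using has_derivative_transform_within_open[OF assms(1), of S g] by simp
qed

text \<open>The chain rule for the germ of \<open>h\<close> at \<open>m\<close>: its coordinate
  expression \<open>k\<close> is known in a convenient chart \<open>c\<close>, while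
  \<open>dir_deriv\<close> evaluates in a chart selected by choice.\<close>

lemma has_derivative_change_chart:
  assumes "c0 \<in> charts_at A m" "c \<in> charts_at A m"
    and "(k has_derivative k') (at (snd c m))"
    and "\<forall>\<^sub>F a in nhds (snd c m). h (cinv c a) = k a"
  shows "((h \<circ> cinv c0) has_derivative (\<lambda>e. k' (transition_deriv c0 c m e))) (at (snd c0 m))"
proof -
  have c: "c \<in> A" "c0 \<in> A" "m \<in> fst c" "m \<in> fst c0" using assms(1,2) by (auto simp: charts_at_def)
  have D: "((snd c \<circ> cinv c0) has_derivative transition_deriv c0 c m) (at (snd c0 m))"
    by (rule transition_has_derivative[OF assms(1,2)])
  have eq: "(snd c \<circ> cinv c0) (snd c0 m) = snd c m" using c by (simp add: cinv_chart)
  have "(k has_derivative k') (at ((snd c \<circ> cinv c0) (snd c0 m)))" using assms(3) eq by simp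
  from has_derivative_compose[OF D this]
  have 1: "((\<lambda>a. k ((snd c \<circ> cinv c0) a)) has_derivative (\<lambda>e. k' (transition_deriv c0 c m e))) (at (snd c0 m))" .
  have "((snd c \<circ> cinv c0) \<longlongrightarrow> snd c m) (nhds (snd c0 m))"
    using has_derivative_continuous[OF D] eq by (simp add: isCont_def tendsto_nhds_iff)
  from eventually_compose_filterlim[OF assms(4) this]
  have "\<forall>\<^sub>F a in nhds (snd c0 m). h (cinv c ((snd c \<circ> cinv c0) a)) = k ((snd c \<circ> cinv c0) a)" .
  moreover have "\<forall>\<^sub>F a in nhds (snd c0 m). a \<in> crange c0 \<and> cinv c0 a \<in> fst c"
    by (rule eventually_cinv[OF assms(1) open_chart(1)]) (use c in auto)
  ultimately have "\<forall>\<^sub>F a in nhds (snd c0 m). (h \<circ> cinv c0) a = k ((snd c \<circ> cinv c0) a)"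
    by eventually_elim (use c in \<open>auto simp: cinv_chart\<close>)
  with 1 show ?thesis by (rule has_derivative_transform_nhds)
qed

lemma transition_deriv_refl:
  assumes "c \<in> charts_at A m"
  shows "transition_deriv c c m e = e"
proof -
  have c: "c \<in> A" "m \<in> fst c" using assms by (auto simp: charts_at_def)
  have "((\<lambda>a. a) has_derivative (\<lambda>e. e)) (at (snd c m))" by simp
  moreover have "\<forall>\<^sub>F a in nhds (snd c m). (snd c \<circ> cinv c) a = a"
    using eventually_cinv[OF assms open_UNIV] by (auto elim!: eventually_mono simp: chart_cinv c)
  ultimately have "((snd c \<circ> cinv c) has_derivative (\<lambda>e. e)) (at (snd c m))"
    by (rule has_derivative_transform_nhds)
  from frechet_derivative_at[OF this] show ?thesis by metis
qed

lemma transition_deriv_compose: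
  assumes "c \<in> charts_at A m" "c' \<in> charts_at A m" "c'' \<in> charts_at A m"
  shows "transition_deriv c' c'' m (transition_deriv c c' m e) = transition_deriv c c'' m e"
proof -
  have "((snd c'' \<circ> cinv c) has_derivative (\<lambda>e. transition_deriv c' c'' m (transition_deriv c c' m e))) (at (snd c m))"
    by (rule has_derivative_change_chart[OF assms(1,2) transition_has_derivative[OF assms(2,3)]]) simp
  from frechet_derivative_at[OF this] show ?thesis by metis
qed

lemma coord_vec_in_tangent_space:
  assumes "c \<in> charts_at A m"
  shows "coord_vec A c m e \<in> tangent_space A m"
  using assms by (simp add: tangent_space_def coord_vec_def transition_deriv_compose)

lemma coord_vec_self: "c \<in> charts_at A m \<Longrightarrow> coord_vec A c m e c = e"
  by (simp add: coord_vec_def transition_deriv_refl)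

lemma tangent_space_transition:
  assumes "v \<in> tangent_space A m" "c \<in> charts_at A m" "c' \<in> charts_at A m"
  shows "transition_deriv c c' m (v c) = v c'"
proof -
  have "\<forall>c\<in>charts_at A m. \<forall>c'\<in>charts_at A m. v c' = transition_deriv c c' m (v c)"
    using assms(1) unfolding tangent_space_def by blast
  from bspec[OF bspec[OF this assms(2)] assms(3)] show ?thesis by (rule sym)
qed

lemma tangent_space_outside: "v \<in> tangent_space A m \<Longrightarrow> c \<notin> charts_at A m \<Longrightarrow> v c = 0"
  unfolding tangent_space_def by blast

lemma coord_vec_of:
  assumes "c \<in> charts_at A m" "v \<in> tangent_space A m"
  shows "coord_vec A c m (v c) = v"
proof
  fix c'
  show "coord_vec A c m (v c) c' = v c'"
    unfolding coord_vec_def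
    using tangent_space_transition[OF assms(2,1)] tangent_space_outside[OF assms(2)] by simp
qed

lemma tangent_eqI:
  assumes "c \<in> charts_at A m" "v \<in> tangent_space A m" "w \<in> tangent_space A m" "v c = w c"
  shows "v = w"
proof -
  have "v = coord_vec A c m (v c)" by (rule coord_vec_of[OF assms(1,2), symmetric])
  also have "\<dots> = coord_vec A c m (w c)" by (simp only: assms(4))
  also have "\<dots> = w" by (rule coord_vec_of[OF assms(1,3)])
  finally show ?thesis .
qed

lemma linear_coord_vec_apply:
  assumes "c \<in> charts_at A m"
  shows "linear (\<lambda>e. coord_vec A c m e c')"
  unfolding coord_vec_def using linear_transition[OF assms]
  by (cases "c' \<in> charts_at A m") (auto intro: linear_zero)

lemma linear_coord_vec:
  assumes "c \<in> charts_at A m"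
  shows "linear (coord_vec A c m)"
  using linear_add[OF linear_coord_vec_apply[OF assms]] linear_scale[OF linear_coord_vec_apply[OF assms]]
  by (intro linearI) (auto simp: fun_eq_iff)

lemma subspace_tangent_space: "subspace (tangent_space A m)"
proof -
  obtain c where c: "c \<in> charts_at A m" using exists_chart .
  have "tangent_space A m = range (coord_vec A c m)"
    using coord_vec_in_tangent_space[OF c] coord_vec_of[OF c] by (auto intro: range_eqI[OF sym])
  then show ?thesis
    using linear_subspace_image[OF linear_coord_vec[OF c] subspace_UNIV] by simp
qed

lemma tangent_linearD:
  assumes "tangent_linear A m f"
  shows "v \<in> tangent_space A m \<Longrightarrow> w \<in> tangent_space A m \<Longrightarrow> f (v + w) = f v + f w"
    and "v \<in> tangent_space A m \<Longrightarrow> f (r *\<^sub>R v) = r *\<^sub>R f v"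
  using assms by (auto simp: tangent_linear_def)

lemma tangent_linear_coord_vec:
  assumes "tangent_linear A m f" "c \<in> charts_at A m"
  shows "linear (\<lambda>e. f (coord_vec A c m e))"
  using tangent_linearD[OF assms(1)] coord_vec_in_tangent_space[OF assms(2)]
  by (intro linearI) (auto simp: linear_add[OF linear_coord_vec[OF assms(2)]]
      linear_scale[OF linear_coord_vec[OF assms(2)]])

lemma dir_deriv_chart:
  assumes "c \<in> charts_at A m" "v \<in> tangent_space A m"
    and "(k has_derivative k') (at (snd c m))"
    and "\<forall>\<^sub>F a in nhds (snd c m). h (cinv c a) = k a"
  shows "dir_deriv A m v h = k' (v c)"
proof -
  define c0 where "c0 = (SOME c. c \<in> charts_at A m)"
  have c0: "c0 \<in> charts_at A m" unfolding c0_def using assms(1) by (rule someI)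
  have "frechet_derivative (h \<circ> cinv c0) (at (snd c0 m)) = (\<lambda>e. k' (transition_deriv c0 c m e))"
    using frechet_derivative_at[OF has_derivative_change_chart[OF c0 assms(1,3,4)]] by simp
  moreover have "transition_deriv c0 c m (v c0) = v c"
    by (rule tangent_space_transition[OF assms(2) c0 assms(1)])
  ultimately show ?thesis by (simp add: dir_deriv_def c0_def[symmetric])
qed

text \<open>In the fixed tangent space at \<open>m0\<close> all components are linear functions of
  the one in \<open>c0\<close>, so the derivative of a single coordinate function determines the
  componentwise derivative, and the result is again a tangent vector.\<close>

lemma tangent_deriv_chart:
  assumes "c \<in> charts_at A m" "v \<in> tangent_space A m" "c0 \<in> charts_at A m0"
    and k: "(k has_derivative k') (at (snd c m))"
    and h: "\<forall>\<^sub>F a in nhds (snd c m). h (cinv c a) = coord_vec A c0 m0 (k a)"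
  shows "tangent_deriv A m v h = coord_vec A c0 m0 (k' (v c))"
proof
  fix c'
  have "bounded_linear (\<lambda>e. coord_vec A c0 m0 e c')"
    using linear_coord_vec_apply[OF assms(3)] linear_conv_bounded_linear by blast
  from bounded_linear.has_derivative[OF this k]
  have "((\<lambda>a. coord_vec A c0 m0 (k a) c') has_derivative (\<lambda>e. coord_vec A c0 m0 (k' e) c')) (at (snd c m))" .
  moreover have "\<forall>\<^sub>F a in nhds (snd c m). h (cinv c a) c' = coord_vec A c0 m0 (k a) c'"
    using h by eventually_elim simp
  ultimately show "tangent_deriv A m v h c' = coord_vec A c0 m0 (k' (v c)) c'"
    unfolding tangent_deriv_def by (rule dir_deriv_chart[OF assms(1,2)])
qed

end

section \<open>Parallelisms and logarithms in a chart\<close>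

text \<open>Intended for the inverse of one parallelism composed with another: a quadratic error
  identifies the derivative without any smoothness of the inverse.\<close>

lemma has_derivative_quadratic:
  fixes f :: "'a::euclidean_space \<Rightarrow> 'b::real_normed_vector"
  assumes "linear f'" "\<forall>\<^sub>F x in nhds x0. norm (f x - f x0 - f' (x - x0)) \<le> C * norm (x - x0)^2"
  shows "(f has_derivative f') (at x0)"
  unfolding has_derivative_def
proof (intro conjI)
  show "bounded_linear f'" using assms(1) linear_conv_bounded_linear by blast
  have lim: "((\<lambda>x. norm (x - x0)) \<longlongrightarrow> 0) (at x0)"
  proof -
    have "((\<lambda>x. x - x0) \<longlongrightarrow> x0 - x0) (at x0)" by (intro tendsto_intros)
    from tendsto_norm[OF this] show ?thesis by simp
  qed
  have b: "norm ((f x - f x0 - f' (x - x0)) /\<^sub>R norm (x - x0)) \<le> norm (x - x0) * C"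
    if "norm (f x - f x0 - f' (x - x0)) \<le> C * norm (x - x0)^2" "x \<noteq> x0" for x
  proof -
    have "norm ((f x - f x0 - f' (x - x0)) /\<^sub>R norm (x - x0)) = norm (f x - f x0 - f' (x - x0)) / norm (x - x0)"
      by (simp add: divide_inverse)
    also have "\<dots> \<le> norm (x - x0) * C"
      using that by (simp add: pos_divide_le_eq power2_eq_square ac_simps)
    finally show ?thesis .
  qed
  have ev: "\<forall>\<^sub>F x in at x0. norm (f x - f x0 - f' (x - x0)) \<le> C * norm (x - x0)^2"
    using assms(2) eventually_nhds_conv_at by blast
  show "((\<lambda>y. (f y - f (Lim (at x0) (\<lambda>x. x)) - f' (y - Lim (at x0) (\<lambda>x. x)))
      /\<^sub>R norm (y - Lim (at x0) (\<lambda>x. x))) \<longlongrightarrow> 0) (at x0)"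
    unfolding Lim_ident_at[OF at_neq_bot]
  proof (rule tendsto_0_le[OF lim, of _ C])
    show "\<forall>\<^sub>F x in at x0. norm ((f x - f x0 - f' (x - x0)) /\<^sub>R norm (x - x0)) \<le> norm (norm (x - x0)) * C"
      using eventually_conj[OF ev eventually_neq_at_within[of x0 x0 UNIV]]
      by (rule eventually_mono) (use b in auto)
  qed
qed

text \<open>Distance at most 1/2 from the identity gives a lower bound, hence injectivity, and then
  surjectivity by equality of dimensions.\<close>

lemma near_identity:
  fixes f :: "'e::euclidean_space \<Rightarrow> 'e"
  assumes "linear f" "\<And>e. norm (f e - e) \<le> 1/2 * norm e"
  shows "norm e \<le> 2 * norm (f e)" and "inj f" and "surj f"
proof -
  show le: "norm e \<le> 2 * norm (f e)" for e
    using assms(2)[of e] norm_triangle_sub[of e "f e"] norm_minus_commute[of e "f e"] by simp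
  show "inj f" unfolding linear_injective_0[OF assms(1)]
  proof (intro allI impI)
    fix x assume "f x = 0"
    then show "x = 0" using le[of x] by simp
  qed
  then show "surj f" using linear_injective_imp_surjective assms(1) by blast
qed

text \<open>With \<open>F\<close> and \<open>G\<close> as first order parts of \<open>f\<close> and
  \<open>g\<close>, the solution of \<open>f q = g e\<close> is e + (G - F) e up to d^2. The bound 2
  for the inverse of \<open>f\<close> turns C + C into 4 C; the term 4 C^2 is \<open>f\<close> minus
  the identity acting on \<open>q - e\<close>.\<close>

lemma near_identity_solve:
  fixes f g :: "'e::euclidean_space \<Rightarrow> 'e"
  assumes f: "linear f" "\<And>e. norm (f e - e) \<le> 1/2 * norm e"
    and "0 \<le> C" "0 \<le> d"
    and f1: "\<And>e. norm (f e - e) \<le> C * d * norm e" and f2: "\<And>e. norm (f e - e - F e) \<le> C * d^2 * norm e"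
    and g1: "\<And>e. norm (g e - e) \<le> C * d * norm e" and g2: "\<And>e. norm (g e - e - G e) \<le> C * d^2 * norm e"
  shows "\<exists>q. f q = g e \<and> norm (q - e) \<le> (4 * C + 4 * C^2) * d * norm e \<and>
    norm (q - e - (G e - F e)) \<le> (2 * C + 4 * C^2) * d^2 * norm e"
proof -
  obtain q where q: "f q = g e" using near_identity(3)[OF f] by (metis surjD)
  have fr: "f (q - e) = (g e - e) - (f e - e)" using q by (simp add: linear_diff[OF f(1)])
  have "norm (q - e) \<le> 2 * norm (f (q - e))" by (rule near_identity(1)[OF f])
  also have "norm (f (q - e)) \<le> C * d * norm e + C * d * norm e"
    unfolding fr by (rule norm_triangle_le_diff[OF add_mono[OF g1 f1]])
  finally have r: "norm (q - e) \<le> 4 * C * d * norm e" by simp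
  have "q - e - (G e - F e) = ((g e - e - G e) - (f e - e - F e)) - (f (q - e) - (q - e))"
    by (simp add: fr)
  also have "norm \<dots> \<le> (C * d^2 * norm e + C * d^2 * norm e) + C * d * norm (q - e)"
    by (rule norm_triangle_le_diff[OF add_mono[OF norm_triangle_le_diff[OF add_mono[OF g2 f2]] f1]])
  also have "\<dots> \<le> (C * d^2 * norm e + C * d^2 * norm e) + C * d * (4 * C * d * norm e)"
    using r assms(3,4) by (intro add_left_mono mult_left_mono) auto
  also have "\<dots> = (2 * C + 4 * C^2) * d^2 * norm e" by (simp add: algebra_simps power2_eq_square)
  finally have "norm (q - e - (G e - F e)) \<le> (2 * C + 4 * C^2) * d^2 * norm e" .
  moreover have "4 * C * d * norm e \<le> (4 * C + 4 * C^2) * d * norm e"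
    using assms(3,4) by (intro mult_right_mono) auto
  ultimately show ?thesis using q r by (intro exI[of _ q]) auto
qed

definition par_coord where
  "par_coord A U c e z = U (cinv c (fst z)) (cinv c (snd z)) (coord_vec A c (cinv c (snd z)) e) c"

text \<open>The derivative at the diagonal in the first variable plays the role of the Christoffel symbols.\<close>

definition christoffel where
  "christoffel A U c a v e = frechet_derivative (par_coord A U c e) (at (a, a)) (v, 0)"

text \<open>The clause with 1/2 makes U(a, b) invertible with inverse of norm at most 2. Expansions
  are based at the second point \<open>b\<close>, since U(b, b) is the identity; the comparison with
  the symbols at \<open>a\<close> is needed when the tensor is moved along the path.\<close>

definition par_bounds where
  "par_bounds A U c C a b \<longleftrightarrow> (\<forall>e. norm (par_coord A U c e (a, b) - e) \<le> C * norm (a - b) * norm e \<and>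
      norm (par_coord A U c e (a, b) - e) \<le> 1/2 * norm e \<and>
      norm (par_coord A U c e (a, b) - e - christoffel A U c b (a - b) e) \<le> C * norm (a - b)^2 * norm e \<and>
      (\<forall>v. norm (christoffel A U c b v e) \<le> C * norm v * norm e \<and>
        norm (christoffel A U c a v e - christoffel A U c b v e) \<le> C * norm (a - b) * norm v * norm e))"

lemma par_bounds_mono:
  assumes "par_bounds A U c C a b" "C \<le> C'"
  shows "par_bounds A U c C' a b"
proof -
  have m: "s \<le> C' * t" if "s \<le> C * t" "t \<ge> 0" for s t
    using that mult_right_mono[OF assms(2) that(2)] by linarith
  show ?thesis
    using assms(1) unfolding par_bounds_def by (simp add: mult.assoc m)
qed

text \<open>The chart \<open>c'\<close> serves the base point and the fibre, \<open>c\<close> the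
  moving point. They may differ because smoothness of the differential has to be checked in all
  pairs of charts, also away from the diagonal.\<close>

definition log_coord where
  "log_coord \<psi> c' c z = \<psi> (cinv c' (fst z)) (cinv c (snd z)) c'"

context smooth_manifold
begin

lemma open_coord_domain:
  assumes "c \<in> A" "c' \<in> A" "open D"
  shows "open (coord_domain D c c')"
proof -
  have "continuous_on (crange c \<times> crange c') (\<lambda>z. (cinv c (fst z), cinv c' (snd z)))"
    using assms by (intro continuous_on_Pair continuous_on_compose2[OF continuous_cinv] continuous_intros) auto
  then have "open ((crange c \<times> crange c') \<inter> (\<lambda>z. (cinv c (fst z), cinv c' (snd z))) -` D)"
    using assms by (intro continuous_open_preimage open_Times open_chart) auto
  moreover have "(crange c \<times> crange c') \<inter> (\<lambda>z. (cinv c (fst z), cinv c' (snd z))) -` D = coord_domain D c c'"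
    by (auto simp: coord_domain_def)
  ultimately show ?thesis by simp
qed

lemma coord_domain_diag: "diagonal_domain D \<Longrightarrow> (a, a) \<in> coord_domain D c c \<longleftrightarrow> a \<in> crange c"
  by (auto simp: coord_domain_def diagonal_domain_def)

lemma charts_at_cinv: "c \<in> A \<Longrightarrow> a \<in> crange c \<Longrightarrow> c \<in> charts_at A (cinv c a)"
  by (simp add: charts_at_def cinv_in_chart)

lemma charts_atD: "c \<in> charts_at A m \<Longrightarrow> c \<in> A" "c \<in> charts_at A m \<Longrightarrow> m \<in> fst c"
  by (simp_all add: charts_at_def)

lemma coord_in_domain:
  assumes "(n, m) \<in> D" "c \<in> charts_at A n" "c' \<in> charts_at A m"
  shows "(snd c n, snd c' m) \<in> coord_domain D c c'"
  using assms by (auto simp: coord_domain_def charts_at_def chart_in_crange cinv_chart)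

lemma eventually_coord_domain:
  assumes "diagonal_domain D" "c \<in> A" "a \<in> crange c"
  shows "\<forall>\<^sub>F z in nhds (a, a). z \<in> coord_domain D c c"
  using assms by (intro eventually_nhds_in_open open_coord_domain) (auto simp: coord_domain_diag diagonal_domain_def)

lemma smooth_par_coord:
  assumes "parallelism A D U" "c \<in> A"
  shows "smooth_on (coord_domain D c c) (par_coord A U c e)"
  using assms by (simp add: parallelism_def par_coord_def[abs_def] case_prod_unfold)

lemma parallelism_in_tangent_space:
  "parallelism A D U \<Longrightarrow> (n, m) \<in> D \<Longrightarrow> v \<in> tangent_space A m \<Longrightarrow> U n m v \<in> tangent_space A n"
  and parallelism_tangent_linear: "parallelism A D U \<Longrightarrow> (n, m) \<in> D \<Longrightarrow> tangent_linear A m (U n m)"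
  by (auto simp: parallelism_def)

lemma linear_par_coord:
  assumes "parallelism A D U" "c \<in> A" "z \<in> coord_domain D c c"
  shows "linear (\<lambda>e. par_coord A U c e z)"
proof -
  have z: "snd z \<in> crange c" "(cinv c (fst z), cinv c (snd z)) \<in> D"
    using assms(3) by (auto simp: coord_domain_def)
  have "linear (\<lambda>e. U (cinv c (fst z)) (cinv c (snd z)) (coord_vec A c (cinv c (snd z)) e))"
    by (rule tangent_linear_coord_vec[OF parallelism_tangent_linear[OF assms(1) z(2)]
          charts_at_cinv[OF assms(2) z(1)]])
  from linear_add[OF this] linear_scale[OF this] show ?thesis
    by (intro linearI) (simp_all add: par_coord_def)
qed

lemma par_coord_diag:
  assumes "parallelism A D U" "c \<in> A" "b \<in> crange c"
  shows "par_coord A U c e (b, b) = e"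
proof -
  note c = charts_at_cinv[OF assms(2,3)]
  show ?thesis
    using assms(1) coord_vec_in_tangent_space[OF c] coord_vec_self[OF c]
    by (simp add: par_coord_def parallelism_def)
qed

lemma parallelism_coord:
  assumes "c \<in> charts_at A n" "c \<in> charts_at A m" "v \<in> tangent_space A m"
  shows "U n m v c = par_coord A U c (v c) (snd c n, snd c m)"
  using assms charts_atD by (simp add: par_coord_def cinv_chart coord_vec_of)

lemma linear_christoffel:
  assumes "parallelism A D U" "diagonal_domain D" "c \<in> A" "a \<in> crange c"
  shows "linear (\<lambda>v. christoffel A U c a v e)" and "linear (christoffel A U c a v)"
proof -
  have aa: "(a, a) \<in> coord_domain D c c" using coord_domain_diag[OF assms(2), of a c] assms(4) by blast
  have o: "open (coord_domain D c c)"
    using assms by (intro open_coord_domain) (auto simp: diagonal_domain_def)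
  have "linear (frechet_derivative (par_coord A U c e) (at (a, a)))"
    by (rule linear_frechet_derivative[OF o smooth_par_coord[OF assms(1,3)] aa])
  from linear_compose[OF _ this, of "\<lambda>v. (v, 0)"]
  show "linear (\<lambda>v. christoffel A U c a v e)"
    by (simp add: christoffel_def[abs_def] o_def linear_iff)
  show "linear (christoffel A U c a v)"
    unfolding christoffel_def[abs_def]
    by (rule linear_frechet_derivative_family[OF o smooth_par_coord[OF assms(1,3)] _ aa])
      (rule linear_par_coord[OF assms(1,3)])
qed

text \<open>Second order bounds for the matrices near (a0, a0), read along two moves: from (b, b) to
  (a, b) for the expansion of U, and from (b, b) to (a, a) for the variation of the Christoffel
  symbols.\<close>

lemma parallelism_local_bounds:
  assumes U: "parallelism A D U" "diagonal_domain D" and c: "c \<in> A" "a0 \<in> crange c"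
  shows "\<exists>C\<ge>0. \<forall>\<^sub>F (a, b) in nhds (a0, a0). par_bounds A U c C a b"
proof -
  let ?S = "coord_domain D c c"
  have o: "open ?S" using U c by (intro open_coord_domain) (auto simp: diagonal_domain_def)
  have aa: "(a0, a0) \<in> ?S" using coord_domain_diag[OF U(2), of a0 c] c by blast
  obtain \<rho> L where L: "\<rho> > 0" "ball (a0, a0) \<rho> \<subseteq> ?S" "family_bounds (par_coord A U c) (ball (a0, a0) \<rho>) L"
    using smooth_family_bounds[OF o aa smooth_par_coord[OF U(1) c(1)] linear_par_coord[OF U(1) c(1)]]
    by blast
  have L0: "L \<ge> 0" using L(3) by (simp add: family_bounds_def)
  \<comment> \<open>Two points of the ball have distance at most 2 r \<le> 1/(2 (L + 1)), so L times
    it is at most 1/2; the bound \<open>\<rho>/2\<close> puts pairs into the ball of the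
    product.\<close>
  define r where "r = min (\<rho>/2) (1 / (4 * (L + 1)))"
  have r: "r > 0" "r \<le> \<rho>/2" "r \<le> 1 / (4 * (L + 1))" using L L0 by (auto simp: r_def)
  have "\<forall>\<^sub>F z in nhds (a0, a0). z \<in> ball a0 r \<times> ball a0 r"
    using r by (intro eventually_nhds_in_open open_Times) auto
  then have "\<forall>\<^sub>F (a, b) in nhds (a0, a0). par_bounds A U c (2 * L) a b"
  proof (rule eventually_mono, unfold split_paired_all prod.case par_bounds_def, intro allI conjI)
    fix a b e v :: 'e assume "(a, b) \<in> ball a0 r \<times> ball a0 r"
    then have d: "dist a0 a < r" "dist a0 b < r" by auto
    have inb: "(p, q) \<in> ball (a0, a0) \<rho>" if "dist a0 p < r" "dist a0 q < r" for p q
    proof -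
      have "dist (a0, a0) (p, q) \<le> dist a0 p + dist a0 q"
        by (simp add: dist_Pair_Pair sqrt_sum_squares_le_sum)
      then show ?thesis using that r by simp
    qed
    have ab: "norm (a - b) \<le> 2 * r"
      using dist_triangle2[of a b a0] d by (simp add: dist_norm norm_minus_commute)
    have fb: "norm (par_coord A U c e y - par_coord A U c e x) \<le> L * norm (y - x) * norm e"
       "norm (par_coord A U c e y - par_coord A U c e x - frechet_derivative (par_coord A U c e) (at x) (y - x))
         \<le> L * norm (y - x)^2 * norm e"
       "norm (frechet_derivative (par_coord A U c e) (at x) w) \<le> L * norm w * norm e"
       "norm (frechet_derivative (par_coord A U c e) (at y) w - frechet_derivative (par_coord A U c e) (at x) w)
         \<le> L * norm (y - x) * norm w * norm e"
      if "x \<in> ball (a0, a0) \<rho>" "y \<in> ball (a0, a0) \<rho>" for x y w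
      using L(3) that unfolding family_bounds_def by blast+
    have diag: "par_coord A U c e (b, b) = e"
      by (rule par_coord_diag[OF U(1) c(1)]) (use inb[OF d(2) d(2)] L(2) in \<open>auto simp: coord_domain_def\<close>)
    have n1: "(a, b) - (b, b) = (a - b, 0)" "norm (a - b, 0::'e) = norm (a - b)"
      by (simp_all add: norm_prod_def)
    \<comment> \<open>A move along the diagonal counts at most twice, which explains the constant
      \<open>2 * L\<close>.\<close>
    have n2: "norm ((a, a) - (b, b)) \<le> 2 * norm (a - b)"
      using sqrt_sum_squares_le_sum[of "norm (a - b)" "norm (a - b)"] by (simp add: norm_prod_def)
    have b1: "norm (par_coord A U c e (a, b) - e) \<le> L * norm (a - b) * norm e"
      using fb(1)[OF inb[OF d(2) d(2)] inb[OF d(1) d(2)]] unfolding n1 diag .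
    have dbl: "L * t \<le> 2 * L * t" if "t \<ge> 0" for t using L0 that by simp
    show "norm (par_coord A U c e (a, b) - e) \<le> 2 * L * norm (a - b) * norm e"
      by (rule order_trans[OF b1]) (use dbl[of "norm (a - b) * norm e"] in \<open>simp only: mult.assoc norm_ge_zero zero_le_mult_iff simp_thms\<close>)
    have "L * norm (a - b) \<le> L * (2 * (1 / (4 * (L + 1))))"
      using ab r(3) L0 by (intro mult_left_mono) auto
    also have "\<dots> \<le> 1/2" using L0 by (simp add: field_simps)
    finally have "L * norm (a - b) * norm e \<le> 1/2 * norm e" by (intro mult_right_mono) auto
    then show "norm (par_coord A U c e (a, b) - e) \<le> 1/2 * norm e" using b1 by linarith
    have b2: "norm (par_coord A U c e (a, b) - e - christoffel A U c b (a - b) e) \<le> L * norm (a - b)^2 * norm e"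
      using fb(2)[OF inb[OF d(2) d(2)] inb[OF d(1) d(2)]] unfolding n1 diag christoffel_def .
    show "norm (par_coord A U c e (a, b) - e - christoffel A U c b (a - b) e) \<le> 2 * L * norm (a - b)^2 * norm e"
      by (rule order_trans[OF b2]) (use dbl[of "norm (a - b)^2 * norm e"] in \<open>simp only: mult.assoc norm_ge_zero zero_le_power zero_le_mult_iff simp_thms\<close>)
    have nv: "norm (v, 0::'e) = norm v" by (simp add: norm_prod_def)
    have b3: "norm (christoffel A U c b v e) \<le> L * norm v * norm e"
      using fb(3)[OF inb[OF d(2) d(2)] inb[OF d(2) d(2)], of "(v, 0)"] unfolding christoffel_def nv .
    show "norm (christoffel A U c b v e) \<le> 2 * L * norm v * norm e"
      by (rule order_trans[OF b3]) (use dbl[of "norm v * norm e"] in \<open>simp only: mult.assoc norm_ge_zero zero_le_mult_iff simp_thms\<close>)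
    have "norm (christoffel A U c a v e - christoffel A U c b v e) \<le> L * norm ((a, a) - (b, b)) * norm v * norm e"
      using fb(4)[OF inb[OF d(2) d(2)] inb[OF d(1) d(1)], of "(v, 0)"] unfolding christoffel_def nv .
    also have "\<dots> \<le> L * (2 * norm (a - b)) * norm v * norm e"
      using n2 L0 by (intro mult_right_mono mult_left_mono) auto
    finally show "norm (christoffel A U c a v e - christoffel A U c b v e) \<le> 2 * L * norm (a - b) * norm v * norm e"
      by (simp add: mult.assoc mult.left_commute)
  qed
  then show ?thesis using L0 by (intro exI[of _ "2 * L"]) auto
qed

end

lemma eventually_nhds_Pair_left:
  assumes "\<forall>\<^sub>F (a, b) in nhds (a0, b0). P a b"
  shows "\<forall>\<^sub>F a in nhds a0. P a b0"
proof -
  have "((\<lambda>a. (a, b0)) \<longlongrightarrow> (a0, b0)) (nhds a0)" by (intro tendsto_intros filterlim_ident)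
  from eventually_compose_filterlim[OF assms this] show ?thesis by simp
qed

context smooth_manifold
begin

text \<open>\<open>q\<close> is the coordinate vector of U(a, b)^-1 U'(a, b) e; the equation that it
  solves avoids writing inverses.\<close>

abbreviation compare_bounds where
  "compare_bounds U U' c C a b \<equiv> \<forall>e. \<exists>q.
     par_coord A U c q (a, b) = par_coord A U' c e (a, b) \<and> norm (q - e) \<le> C * norm (a - b) * norm e \<and>
     norm (q - e - (christoffel A U' c b (a - b) e - christoffel A U c b (a - b) e)) \<le> C * norm (a - b)^2 * norm e"

lemma parallelism_compare:
  assumes U: "parallelism A D U" "diagonal_domain D"
    and U': "parallelism A D' U'" "diagonal_domain D'"
    and c: "c \<in> A" "a0 \<in> crange c"
  shows "\<exists>C\<ge>0. \<forall>\<^sub>F (a, b) in nhds (a0, a0). compare_bounds U U' c C a b"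
proof -
  obtain C1 where C1: "C1 \<ge> 0" "\<forall>\<^sub>F (a, b) in nhds (a0, a0). par_bounds A U c C1 a b"
    using parallelism_local_bounds[OF U c] by blast
  obtain C2 where C2: "C2 \<ge> 0" "\<forall>\<^sub>F (a, b) in nhds (a0, a0). par_bounds A U' c C2 a b"
    using parallelism_local_bounds[OF U' c] by blast
  define C where "C = C1 + C2"
  have C: "C \<ge> 0" using C1 C2 by (simp add: C_def)
  define K where "K = 4 * C + 4 * C^2"
  have K: "K \<ge> 0" "2 * C + 4 * C^2 \<le> K" using C by (auto simp: K_def)
  have "\<forall>\<^sub>F z in nhds (a0, a0). z \<in> coord_domain D c c"
    by (rule eventually_coord_domain[OF U(2) c])
  with C1(2) C2(2) have "\<forall>\<^sub>F (a, b) in nhds (a0, a0). compare_bounds U U' c K a b"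
  proof (eventually_elim, unfold split_paired_all prod.case, intro allI)
    fix a b e
    assume "par_bounds A U c C1 a b" "par_bounds A U' c C2 a b" and dom: "(a, b) \<in> coord_domain D c c"
    then have b: "par_bounds A U c C a b" "par_bounds A U' c C a b"
      using C1(1) C2(1) by (auto elim!: par_bounds_mono simp: C_def)
    have "\<exists>q. par_coord A U c q (a, b) = par_coord A U' c e (a, b) \<and>
       norm (q - e) \<le> (4 * C + 4 * C^2) * norm (a - b) * norm e \<and>
       norm (q - e - (christoffel A U' c b (a - b) e - christoffel A U c b (a - b) e))
         \<le> (2 * C + 4 * C^2) * norm (a - b)^2 * norm e"
      by (rule near_identity_solve[OF linear_par_coord[OF U(1) c(1) dom]])
        (use b C in \<open>auto simp: par_bounds_def\<close>)
    then obtain q where q: "par_coord A U c q (a, b) = par_coord A U' c e (a, b)"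
       "norm (q - e) \<le> K * norm (a - b) * norm e"
       "norm (q - e - (christoffel A U' c b (a - b) e - christoffel A U c b (a - b) e))
         \<le> (2 * C + 4 * C^2) * norm (a - b)^2 * norm e"
      unfolding K_def by blast
    have "(2 * C + 4 * C^2) * (norm (a - b)^2 * norm e) \<le> K * (norm (a - b)^2 * norm e)"
      using K(2) by (intro mult_right_mono) auto
    with q show "\<exists>q. par_coord A U c q (a, b) = par_coord A U' c e (a, b) \<and> norm (q - e) \<le> K * norm (a - b) * norm e \<and>
     norm (q - e - (christoffel A U' c b (a - b) e - christoffel A U c b (a - b) e)) \<le> K * norm (a - b)^2 * norm e"
      by (intro exI[of _ q]) (simp add: mult.assoc)
  qed
  then show ?thesis using K(1) by blast
qed

lemma parallelism_factor:
  assumes U: "parallelism A D U" and U': "parallelism A D' U'"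
    and n: "c \<in> charts_at A n" and m: "c \<in> charts_at A m" and D: "(n, m) \<in> D" "(n, m) \<in> D'"
    and w: "w \<in> tangent_space A m"
    and q: "par_coord A U c q (snd c n, snd c m) = par_coord A U' c (w c) (snd c n, snd c m)"
  shows "U n m (coord_vec A c m q) = U' n m w"
proof (rule tangent_eqI[OF n])
  note cv = coord_vec_in_tangent_space[OF m]
  show "U n m (coord_vec A c m q) \<in> tangent_space A n"
    by (rule parallelism_in_tangent_space[OF U D(1) cv])
  show "U' n m w \<in> tangent_space A n"
    by (rule parallelism_in_tangent_space[OF U' D(2) w])
  show "U n m (coord_vec A c m q) c = U' n m w c"
    unfolding parallelism_coord[OF n m cv] parallelism_coord[OF n m w] coord_vec_self[OF m] by (rule q)
qed

text \<open>\<open>compat\<close> inverts with \<open>inv_into\<close>, which is sure to return the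
  intended preimage only where the map is injective.\<close>

lemma parallelism_inj_on:
  assumes U: "parallelism A D U" and n: "c \<in> charts_at A n" and m: "c \<in> charts_at A m"
    and D: "(n, m) \<in> D" and b: "par_bounds A U c C (snd c n) (snd c m)"
  shows "inj_on (U n m) (tangent_space A m)"
proof (rule inj_onI)
  fix v w assume v: "v \<in> tangent_space A m" and w: "w \<in> tangent_space A m" and eq: "U n m v = U n m w"
  have lin: "linear (\<lambda>e. par_coord A U c e (snd c n, snd c m))"
    by (rule linear_par_coord[OF U charts_atD(1)[OF n] coord_in_domain[OF D n m]])
  have "inj (\<lambda>e. par_coord A U c e (snd c n, snd c m))"
    by (rule near_identity(2)[OF lin]) (use b in \<open>simp add: par_bounds_def\<close>)
  moreover have "par_coord A U c (v c) (snd c n, snd c m) = par_coord A U c (w c) (snd c n, snd c m)"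
    unfolding parallelism_coord[OF n m v, symmetric] parallelism_coord[OF n m w, symmetric] eq ..
  ultimately have "v c = w c" by (rule injD)
  then show "v = w" by (rule tangent_eqI[OF m v w])
qed

lemma eventually_in_domain:
  assumes "diagonal_domain D" "c \<in> charts_at A m"
  shows "\<forall>\<^sub>F a in nhds (snd c m). (cinv c a, m) \<in> D" and "\<forall>\<^sub>F a in nhds (snd c m). c \<in> charts_at A (cinv c a)"
proof -
  note c = charts_atD[OF assms(2)]
  show "\<forall>\<^sub>F a in nhds (snd c m). c \<in> charts_at A (cinv c a)"
    using eventually_cinv[OF assms(2) open_UNIV] by (rule eventually_mono) (auto simp: charts_at_cinv c)
  have "open ((\<lambda>n. (n, m)) -` D)"
    using assms(1) by (intro open_vimage continuous_intros) (simp add: diagonal_domain_def)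
  from eventually_cinv[OF assms(2) this]
  show "\<forall>\<^sub>F a in nhds (snd c m). (cinv c a, m) \<in> D"
    using assms(1) by (auto elim!: eventually_mono simp: diagonal_domain_def)
qed

text \<open>The compatibility tensor is the difference of the Christoffel symbols, by the first order
  expansion of the inverse parallelism.\<close>

lemma compat_chart:
  assumes U: "parallelism A D U" "diagonal_domain D"
    and U': "parallelism A D' U'" "diagonal_domain D'"
    and c: "c \<in> charts_at A m" and v: "v \<in> tangent_space A m" and w: "w \<in> tangent_space A m"
  shows "compat A U' U m v w = coord_vec A c m
    (christoffel A U' c (snd c m) (v c) (w c) - christoffel A U c (snd c m) (v c) (w c))"
proof -
  note cA = charts_atD[OF c]
  define b where "b = snd c m"
  have b: "b \<in> crange c" "cinv c b = m" using cA by (auto simp: b_def chart_in_crange cinv_chart)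
  define k where "k a = inv_into (tangent_space A m) (U (cinv c a) m) (U' (cinv c a) m w) c" for a
  define F where "F v = christoffel A U' c b v (w c) - christoffel A U c b v (w c)" for v
  obtain C where C: "\<forall>\<^sub>F (a, b) in nhds (b, b). compare_bounds U U' c C a b"
    using parallelism_compare[OF U U' cA(1) b(1)] by blast
  obtain L where L: "\<forall>\<^sub>F (a, b) in nhds (b, b). par_bounds A U c L a b"
    using parallelism_local_bounds[OF U cA(1) b(1)] by blast
  have ev: "\<forall>\<^sub>F a in nhds b. inv_into (tangent_space A m) (U (cinv c a) m) (U' (cinv c a) m w) = coord_vec A c m (k a)
      \<and> norm (k a - w c) \<le> C * norm (a - b) * norm (w c)
      \<and> norm (k a - w c - F (a - b)) \<le> C * norm (a - b)^2 * norm (w c)"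
    using eventually_nhds_Pair_left[OF C] eventually_nhds_Pair_left[OF L]
      eventually_cinv[OF c open_UNIV, folded b_def, simplified]
      eventually_in_domain[OF U(2) c, folded b_def] eventually_in_domain(1)[OF U'(2) c, folded b_def]
  proof eventually_elim
    case (elim a)
    let ?n = "cinv c a"
    have sn: "snd c ?n = a" using elim(3) cA by (simp add: chart_cinv)
    obtain q where q: "par_coord A U c q (a, b) = par_coord A U' c (w c) (a, b)"
        "norm (q - w c) \<le> C * norm (a - b) * norm (w c)"
        "norm (q - w c - F (a - b)) \<le> C * norm (a - b)^2 * norm (w c)"
      using elim(1) unfolding F_def by blast
    have eq: "U ?n m (coord_vec A c m q) = U' ?n m w"
      by (rule parallelism_factor[OF U(1) U'(1) elim(5) c elim(4) elim(6) w])
        (use q(1) sn in \<open>simp add: b_def\<close>)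
    have "inj_on (U ?n m) (tangent_space A m)"
      by (rule parallelism_inj_on[OF U(1) elim(5) c elim(4)]) (use elim(2) sn in \<open>simp add: b_def\<close>)
    from inv_into_f_f[OF this coord_vec_in_tangent_space[OF c]]
    have inv: "inv_into (tangent_space A m) (U ?n m) (U' ?n m w) = coord_vec A c m q"
      unfolding eq[symmetric] .
    then have "k a = q" by (simp add: k_def coord_vec_self[OF c])
    then show ?case using inv q by simp
  qed
  \<comment> \<open>At a = b the error bound is 0, which fixes the base value for the quadratic
    criterion.\<close>
  have kb: "k b = w c"
    using eventually_nhds_x_imp_x[OF ev] by simp
  have "linear F"
    unfolding F_def
    by (intro linear_compose_sub linear_christoffel(1)[OF U cA(1) b(1)] linear_christoffel(1)[OF U' cA(1) b(1)])
  then have "(k has_derivative F) (at b)"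
  proof (rule has_derivative_quadratic)
    show "\<forall>\<^sub>F a in nhds b. norm (k a - k b - F (a - b)) \<le> (C * norm (w c)) * norm (a - b)^2"
      using ev by (rule eventually_mono) (simp add: kb ac_simps)
  qed
  then have "(k has_derivative F) (at (snd c m))" by (simp add: b_def)
  then have "compat A U' U m v w = coord_vec A c m (F (v c))"
    unfolding compat_def
    by (rule tangent_deriv_chart[OF c v c]) (use ev in \<open>auto elim!: eventually_mono simp: b_def\<close>)
  then show ?thesis by (simp add: F_def b_def)
qed

section \<open>Logarithms and their differentials in a chart\<close>

lemma logarithm_in_tangent_space:
  "logarithm A D \<psi> \<Longrightarrow> (m, n) \<in> D \<Longrightarrow> \<psi> m n \<in> tangent_space A m"
  by (simp add: logarithm_def)

lemma smooth_log_coord: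
  assumes "logarithm A D \<psi>" "c \<in> A" "c' \<in> A"
  shows "smooth_on (coord_domain D c c') (log_coord \<psi> c c')"
  using assms by (simp add: logarithm_def log_coord_def[abs_def] case_prod_unfold)

text \<open>Since \<open>D\<close> is open, the logarithm based at \<open>n\<close> is given by
  \<open>log_coord\<close> at all points near \<open>m\<close>; its differential is therefore the
  partial derivative in the second variable.\<close>

lemma log_parallelism_chart:
  assumes \<psi>: "logarithm A D \<psi>" "diagonal_domain D" and D: "(n, m) \<in> D"
    and c': "c' \<in> charts_at A n" and c: "c \<in> charts_at A m" and w: "w \<in> tangent_space A m"
  shows "log_parallelism A \<psi> n m w
    = coord_vec A c' n (frechet_derivative (log_coord \<psi> c' c) (at (snd c' n, snd c m)) (0, w c))"
proof -
  note cA = charts_atD[OF c] and cA' = charts_atD[OF c']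
  have oD: "open D" using \<psi>(2) by (simp add: diagonal_domain_def)
  have "(log_coord \<psi> c' c has_derivative frechet_derivative (log_coord \<psi> c' c) (at (snd c' n, snd c m)))
      (at (snd c' n, snd c m))"
    by (rule smooth_on_has_derivative[OF open_coord_domain[OF cA'(1) cA(1) oD]
          smooth_log_coord[OF \<psi>(1) cA'(1) cA(1)] coord_in_domain[OF D c' c]])
  moreover have "((\<lambda>b. (snd c' n, b)) has_derivative (\<lambda>e. (0, e))) (at (snd c m))"
    by (auto intro!: derivative_eq_intros)
  ultimately have "((\<lambda>b. log_coord \<psi> c' c (snd c' n, b)) has_derivative
      (\<lambda>e. frechet_derivative (log_coord \<psi> c' c) (at (snd c' n, snd c m)) (0, e))) (at (snd c m))"
    using has_derivative_compose by blast
  moreover have "\<forall>\<^sub>F b in nhds (snd c m). \<psi> n (cinv c b) = coord_vec A c' n (log_coord \<psi> c' c (snd c' n, b))"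
  proof -
    have "open ((\<lambda>k. (n, k)) -` D)" by (intro open_vimage continuous_intros oD)
    from eventually_cinv[OF c this] D
    have "\<forall>\<^sub>F b in nhds (snd c m). (n, cinv c b) \<in> D" by (auto elim!: eventually_mono)
    then show ?thesis
      by (rule eventually_mono)
        (simp add: log_coord_def cinv_chart[OF cA'] coord_vec_of[OF c' logarithm_in_tangent_space[OF \<psi>(1)]])
  qed
  ultimately show ?thesis
    unfolding log_parallelism_def by (rule tangent_deriv_chart[OF c w c'])
qed

lemma par_coord_log_parallelism:
  assumes \<psi>: "logarithm A D \<psi>" "diagonal_domain D" and c: "c \<in> A" and z: "z \<in> coord_domain D c c"
  shows "par_coord A (log_parallelism A \<psi>) c e z = frechet_derivative (log_coord \<psi> c c) (at z) (0, e)"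
proof -
  have z': "fst z \<in> crange c" "snd z \<in> crange c" "(cinv c (fst z), cinv c (snd z)) \<in> D"
    using z by (auto simp: coord_domain_def)
  note n = charts_at_cinv[OF c z'(1)] and m = charts_at_cinv[OF c z'(2)]
  show ?thesis
    unfolding par_coord_def
      log_parallelism_chart[OF \<psi> z'(3) n m coord_vec_in_tangent_space[OF m]]
    by (simp add: coord_vec_self[OF n] coord_vec_self[OF m] chart_cinv[OF c] z')
qed

text \<open>Makes the results on \<open>compat\<close> applicable to \<open>gauge_compat\<close>.
  Smoothness costs one derivative of \<psi>, and the identity on the diagonal is the normalisation
  of its differential.\<close>

lemma parallelism_log_parallelism:
  assumes \<psi>: "logarithm A D \<psi>" "diagonal_domain D"
  shows "parallelism A D (log_parallelism A \<psi>)"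
  unfolding parallelism_def
proof (intro conjI allI ballI impI)
  fix n m assume D: "(n, m) \<in> D"
  obtain c' where c': "c' \<in> charts_at A n" using exists_chart .
  obtain c where c: "c \<in> charts_at A m" using exists_chart .
  have oD: "open D" using \<psi>(2) by (simp add: diagonal_domain_def)
  have lin: "linear (frechet_derivative (log_coord \<psi> c' c) (at (snd c' n, snd c m)))"
    by (rule linear_frechet_derivative[OF open_coord_domain[OF charts_atD(1)[OF c'] charts_atD(1)[OF c] oD]
          smooth_log_coord[OF \<psi>(1) charts_atD(1)[OF c'] charts_atD(1)[OF c]] coord_in_domain[OF D c' c]])
  note eq = log_parallelism_chart[OF \<psi> D c' c]
  note lcv = linear_coord_vec[OF c']
  show "tangent_linear A m (log_parallelism A \<psi> n m)"
    unfolding tangent_linear_def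
    using linear_add[OF lin, of "(0, _)" "(0, _)"] linear_scale[OF lin, of _ "(0, _)"]
    by (auto simp: eq subspace_add[OF subspace_tangent_space] subspace_scale[OF subspace_tangent_space]
        linear_add[OF lcv, symmetric] linear_scale[OF lcv, symmetric])
  show "log_parallelism A \<psi> n m ` tangent_space A m \<subseteq> tangent_space A n"
    using coord_vec_in_tangent_space[OF c'] by (auto simp: eq)
next
  fix c c' e assume c: "c \<in> A" "c' \<in> A"
  have oD: "open D" using \<psi>(2) by (simp add: diagonal_domain_def)
  have sm: "smooth_on (coord_domain D c c') (\<lambda>z. frechet_derivative (log_coord \<psi> c c') (at z) (0, e))"
    by (rule smooth_on_frechet_derivative[OF smooth_log_coord[OF \<psi>(1) c]])
  have eq: "(case z of (a, b) \<Rightarrow> log_parallelism A \<psi> (cinv c a) (cinv c' b) (coord_vec A c' (cinv c' b) e) c)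
      = frechet_derivative (log_coord \<psi> c c') (at z) (0, e)" if "z \<in> coord_domain D c c'" for z
  proof -
    obtain a b where z: "z = (a, b)" by (cases z)
    have ab: "a \<in> crange c" "b \<in> crange c'" "(cinv c a, cinv c' b) \<in> D"
      using that by (auto simp: coord_domain_def z)
    note n = charts_at_cinv[OF c(1) ab(1)] and m = charts_at_cinv[OF c(2) ab(2)]
    show ?thesis
      unfolding z prod.case log_parallelism_chart[OF \<psi> ab(3) n m coord_vec_in_tangent_space[OF m]]
      by (simp add: coord_vec_self[OF n] coord_vec_self[OF m] chart_cinv[OF c(1)] chart_cinv[OF c(2)] ab)
  qed
  show "smooth_on (coord_domain D c c')
     (\<lambda>(a, b). log_parallelism A \<psi> (cinv c a) (cinv c' b) (coord_vec A c' (cinv c' b) e) c)"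
    by (rule iffD2[OF smooth_on_cong[OF open_coord_domain[OF c oD] eq] sm])
next
  fix m v assume "v \<in> tangent_space A m"
  then show "log_parallelism A \<psi> m m v = v"
    using \<psi>(1) by (simp add: logarithm_def log_parallelism_def)
qed

lemma log_coord_normalized:
  assumes \<psi>: "logarithm A D \<psi>" "diagonal_domain D" and c: "c \<in> A" and b: "(b, b) \<in> coord_domain D c c"
  shows "log_coord \<psi> c c (b, b) = 0" and "frechet_derivative (log_coord \<psi> c c) (at (b, b)) (0, e) = e"
proof -
  have b': "b \<in> crange c" using b by (simp add: coord_domain_def)
  show "log_coord \<psi> c c (b, b) = 0" using \<psi>(1) by (simp add: log_coord_def logarithm_def)
  show "frechet_derivative (log_coord \<psi> c c) (at (b, b)) (0, e) = e"
    using par_coord_log_parallelism[OF \<psi> c b] par_coord_diag[OF parallelism_log_parallelism[OF \<psi>] c b']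
    by simp
qed

lemma christoffel_log_parallelism:
  assumes \<psi>: "logarithm A D \<psi>" "diagonal_domain D" and c: "c \<in> A" "a \<in> crange c"
  shows "christoffel A (log_parallelism A \<psi>) c a v e
    = frechet_derivative (\<lambda>z. frechet_derivative (log_coord \<psi> c c) (at z) (0, e)) (at (a, a)) (v, 0)"
proof -
  have o: "open (coord_domain D c c)"
    using \<psi>(2) c(1) by (intro open_coord_domain) (auto simp: diagonal_domain_def)
  have "(a, a) \<in> coord_domain D c c" using coord_domain_diag[OF \<psi>(2), of a c] c by blast
  from frechet_derivative_cong_open[OF o this par_coord_log_parallelism[OF \<psi> c(1)]]
  show ?thesis by (simp add: christoffel_def)
qed

text \<open>The differential of a logarithm is torsion-free: its Christoffel symbols are mixed
  second derivatives of one function that is normalised along the whole diagonal.\<close>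

lemma christoffel_log_symmetric:
  assumes \<psi>: "logarithm A D \<psi>" "diagonal_domain D" and c: "c \<in> A" "a \<in> crange c"
  shows "christoffel A (log_parallelism A \<psi>) c a v e = christoffel A (log_parallelism A \<psi>) c a e v"
proof -
  have o: "open (coord_domain D c c)"
    using \<psi>(2) c(1) by (intro open_coord_domain) (auto simp: diagonal_domain_def)
  have "(a, a) \<in> coord_domain D c c" using coord_domain_diag[OF \<psi>(2), of a c] c by blast
  from normalized_mixed_derivative_symmetric[OF o smooth_log_coord[OF \<psi>(1) c(1) c(1)] this
      log_coord_normalized(2)[OF \<psi> c(1)]]
  show ?thesis by (simp only: christoffel_log_parallelism[OF \<psi> c])
qed

abbreviation log_expansion where
  "log_expansion \<psi> c C a b \<equiv> norm (log_coord \<psi> c c (a, b) - (b - a)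
    + (1/2) *\<^sub>R christoffel A (log_parallelism A \<psi>) c a (b - a) (b - a)) \<le> C * norm (b - a)^3"

lemma log_coord_taylor:
  assumes \<psi>: "logarithm A D \<psi>" "diagonal_domain D" and c: "c \<in> A" "a0 \<in> crange c"
  shows "\<exists>C\<ge>0. \<forall>\<^sub>F (a, b) in nhds (a0, a0). log_expansion \<psi> c C a b"
proof -
  have o: "open (coord_domain D c c)"
    using \<psi>(2) c(1) by (intro open_coord_domain) (auto simp: diagonal_domain_def)
  have aa: "(a0, a0) \<in> coord_domain D c c" using coord_domain_diag[OF \<psi>(2), of a0 c] c by blast
  obtain C where C: "C \<ge> 0" "\<forall>\<^sub>F (a, b) in nhds (a0, a0). norm (log_coord \<psi> c c (a, b) - (b - a)
    + (1/2) *\<^sub>R frechet_derivative (\<lambda>z. frechet_derivative (log_coord \<psi> c c) (at z) (0, b - a)) (at (a, a)) (b - a, 0))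
      \<le> C * norm (b - a)^3"
    using normalized_taylor[OF o smooth_log_coord[OF \<psi>(1) c(1) c(1)] aa log_coord_normalized[OF \<psi> c(1)]]
    by blast
  have "\<forall>\<^sub>F z in nhds (a0, a0). z \<in> coord_domain D c c"
    by (rule eventually_coord_domain[OF \<psi>(2) c])
  with C(2) have "\<forall>\<^sub>F (a, b) in nhds (a0, a0). log_expansion \<psi> c C a b"
  proof (eventually_elim, unfold split_paired_all prod.case)
    fix a b assume "(a, b) \<in> coord_domain D c c"
    then have "a \<in> crange c" by (simp add: coord_domain_def)
    note chr = christoffel_log_parallelism[OF \<psi> c(1) this]
    assume "norm (log_coord \<psi> c c (a, b) - (b - a) + (1/2) *\<^sub>R
      frechet_derivative (\<lambda>z. frechet_derivative (log_coord \<psi> c c) (at z) (0, b - a)) (at (a, a)) (b - a, 0))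
      \<le> C * norm (b - a)^3"
    then show "log_expansion \<psi> c C a b"
      by (simp only: chr)
  qed
  then show ?thesis using C(1) by blast
qed

section \<open>Comparison of the metric norm with the coordinate norm\<close>

lemma metric_bilinear_expansion:
  assumes g: "riemannian_metric A g" and c: "c \<in> charts_at A m"
  shows "g m (coord_vec A c m e) (coord_vec A c m e')
    = (\<Sum>i\<in>Basis. \<Sum>j\<in>Basis. (e \<bullet> i) * ((e' \<bullet> j) * g m (coord_vec A c m i) (coord_vec A c m j)))"
proof -
  note cv = coord_vec_in_tangent_space[OF c]
  have lin: "linear (\<lambda>e. g m (coord_vec A c m f) (coord_vec A c m e))" for f
    using g cv unfolding riemannian_metric_def by (intro tangent_linear_coord_vec[OF _ c]) blast
  have sym: "g m (coord_vec A c m f) (coord_vec A c m f') = g m (coord_vec A c m f') (coord_vec A c m f)" for f f'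
    using g cv unfolding riemannian_metric_def by blast
  have exp: "g m (coord_vec A c m f) (coord_vec A c m h) = (\<Sum>j\<in>Basis. (h \<bullet> j) * g m (coord_vec A c m f) (coord_vec A c m j))" for f h
  proof -
    have "g m (coord_vec A c m f) (coord_vec A c m h)
        = g m (coord_vec A c m f) (coord_vec A c m (\<Sum>j\<in>Basis. (h \<bullet> j) *\<^sub>R j))"
      by (simp add: euclidean_representation)
    then show ?thesis by (simp add: linear_sum[OF lin] linear_scale[OF lin])
  qed
  have "g m (coord_vec A c m e) (coord_vec A c m e') = g m (coord_vec A c m e') (coord_vec A c m e)" by (rule sym)
  also have "\<dots> = (\<Sum>i\<in>Basis. (e \<bullet> i) * g m (coord_vec A c m e') (coord_vec A c m i))" by (rule exp)
  also have "\<dots> = (\<Sum>i\<in>Basis. (e \<bullet> i) * (\<Sum>j\<in>Basis. (e' \<bullet> j) * g m (coord_vec A c m i) (coord_vec A c m j)))"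
    by (rule sum.cong[OF refl]) (subst sym, subst exp, rule refl)
  finally show ?thesis by (simp add: sum_distrib_left)
qed

text \<open>Smoothness of the metric is given for fixed coordinate vectors; the bilinear expansion
  makes the squared norm jointly continuous in base point and vector. On a compact ball times the
  unit sphere it has a positive minimum and a maximum, and homogeneity covers all vectors.\<close>

lemma tnorm_local_equivalence:
  assumes g: "riemannian_metric A g" and c: "c \<in> A" "a0 \<in> crange c"
  shows "\<exists>K>0. \<forall>\<^sub>F a in nhds a0. \<forall>v\<in>tangent_space A (cinv c a).
    norm (v c) \<le> K * tnorm g (cinv c a) v \<and> tnorm g (cinv c a) v \<le> K * norm (v c)"
proof -
  define G where "G z = g (cinv c (fst z)) (coord_vec A c (cinv c (fst z)) (snd z)) (coord_vec A c (cinv c (fst z)) (snd z))" for z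
  obtain \<rho> where \<rho>: "\<rho> > 0" "cball a0 \<rho> \<subseteq> crange c"
    using open_chart(2)[OF c(1)] c(2) open_contains_cball by blast
  let ?S = "cball a0 \<rho> \<times> sphere (0::'e) 1"
  have G_eq: "G z = (\<Sum>i\<in>Basis. \<Sum>j\<in>Basis. (snd z \<bullet> i) * ((snd z \<bullet> j) *
      g (cinv c (fst z)) (coord_vec A c (cinv c (fst z)) i) (coord_vec A c (cinv c (fst z)) j)))" if "z \<in> ?S" for z
    unfolding G_def by (rule metric_bilinear_expansion[OF g charts_at_cinv[OF c(1)]]) (use that \<rho>(2) in auto)
  have gc: "continuous_on (crange c) (\<lambda>a. g (cinv c a) (coord_vec A c (cinv c a) i) (coord_vec A c (cinv c a) j))" for i j
    using g c(1) unfolding riemannian_metric_def by (intro smooth_on_continuous) blast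
  have "continuous_on ?S (\<lambda>z. \<Sum>i\<in>Basis. \<Sum>j\<in>Basis. (snd z \<bullet> i) * ((snd z \<bullet> j) *
      g (cinv c (fst z)) (coord_vec A c (cinv c (fst z)) i) (coord_vec A c (cinv c (fst z)) j)))"
    by (intro continuous_intros continuous_on_compose2[OF gc]) (use \<rho>(2) in auto)
  then have cont: "continuous_on ?S G" by (simp add: G_eq cong: continuous_on_cong)
  have cpt: "compact ?S" by (intro compact_Times) auto
  obtain u :: 'e where "u \<in> Basis" using nonempty_Basis by blast
  then have ne: "?S \<noteq> {}" using \<rho>(1) by (auto intro!: exI[of _ u])
  obtain zm where zm: "zm \<in> ?S" "\<forall>z\<in>?S. G zm \<le> G z"
    using continuous_attains_inf[OF cpt ne cont] by blast
  obtain zM where zM: "zM \<in> ?S" "\<forall>z\<in>?S. G z \<le> G zM"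
    using continuous_attains_sup[OF cpt ne cont] by blast
  have pos: "G z > 0" if "z \<in> ?S" for z
  proof -
    have ch: "c \<in> charts_at A (cinv c (fst z))" using charts_at_cinv[OF c(1)] that \<rho>(2) by auto
    have "coord_vec A c (cinv c (fst z)) (snd z) c \<noteq> 0" using that by (auto simp: coord_vec_self[OF ch])
    then have "coord_vec A c (cinv c (fst z)) (snd z) \<noteq> 0" by force
    then show ?thesis using g coord_vec_in_tangent_space[OF ch] unfolding riemannian_metric_def G_def by blast
  qed
  define K where "K = max (sqrt (G zM)) (1 / sqrt (G zm))"
  have K: "K > 0" using pos[OF zM(1)] by (simp add: K_def less_max_iff_disj)
  have "norm (v c) \<le> K * tnorm g (cinv c a) v \<and> tnorm g (cinv c a) v \<le> K * norm (v c)"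
    if a: "a \<in> ball a0 \<rho>" and v: "v \<in> tangent_space A (cinv c a)" for a v
  proof (cases "v c = 0")
    case True
    have ch: "c \<in> charts_at A (cinv c a)" by (rule charts_at_cinv[OF c(1)]) (use a \<rho>(2) in \<open>auto simp: subset_iff\<close>)
    have "v = coord_vec A c (cinv c a) 0" using coord_vec_of[OF ch v] True by simp
    then have "g (cinv c a) v v = 0" using metric_bilinear_expansion[OF g ch, of 0 0] by simp
    then show ?thesis using True by (simp add: tnorm_def)
  next
    case False
    have ch: "c \<in> charts_at A (cinv c a)" by (rule charts_at_cinv[OF c(1)]) (use a \<rho>(2) in \<open>auto simp: subset_iff\<close>)
    define e where "e = v c /\<^sub>R norm (v c)"
    have e: "(a, e) \<in> ?S" "v c = norm (v c) *\<^sub>R e" using False a by (auto simp: e_def)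
    have "v = coord_vec A c (cinv c a) (norm (v c) *\<^sub>R e)" using coord_vec_of[OF ch v] e(2) by simp
    then have "g (cinv c a) v v = norm (v c)^2 * G (a, e)"
      unfolding G_def fst_conv snd_conv using metric_bilinear_expansion[OF g ch, of e e]
        metric_bilinear_expansion[OF g ch, of "norm (v c) *\<^sub>R e" "norm (v c) *\<^sub>R e"]
      by (simp add: sum_distrib_left power2_eq_square ac_simps)
    then have t: "tnorm g (cinv c a) v = norm (v c) * sqrt (G (a, e))"
      by (simp add: tnorm_def real_sqrt_mult)
    have "sqrt (G (a, e)) \<le> K" using zM(2) e(1) by (auto simp: K_def le_max_iff_disj)
    then have "tnorm g (cinv c a) v \<le> K * norm (v c)"
      unfolding t by (subst mult.commute) (rule mult_right_mono, simp_all)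
    moreover have "1 / sqrt (G zm) * sqrt (G (a, e)) \<ge> 1"
      using zm e(1) pos[OF zm(1)] by (simp add: pos_le_divide_eq)
    then have "K * sqrt (G (a, e)) \<ge> 1"
      using mult_right_mono[of "1 / sqrt (G zm)" K "sqrt (G (a, e))"] pos[OF e(1)] by (simp add: K_def)
    then have "norm (v c) \<le> K * tnorm g (cinv c a) v"
      unfolding t using mult_right_mono[of 1 "K * sqrt (G (a, e))" "norm (v c)"] by (simp add: ac_simps)
    ultimately show ?thesis by blast
  qed
  moreover have "\<forall>\<^sub>F a in nhds a0. a \<in> ball a0 \<rho>" using \<rho>(1) by (intro eventually_nhds_in_open) auto
  ultimately show ?thesis using K by (intro exI[of _ K]) (auto elim!: eventually_mono)
qed

end

section \<open>Localisation in time\<close>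

abbreviation near_time :: "real \<Rightarrow> real \<Rightarrow> real filter" where
  "near_time T r \<equiv> inf (nhds r) (principal {0..T})"

text \<open>Restricted to pairs with s \<le> t, since the control and the relations of order i speak
  only about these.\<close>

abbreviation near_diag :: "real \<Rightarrow> real \<Rightarrow> (real \<times> real) filter" where
  "near_diag T r \<equiv> inf (nhds (r, r)) (principal (simplex2 T))"

lemma simplex2_iff: "(s, t) \<in> simplex2 T \<longleftrightarrow> 0 \<le> s \<and> s \<le> t \<and> t \<le> T"
  by (simp add: simplex2_def)

lemma eventually_near_diag_box:
  assumes "\<forall>\<^sub>F (s, t) in near_diag T r. P s t"
  shows "\<exists>\<eta>>0. \<forall>s t. 0 \<le> s \<and> s \<le> t \<and> t \<le> T \<and> \<bar>s - r\<bar> < \<eta> \<and> \<bar>t - r\<bar> < \<eta> \<longrightarrow> P s t"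
proof -
  have "\<forall>\<^sub>F z in nhds (r, r). z \<in> simplex2 T \<longrightarrow> (case z of (s, t) \<Rightarrow> P s t)"
    using assms by (simp add: eventually_inf_principal)
  then obtain \<eta> where \<eta>: "\<eta> > 0" "\<And>z. dist z (r, r) < \<eta> \<Longrightarrow> z \<in> simplex2 T \<longrightarrow> (case z of (s, t) \<Rightarrow> P s t)"
    unfolding eventually_nhds_metric by blast
  show ?thesis
  proof (rule exI[of _ "\<eta>/2"], intro conjI allI impI)
    fix s t assume st: "0 \<le> s \<and> s \<le> t \<and> t \<le> T \<and> \<bar>s - r\<bar> < \<eta>/2 \<and> \<bar>t - r\<bar> < \<eta>/2"
    have "dist (s, t) (r, r) \<le> \<bar>s - r\<bar> + \<bar>t - r\<bar>"
      using sqrt_sum_squares_le_sum_abs[of "s - r" "t - r"] by (simp add: dist_Pair_Pair dist_real_def)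
    then show "P s t" using \<eta>(2)[of "(s, t)"] st by (simp add: simplex2_iff)
  qed (use \<eta> in simp)
qed

text \<open>A single base time that works for all t near \<open>r\<close>. It has to lie to the left
  of these t, as the eventual property concerns s \<le> t only.\<close>

lemma eventually_near_diag_base_point:
  assumes "\<forall>\<^sub>F (s, t) in near_diag T r. P s t" "r \<in> {0..T}"
  shows "\<exists>s0\<in>{0..T}. \<forall>\<^sub>F t in near_time T r. P s0 t"
proof -
  obtain \<eta> where \<eta>: "\<eta> > 0"
    "\<forall>s t. 0 \<le> s \<and> s \<le> t \<and> t \<le> T \<and> \<bar>s - r\<bar> < \<eta> \<and> \<bar>t - r\<bar> < \<eta> \<longrightarrow> P s t"
    using eventually_near_diag_box[OF assms(1)] by blast
  \<comment> \<open>If \<open>r\<close> is too close to 0 the base time is 0 itself, which is still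
    to the left of every admissible t.\<close>
  define s0 where "s0 = max 0 (r - \<eta>/2)"
  show ?thesis
  proof (rule bexI)
    show "s0 \<in> {0..T}" using assms(2) \<eta>(1) by (auto simp: s0_def)
    have "\<forall>\<^sub>F t in nhds r. \<bar>t - r\<bar> < \<eta>/2"
      using \<eta>(1) by (auto simp: eventually_nhds_metric dist_real_def intro!: exI[of _ "\<eta>/2"])
    then show "\<forall>\<^sub>F t in near_time T r. P s0 t"
      unfolding eventually_inf_principal
      by (rule eventually_mono) (use assms(2) \<eta>(1) in \<open>auto simp: s0_def max_def abs_if split: if_splits intro!: \<eta>(2)[rule_format]\<close>)
  qed
qed

lemma eventually_near_diag_fst_snd:
  assumes "\<forall>\<^sub>F t in near_time T r. P t"
  shows "\<forall>\<^sub>F (s, t) in near_diag T r. P s \<and> P t"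
proof -
  have "filterlim fst (nhds r) (nhds (r, r))" "filterlim snd (nhds r) (nhds (r, r))"
    using tendsto_fst[OF filterlim_ident[of "nhds (r, r)"]] tendsto_snd[OF filterlim_ident[of "nhds (r, r)"]]
    by simp_all
  then have f: "filterlim fst (near_time T r) (near_diag T r)" "filterlim snd (near_time T r) (near_diag T r)"
    unfolding filterlim_inf filterlim_principal
    by (auto intro: filterlim_mono[OF _ order_refl inf_le1] simp: eventually_inf_principal simplex2_def intro!: always_eventually)
  show ?thesis
    using eventually_conj[OF eventually_compose_filterlim[OF assms f(1)] eventually_compose_filterlim[OF assms f(2)]]
    by (rule eventually_mono) auto
qed

lemma continuous_on_tendsto_within:
  assumes "continuous_on S f" "z \<in> S"
  shows "(f \<longlongrightarrow> f z) (inf (nhds z) (principal S))"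
proof (rule topological_tendstoI)
  fix B assume B: "open B" "f z \<in> B"
  then obtain O' where "open O'" "O' \<inter> S = f -` B \<inter> S"
    using assms(1) unfolding continuous_on_open_invariant by blast
  then show "\<forall>\<^sub>F w in inf (nhds z) (principal S). f w \<in> B"
    unfolding eventually_inf_principal eventually_nhds using B assms(2) by (intro exI[of _ O']) blast
qed

text \<open>A Lebesgue number of the cover of the compact diagonal by local neighbourhoods provides
  \<delta>; the finitely many local constants are replaced by their maximum, which
  \<open>mono\<close> allows.\<close>

lemma approx_localI:
  assumes \<omega>: "rp_control T \<omega>"
    and mono: "\<And>s t K K'. \<lbrakk>(s, t) \<in> simplex2 T; K \<le> K'; bnd s t K\<rbrakk> \<Longrightarrow> bnd s t K'"
    and loc: "\<And>r. r \<in> {0..T} \<Longrightarrow> \<exists>C. \<forall>\<^sub>F (s, t) in near_diag T r. dfd s t \<and> bnd s t (C * \<omega> s t powr (real i / p))"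
  shows "approx T p \<omega> i dfd bnd"
proof -
  have "\<forall>r\<in>{0..T}. \<exists>N. \<exists>C. open N \<and> (r, r) \<in> N \<and>
      (\<forall>s t. (s, t) \<in> N \<and> (s, t) \<in> simplex2 T \<longrightarrow> dfd s t \<and> bnd s t (C * \<omega> s t powr (real i / p)))"
  proof
    fix r assume "r \<in> {0..T}"
    then obtain C where "\<forall>\<^sub>F (s, t) in near_diag T r. dfd s t \<and> bnd s t (C * \<omega> s t powr (real i / p))"
      using loc by blast
    then show "\<exists>N. \<exists>C. open N \<and> (r, r) \<in> N \<and>
      (\<forall>s t. (s, t) \<in> N \<and> (s, t) \<in> simplex2 T \<longrightarrow> dfd s t \<and> bnd s t (C * \<omega> s t powr (real i / p)))"
      unfolding eventually_inf_principal eventually_nhds by fast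
  qed
  from bchoice[OF this] obtain N where "\<forall>r\<in>{0..T}. \<exists>C. open (N r) \<and> (r, r) \<in> N r \<and>
      (\<forall>s t. (s, t) \<in> N r \<and> (s, t) \<in> simplex2 T \<longrightarrow> dfd s t \<and> bnd s t (C * \<omega> s t powr (real i / p)))" ..
  from bchoice[OF this] obtain C where NC: "\<And>r. r \<in> {0..T} \<Longrightarrow> open (N r) \<and> (r, r) \<in> N r \<and>
      (\<forall>s t. (s, t) \<in> N r \<and> (s, t) \<in> simplex2 T \<longrightarrow> dfd s t \<and> bnd s t (C r * \<omega> s t powr (real i / p)))" by blast
  let ?\<Delta> = "(\<lambda>r. (r, r)) ` {0..T}"
  have cpt: "compact ?\<Delta>" by (intro compact_continuous_image continuous_intros) auto
  obtain R where R: "R \<subseteq> {0..T}" "finite R" "?\<Delta> \<subseteq> (\<Union>r\<in>R. N r)"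
    by (rule compactE_image[OF cpt, of "{0..T}" N]) (use NC in auto)
  obtain e where e: "e > 0" "\<And>z. z \<in> ?\<Delta> \<Longrightarrow> \<exists>G\<in>N ` R. ball z e \<subseteq> G"
    by (rule Heine_Borel_lemma[OF cpt, of "N ` R"]) (use R NC in auto)
  \<comment> \<open>The inserted 0 keeps the set nonempty even if the subcover is empty.\<close>
  define M where "M = Max (insert 0 (C ` R))"
  show ?thesis unfolding approx_def
  proof (rule exI[of _ M], rule exI[of _ "e/2"], intro conjI allI impI)
    fix s t assume st: "0 \<le> s \<and> s \<le> t \<and> t \<le> T \<and> t - s \<le> e/2"
    then have "(s, s) \<in> ?\<Delta>" by auto
    then obtain r where r: "r \<in> R" "ball (s, s) e \<subseteq> N r" using e(2) by blast
    have "(s, t) \<in> ball (s, s) e" using st e(1) by (simp add: dist_Pair_Pair dist_real_def)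
    then have "(s, t) \<in> N r" using r(2) by blast
    moreover have S: "(s, t) \<in> simplex2 T" using st by (simp add: simplex2_iff)
    ultimately have *: "dfd s t \<and> bnd s t (C r * \<omega> s t powr (real i / p))" using NC R(1) r(1) by blast
    then show "dfd s t" by blast
    have "C r \<le> M" unfolding M_def using R(2) r(1) by (intro Max_ge) auto
    then have "C r * \<omega> s t powr (real i / p) \<le> M * \<omega> s t powr (real i / p)" by (intro mult_right_mono) auto
    from mono[OF S this] * show "bnd s t (M * \<omega> s t powr (real i / p))" by blast
  qed (use e in simp)
qed

text \<open>Times closer than \<open>\<delta>/2\<close> to \<open>r\<close> differ by less than
  \<delta>. Replacing C by \<open>max C 0\<close> makes the constant nonnegative, as later products
  require.\<close>

lemma approx_localD:
  assumes mono: "\<And>s t K K'. \<lbrakk>(s, t) \<in> simplex2 T; K \<le> K'; bnd s t K\<rbrakk> \<Longrightarrow> bnd s t K'"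
    and "approx T p \<omega> i dfd bnd"
  shows "\<exists>C\<ge>0. \<forall>\<^sub>F (s, t) in near_diag T r. dfd s t \<and> bnd s t (C * \<omega> s t powr (real i / p))"
proof -
  obtain C \<delta> where C: "\<delta> > 0" "\<forall>s t. 0 \<le> s \<and> s \<le> t \<and> t \<le> T \<and> t - s \<le> \<delta> \<longrightarrow>
      dfd s t \<and> bnd s t (C * \<omega> s t powr (real i / p))"
    using assms(2) unfolding approx_def by blast
  have "\<forall>\<^sub>F t in near_time T r. \<bar>t - r\<bar> < \<delta>/2"
    using C(1) by (auto simp: eventually_inf_principal eventually_nhds_metric dist_real_def intro!: exI[of _ "\<delta>/2"])
  from eventually_near_diag_fst_snd[OF this]
  have "\<forall>\<^sub>F (s, t) in near_diag T r. (s, t) \<in> simplex2 T \<and> t - s \<le> \<delta>"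
    unfolding eventually_inf_principal
    by (rule eventually_mono) (auto simp: abs_if split: if_splits)
  then have "\<forall>\<^sub>F (s, t) in near_diag T r. dfd s t \<and> bnd s t (max C 0 * \<omega> s t powr (real i / p))"
  proof (rule eventually_mono, unfold split_paired_all prod.case)
    fix s t assume st: "(s, t) \<in> simplex2 T \<and> t - s \<le> \<delta>"
    then have *: "dfd s t \<and> bnd s t (C * \<omega> s t powr (real i / p))"
      using C(2) by (simp add: simplex2_iff)
    have "C * \<omega> s t powr (real i / p) \<le> max C 0 * \<omega> s t powr (real i / p)" by (intro mult_right_mono) auto
    from mono[OF conjunct1[OF st] this] * show "dfd s t \<and> bnd s t (max C 0 * \<omega> s t powr (real i / p))" by blast
  qed
  then show ?thesis by (intro exI[of _ "max C 0"]) auto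
qed

text \<open>The second estimate inverts the logarithm near the diagonal by absorbing the quadratic
  error into half of \<open>norm (b - a)\<close>. It turns bounds on
  \<open>\<psi> (y s) (y t)\<close> into bounds on coordinate increments.\<close>

lemma (in smooth_manifold) log_coord_quadratic:
  assumes \<psi>: "logarithm A D \<psi>" "diagonal_domain D" and c: "c \<in> A" "a0 \<in> crange c"
  shows "\<exists>C\<ge>0. \<forall>\<^sub>F (a, b) in nhds (a0, a0). norm (log_coord \<psi> c c (a, b) - (b - a)) \<le> C * norm (b - a)^2
    \<and> norm (b - a) \<le> 2 * norm (log_coord \<psi> c c (a, b))"
proof -
  obtain C1 where C1: "C1 \<ge> 0" "\<forall>\<^sub>F (a, b) in nhds (a0, a0). log_expansion \<psi> c C1 a b"
    using log_coord_taylor[OF \<psi> c] by blast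
  obtain C2 where C2: "C2 \<ge> 0" "\<forall>\<^sub>F (a, b) in nhds (a0, a0). par_bounds A (log_parallelism A \<psi>) c C2 a b"
    using parallelism_local_bounds[OF parallelism_log_parallelism[OF \<psi>] \<psi>(2) c] by blast
  define C where "C = C1 + C2"
  have C: "C \<ge> 0" using C1 C2 by (simp add: C_def)
  \<comment> \<open>The bound 1/2 gives \<open>norm h \<le> 1\<close>, so that the cubic error is
    quadratic; the other bound gives \<open>C * norm h \<le> 1/2\<close>.\<close>
  define r where "r = min (1/2) (1 / (4 * (C + 1)))"
  have r: "r > 0" "r \<le> 1/2" "r \<le> 1 / (4 * (C + 1))" using C by (auto simp: r_def)
  have "\<forall>\<^sub>F z in nhds (a0, a0). z \<in> ball a0 r \<times> ball a0 r"
    using r by (intro eventually_nhds_in_open open_Times) auto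
  moreover have "\<forall>\<^sub>F (a, b) in nhds (a0, a0). par_bounds A (log_parallelism A \<psi>) c C2 a a"
  proof -
    have "((\<lambda>z. (fst z, fst z)) \<longlongrightarrow> (a0, a0)) (nhds (a0, a0))"
      using tendsto_fst[OF filterlim_ident[of "nhds (a0, a0)"]] by (intro tendsto_Pair) simp_all
    from eventually_compose_filterlim[OF C2(2) this] show ?thesis by (simp add: case_prod_unfold)
  qed
  ultimately have "\<forall>\<^sub>F (a, b) in nhds (a0, a0). norm (log_coord \<psi> c c (a, b) - (b - a)) \<le> C * norm (b - a)^2
    \<and> norm (b - a) \<le> 2 * norm (log_coord \<psi> c c (a, b))"
    using C1(2)
  proof (eventually_elim, unfold split_paired_all prod.case)
    fix a b :: 'e
    define h where "h = b - a"
    let ?\<Gamma> = "christoffel A (log_parallelism A \<psi>) c a h h" and ?\<phi> = "log_coord \<psi> c c (a, b)"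
    assume "(a, b) \<in> ball a0 r \<times> ball a0 r"
    then have d: "dist a0 a < r" "dist a0 b < r" by auto
    have h: "norm h \<le> 2 * r"
      using dist_triangle2[of a b a0] d by (simp add: h_def dist_norm norm_minus_commute)
    assume "par_bounds A (log_parallelism A \<psi>) c C2 a a"
    then have g: "norm ?\<Gamma> \<le> C2 * norm h * norm h" by (auto simp: par_bounds_def)
    assume "norm (?\<phi> - (b - a) + (1/2) *\<^sub>R christoffel A (log_parallelism A \<psi>) c a (b - a) (b - a)) \<le> C1 * norm (b - a)^3"
    then have t: "norm (?\<phi> - h + (1/2) *\<^sub>R ?\<Gamma>) \<le> C1 * norm h^3" by (simp only: h_def)
    have "norm (?\<phi> - h) \<le> norm (?\<phi> - h + (1/2) *\<^sub>R ?\<Gamma>) + norm ((1/2) *\<^sub>R ?\<Gamma>)"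
      by (metis add_diff_cancel_right' norm_triangle_ineq4)
    also have "\<dots> \<le> C1 * norm h^3 + C2 * norm h * norm h"
    proof (rule add_mono[OF t])
      have "norm ((1/2) *\<^sub>R ?\<Gamma>) \<le> norm ?\<Gamma>" by simp
      also note g
      finally show "norm ((1/2) *\<^sub>R ?\<Gamma>) \<le> C2 * norm h * norm h" .
    qed
    also have "C1 * norm h^3 \<le> C1 * norm h^2"
      using C1(1) h r(2) by (intro mult_left_mono power_decreasing) auto
    finally have q: "norm (?\<phi> - h) \<le> C * norm h^2" by (simp add: C_def algebra_simps power2_eq_square)
    have "C * norm h \<le> C * (2 * (1 / (4 * (C + 1))))" using h r(3) C by (intro mult_left_mono) auto
    also have "\<dots> \<le> 1/2" using C by (simp add: field_simps)
    finally have "C * norm h * norm h \<le> 1/2 * norm h" by (intro mult_right_mono) auto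
    then have "norm (?\<phi> - h) \<le> 1/2 * norm h" using q by (simp add: power2_eq_square mult.assoc)
    then have "norm h \<le> 2 * norm ?\<phi>"
      using norm_triangle_sub[of h ?\<phi>] by (simp add: norm_minus_commute)
    then show "norm (?\<phi> - (b - a)) \<le> C * norm (b - a)^2 \<and> norm (b - a) \<le> 2 * norm ?\<phi>"
      using q by (simp add: h_def)
  qed
  then show ?thesis using C by blast
qed

lemma norm_bilinear_basis_le:
  fixes f :: "'a::euclidean_space \<Rightarrow> 'c::euclidean_space \<Rightarrow> 'b::real_normed_vector"
  assumes "\<And>e. linear (\<lambda>w. f w e)" "\<And>w. linear (f w)"
  shows "\<exists>B\<ge>0. \<forall>w e. norm (f w e) \<le> B * norm w * norm e"
proof (intro exI conjI allI)
  let ?B = "\<Sum>j\<in>Basis. \<Sum>i\<in>Basis. norm (f i j)"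
  show "0 \<le> ?B" by (intro sum_nonneg) auto
  fix w e
  have "norm (f w e) \<le> (\<Sum>j\<in>Basis. norm (f w j)) * norm e" by (rule norm_linear_basis_le[OF assms(2)])
  also have "(\<Sum>j\<in>Basis. norm (f w j)) \<le> (\<Sum>j\<in>Basis. (\<Sum>i\<in>Basis. norm (f i j)) * norm w)"
    by (intro sum_mono norm_linear_basis_le[OF assms(1)])
  finally show "norm (f w e) \<le> ?B * norm w * norm e"
    by (simp add: sum_distrib_right mult_right_mono)
qed

text \<open>Pulls a tangent vector at the current point back to an earlier one with control of its
  size; this transports bounds forward in time.\<close>

lemma (in smooth_manifold) parallelism_surj:
  assumes U: "parallelism A D U" and n: "c \<in> charts_at A n" and m: "c \<in> charts_at A m"
    and D: "(n, m) \<in> D" and b: "par_bounds A U c C (snd c n) (snd c m)" and v: "v \<in> tangent_space A n"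
  shows "\<exists>q\<in>tangent_space A m. U n m q = v \<and> norm (q c) \<le> 2 * norm (v c)"
proof -
  let ?f = "\<lambda>e. par_coord A U c e (snd c n, snd c m)"
  note lin = linear_par_coord[OF U charts_atD(1)[OF n] coord_in_domain[OF D n m]]
  have half: "norm (?f e - e) \<le> 1/2 * norm e" for e using b by (simp add: par_bounds_def)
  obtain e where e: "?f e = v c" using near_identity(3)[OF lin half] by (metis surjD)
  note cv = coord_vec_in_tangent_space[OF m, of e]
  have "U n m (coord_vec A c m e) = v"
    by (rule tangent_eqI[OF n parallelism_in_tangent_space[OF U D cv] v])
      (simp only: parallelism_coord[OF n m cv] coord_vec_self[OF m] e)
  moreover have "norm e \<le> 2 * norm (v c)" using near_identity(1)[OF lin half, of e] e by simp
  ultimately show ?thesis using cv coord_vec_self[OF m, of e] by (intro bexI[OF _ cv]) simp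
qed

locale controlled_setting = smooth_manifold A
  for A :: "('m::{t2_space,second_countable_topology}, 'e::euclidean_space) chart set" +
  fixes g :: "'m \<Rightarrow> ('m, 'e) tvec \<Rightarrow> ('m, 'e) tvec \<Rightarrow> real"
    and T p :: real
    and \<omega> :: "real \<Rightarrow> real \<Rightarrow> real"
    and x :: "real \<Rightarrow> real^'k"
    and XX :: "real \<Rightarrow> real \<Rightarrow> real^'k^'k"
    and y :: "real \<Rightarrow> 'm"
    and y' :: "real \<Rightarrow> real^'k \<Rightarrow> ('m, 'e) tvec"
  assumes metric: "riemannian_metric A g" and p: "1 \<le> p"
    and rp: "weak_geometric_rough_path T p \<omega> x XX"
    and crp: "(y, y') \<in> crp_manifold A g T p \<omega> x"
begin

text \<open>In terms of \<open>eps\<close> the relations of order i involve ordinary powers, so that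
  orders of factors add up.\<close>

definition eps :: "real \<Rightarrow> real \<Rightarrow> real" where
  "eps s t = \<omega> s t powr (1 / p)"

abbreviation tnorm_comparable where
  "tnorm_comparable c K s \<equiv> \<forall>v\<in>tangent_space A (y s).
     norm (v c) \<le> K * tnorm g (y s) v \<and> tnorm g (y s) v \<le> K * norm (v c)"

text \<open>The coordinate form of a controlled path on the manifold: no gauge is left in
  it.\<close>

abbreviation increment_bounds where
  "increment_bounds c C s t \<equiv> norm (snd c (y t) - snd c (y s)) \<le> C * eps s t \<and>
     norm (snd c (y t) - snd c (y s) - y' s (x t - x s) c) \<le> C * eps s t ^ 2 \<and>
     (\<forall>w. norm (y' t w c - y' s w c) \<le> C * eps s t * norm w)"

abbreviation crp_expansion where
  "crp_expansion \<alpha> \<alpha>' U c C s t \<equiv> \<forall>v\<in>tangent_space A (y s).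
     norm (\<alpha> t (U (y t) (y s) v) - \<alpha> s v - \<alpha>' s (x t - x s) v) \<le> C * eps s t ^ 2 * norm (v c) \<and>
     (\<forall>w. norm (\<alpha>' t w (U (y t) (y s) v) - \<alpha>' s w v) \<le> C * eps s t * norm w * norm (v c))"

abbreviation crp_bounded where
  "crp_bounded \<alpha> \<alpha>' c C s \<equiv> \<forall>v\<in>tangent_space A (y s).
     norm (\<alpha> s v) \<le> C * norm (v c) \<and> (\<forall>w. norm (\<alpha>' s w v) \<le> C * norm w * norm (v c))"

text \<open>\<open>\<sigma>\<close> is U^-1 U' v - v between \<open>y s\<close> and
  \<open>y t\<close>. The second part says that the compatibility tensor along the path is bounded
  and transported up to order 1, as the Gubinelli derivative requires.\<close>

abbreviation change_expansion where
  "change_expansion U U' c C s t \<equiv> \<forall>v\<in>tangent_space A (y s).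
     (\<exists>\<sigma>\<in>tangent_space A (y s). U' (y t) (y s) v = U (y t) (y s) (v + \<sigma>) \<and>
       norm (\<sigma> c) \<le> C * eps s t * norm (v c) \<and>
       norm ((\<sigma> - compat A U' U (y s) (y' s (x t - x s)) v) c) \<le> C * eps s t ^ 2 * norm (v c)) \<and>
     (\<forall>w. norm (compat A U' U (y s) (y' s w) v c) \<le> C * norm w * norm (v c) \<and>
       norm ((compat A U' U (y t) (y' t w) (U' (y t) (y s) v)
         - U (y t) (y s) (compat A U' U (y s) (y' s w) v)) c) \<le> C * eps s t * norm w * norm (v c))"

text \<open>The coordinate of the vector to which \<alpha> is applied in the difference of the two
  integrands; the Christoffel symbols of the parallelisms have already cancelled.\<close>

abbreviation log_difference where
  "log_difference \<psi> \<psi>' c s t \<equiv> \<psi> (y s) (y t) c - \<psi>' (y s) (y t) c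
     + tensor_lift (\<lambda>a b. christoffel A (log_parallelism A \<psi>) c (snd c (y s)) (y' s a c) (y' s b c)
         - christoffel A (log_parallelism A \<psi>') c (snd c (y s)) (y' s a c) (y' s b c)) (XX s t)"

abbreviation integrand where
  "integrand \<psi> U \<alpha> \<alpha>' s t \<equiv>
     \<alpha> s (\<psi> (y s) (y t) + tensor_lift (\<lambda>a b. gauge_compat A \<psi> U (y s) (y' s a) (y' s b)) (XX s t))
       + tensor_lift (\<lambda>a b. \<alpha>' s a (y' s b)) (XX s t)"

lemma control: "rp_control T \<omega>" using rp by (simp add: weak_geometric_rough_path_def)

lemma eps_nonneg: "eps s t \<ge> 0" by (simp add: eps_def)

text \<open>Where the control vanishes both sides are 0 for i \<ge> 1; for i = 0 they would differ,
  since \<open>powr\<close> with base 0 is 0 while \<open>eps s t ^ 0\<close> is 1.\<close>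

lemma eps_power:
  assumes "(s, t) \<in> simplex2 T" "i \<ge> 1"
  shows "\<omega> s t powr (real i / p) = eps s t ^ i"
proof (cases "\<omega> s t = 0")
  case False
  have "\<omega> s t \<ge> 0" using control assms(1) unfolding rp_control_def by fast
  then have "(\<omega> s t powr (1 / p)) ^ i = \<omega> s t powr (1 / p * real i)"
    using False by (simp add: powr_powr flip: powr_realpow)
  then show ?thesis by (simp add: eps_def)
qed (use assms in \<open>simp add: eps_def\<close>)

lemma path_bounds:
  assumes "(s, t) \<in> simplex2 T"
  shows "norm (x t - x s) \<le> eps s t" "norm (XX s t) \<le> eps s t ^ 2"
    "XX s t + transpose (XX s t) = tensor (x t - x s) (x t - x s)"
proof -
  have *: "norm (x t - x s) \<le> \<omega> s t powr (1 / p) \<and> norm (XX s t) \<le> \<omega> s t powr (2 / p) \<and>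
      (1 / 2) *\<^sub>R (XX s t + transpose (XX s t)) = (1 / 2) *\<^sub>R tensor (x t - x s) (x t - x s)"
    using rp assms unfolding weak_geometric_rough_path_def by fast
  show "norm (x t - x s) \<le> eps s t" using * by (simp add: eps_def)
  show "norm (XX s t) \<le> eps s t ^ 2" using * eps_power[OF assms, of 2] by simp
  show "XX s t + transpose (XX s t) = tensor (x t - x s) (x t - x s)" using * by simp
qed

lemma eventually_simplex2: "\<forall>\<^sub>F (s, t) in near_diag T r. (s, t) \<in> simplex2 T"
  by (auto simp: eventually_inf_principal)

text \<open>Near the diagonal, higher powers of \<open>eps\<close> may thus be estimated by lower
  ones.\<close>

lemma eventually_eps_le_1:
  assumes "r \<in> {0..T}"
  shows "\<forall>\<^sub>F (s, t) in near_diag T r. eps s t \<le> 1"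
proof -
  have "continuous_on (simplex2 T) (\<lambda>(s, t). \<omega> s t)" "\<omega> r r = 0"
    using control assms by (auto simp: rp_control_def)
  with continuous_on_tendsto_within[of "simplex2 T" "\<lambda>(s, t). \<omega> s t" "(r, r)"] assms
  have "((\<lambda>(s, t). \<omega> s t) \<longlongrightarrow> 0) (near_diag T r)" by (simp add: simplex2_iff)
  from order_tendstoD(2)[OF this, of 1]
  have "\<forall>\<^sub>F (s, t) in near_diag T r. \<omega> s t < 1" by (simp add: case_prod_unfold)
  with eventually_simplex2 show ?thesis
  proof (eventually_elim, unfold split_paired_all prod.case)
    fix s t assume "(s, t) \<in> simplex2 T" "\<omega> s t < 1"
    then have "0 \<le> \<omega> s t" "\<omega> s t \<le> 1" using control unfolding rp_control_def by fastforce+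
    then show "eps s t \<le> 1" unfolding eps_def using p by (intro powr_le1) auto
  qed
qed

section \<open>The controlled path in a chart\<close>

lemma tendsto_path: "r \<in> {0..T} \<Longrightarrow> (y \<longlongrightarrow> y r) (near_time T r)"
  using crp by (intro continuous_on_tendsto_within) (auto simp: crp_manifold_def)

lemma eventually_path_open:
  assumes "r \<in> {0..T}" "open N" "y r \<in> N"
  shows "\<forall>\<^sub>F s in near_time T r. y s \<in> N"
  using topological_tendstoD[OF tendsto_path[OF assms(1)] assms(2,3)] .

lemma eventually_path_chart:
  assumes "r \<in> {0..T}" "c \<in> charts_at A (y r)"
  shows "\<forall>\<^sub>F s in near_time T r. c \<in> charts_at A (y s)"
  using eventually_path_open[OF assms(1) open_chart(1)[OF charts_atD(1)[OF assms(2)]] charts_atD(2)[OF assms(2)]]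
  by (rule eventually_mono) (simp add: charts_at_def charts_atD[OF assms(2)])

lemma tendsto_path_coord:
  assumes "r \<in> {0..T}" "c \<in> charts_at A (y r)"
  shows "((\<lambda>s. snd c (y s)) \<longlongrightarrow> snd c (y r)) (near_time T r)"
proof -
  note c = charts_atD[OF assms(2)]
  have "isCont (snd c) (y r)"
    using continuous_chart[OF c(1)] open_chart(1)[OF c(1)] c(2) continuous_on_eq_continuous_at by blast
  from isCont_tendsto_compose[OF this tendsto_path[OF assms(1)]] show ?thesis .
qed

text \<open>Both orders are needed: logarithms are based at the earlier point, whereas the
  parallelisms acting on controlled paths along \<open>y\<close> have their values at the later
  one.\<close>

lemma eventually_path_coords:
  assumes r: "r \<in> {0..T}" "c \<in> charts_at A (y r)"
    and P: "\<forall>\<^sub>F (a, b) in nhds (snd c (y r), snd c (y r)). P a b"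
  shows "\<forall>\<^sub>F (s, t) in near_diag T r. P (snd c (y s)) (snd c (y t)) \<and> P (snd c (y t)) (snd c (y s))"
proof -
  obtain N where N: "\<forall>\<^sub>F a in nhds (snd c (y r)). N a" "\<And>a b. N a \<Longrightarrow> N b \<Longrightarrow> P a b"
  proof -
    obtain Q1 Q2 where Q: "eventually Q1 (nhds (snd c (y r)))" "eventually Q2 (nhds (snd c (y r)))"
        "\<And>a b. Q1 a \<Longrightarrow> Q2 b \<Longrightarrow> P a b"
      using P unfolding nhds_prod eventually_prod_filter by auto
    show thesis by (rule that[of "\<lambda>a. Q1 a \<and> Q2 a"]) (use Q in \<open>auto intro: eventually_conj\<close>)
  qed
  from eventually_near_diag_fst_snd[OF eventually_compose_filterlim[OF N(1) tendsto_path_coord[OF r]]]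
  show ?thesis by (rule eventually_mono) (auto intro: N(2))
qed

lemma eventually_path_domain:
  assumes "r \<in> {0..T}" "diagonal_domain D"
  shows "\<forall>\<^sub>F (s, t) in near_diag T r. (y s, y t) \<in> D \<and> (y t, y s) \<in> D"
proof -
  have "open D" "(y r, y r) \<in> D" using assms(2) by (auto simp: diagonal_domain_def)
  then obtain M N where MN: "open M" "open N" "y r \<in> M" "y r \<in> N" "M \<times> N \<subseteq> D"
    unfolding open_prod_def by fast
  have "\<forall>\<^sub>F s in near_time T r. y s \<in> M \<inter> N"
    by (rule eventually_path_open) (use assms MN in auto)
  from eventually_near_diag_fst_snd[OF this] show ?thesis
    by (rule eventually_mono) (use MN(5) in auto)
qed

lemma eventually_path_tnorm:
  assumes "r \<in> {0..T}" "c \<in> charts_at A (y r)"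
  shows "\<exists>K>0. \<forall>\<^sub>F s in near_time T r. tnorm_comparable c K s"
proof -
  note c = charts_atD[OF assms(2)]
  obtain K where K: "K > 0" "\<forall>\<^sub>F a in nhds (snd c (y r)). \<forall>v\<in>tangent_space A (cinv c a).
    norm (v c) \<le> K * tnorm g (cinv c a) v \<and> tnorm g (cinv c a) v \<le> K * norm (v c)"
    using tnorm_local_equivalence[OF metric c(1) chart_in_crange[OF c(2)]] by blast
  from eventually_compose_filterlim[OF K(2) tendsto_path_coord[OF assms]] eventually_path_chart[OF assms]
  have "\<forall>\<^sub>F s in near_time T r. tnorm_comparable c K s"
    by eventually_elim (simp add: cinv_chart[OF c(1)] charts_at_def)
  then show ?thesis using K(1) by blast
qed

lemma tnorm_nonneg: "v \<in> tangent_space A m \<Longrightarrow> tnorm g m v \<ge> 0"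
proof -
  assume v: "v \<in> tangent_space A m"
  have "tangent_linear A m (g m v)" "v \<noteq> 0 \<longrightarrow> g m v v > 0" using metric v unfolding riemannian_metric_def by blast+
  then show ?thesis using tangent_linearD(2)[of m "g m v" v 0] v by (cases "v = 0") (auto simp: tnorm_def)
qed

lemma path_deriv:
  assumes "s \<in> {0..T}"
  shows "y' s w \<in> tangent_space A (y s)" "linear (y' s)" "linear (\<lambda>w. y' s w c)"
proof -
  show 1: "y' s w \<in> tangent_space A (y s)" and 2: "linear (y' s)"
    using crp assms unfolding crp_manifold_def by blast+
  show "linear (\<lambda>w. y' s w c)"
    using linear_add[OF 2] linear_scale[OF 2] by (intro linearI) simp_all
qed

text \<open>Continuity of y' in the chart is given for each fixed vector; finitely many basis
  vectors make the bound uniform in \<open>w\<close>, with 1 as slack.\<close>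

lemma eventually_path_deriv_bounded:
  assumes r: "r \<in> {0..T}" and c: "c \<in> charts_at A (y r)"
  shows "\<exists>M\<ge>0. \<forall>\<^sub>F s in near_time T r. \<forall>w. norm (y' s w c) \<le> M * norm w"
proof -
  let ?S = "{s \<in> {0..T}. y s \<in> fst c}"
  define M where "M = (\<Sum>i\<in>(Basis::(real^'k) set). norm (y' r i c) + 1)"
  have "\<forall>\<^sub>F s in near_time T r. norm (y' s i c) \<le> norm (y' r i c) + 1" for i
  proof -
    have "continuous_on ?S (\<lambda>s. y' s i c)" using crp charts_atD[OF c] unfolding crp_manifold_def by blast
    from continuous_on_tendsto_within[OF this, of r] r charts_atD[OF c]
    have "((\<lambda>s. norm (y' s i c)) \<longlongrightarrow> norm (y' r i c)) (inf (nhds r) (principal ?S))" by (intro tendsto_norm) auto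
    from order_tendstoD(2)[OF this, of "norm (y' r i c) + 1"]
    have "\<forall>\<^sub>F s in near_time T r. s \<in> ?S \<longrightarrow> norm (y' s i c) < norm (y' r i c) + 1"
      by (simp add: eventually_inf_principal) (auto elim: eventually_mono)
    moreover have "\<forall>\<^sub>F s in near_time T r. s \<in> ?S"
      using eventually_path_chart[OF r c] unfolding eventually_inf_principal
      by (rule eventually_mono) (auto simp: charts_at_def)
    ultimately show ?thesis by eventually_elim auto
  qed
  then have "\<forall>\<^sub>F s in near_time T r. \<forall>i\<in>(Basis::(real^'k) set). norm (y' s i c) \<le> norm (y' r i c) + 1"
    by (intro eventually_ball_finite) auto
  moreover have "\<forall>\<^sub>F s in near_time T r. s \<in> {0..T}" by (simp add: eventually_inf_principal)
  ultimately have "\<forall>\<^sub>F s in near_time T r. \<forall>w. norm (y' s w c) \<le> M * norm w"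
  proof eventually_elim
    case (elim s)
    show ?case
    proof
      fix w
      have "norm (y' s w c) \<le> (\<Sum>i\<in>Basis. norm (y' s i c)) * norm w"
        by (rule norm_linear_basis_le[OF path_deriv(3)[OF elim(2)]])
      also have "\<dots> \<le> M * norm w" unfolding M_def using elim(1) by (intro mult_right_mono sum_mono) auto
      finally show "norm (y' s w c) \<le> M * norm w" .
    qed
  qed
  moreover have "M \<ge> 0" unfolding M_def by (intro sum_nonneg) auto
  ultimately show ?thesis by blast
qed

text \<open>The defining relations hold for some unknown gauge, which is eliminated here. They bound
  the logarithm by order 1; inverting it bounds the coordinate increment by order 1, and the two
  then differ by order 2. The parallelism differs from the identity by a multiple of the increment,
  which yields the bound for y'.\<close>

lemma eventually_path_increments:
  assumes r: "r \<in> {0..T}" and c: "c \<in> charts_at A (y r)"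
  shows "\<exists>C\<ge>0. \<forall>\<^sub>F (s, t) in near_diag T r.
    increment_bounds c C s t"
proof -
  note cA = charts_atD[OF c]
  note a0 = chart_in_crange[OF cA(2)]
  obtain D \<psi> V where gauge: "manifold_gauge A D \<psi> V" and
    ap2: "approx T p \<omega> 2 (\<lambda>s t. (y s, y t) \<in> D)
             (\<lambda>s t K. tnorm g (y s) (\<psi> (y s) (y t) - y' s (x t - x s)) \<le> K)" and
    ap1: "approx T p \<omega> 1 (\<lambda>s t. (y s, y t) \<in> D)
             (\<lambda>s t K. \<forall>w. tnorm g (y s) (V (y s) (y t) (y' t w) - y' s w) \<le> K * norm w)"
    using crp unfolding crp_manifold_def by blast
  have G: "diagonal_domain D" "logarithm A D \<psi>" "parallelism A D V"
    using gauge by (simp_all add: manifold_gauge_def)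
  obtain C1 where C1: "C1 \<ge> 0" "\<forall>\<^sub>F (s, t) in near_diag T r. (y s, y t) \<in> D \<and>
      tnorm g (y s) (\<psi> (y s) (y t) - y' s (x t - x s)) \<le> C1 * \<omega> s t powr (real 2 / p)"
    using approx_localD[OF _ ap2, of r] by force
  obtain C2 where C2: "C2 \<ge> 0" "\<forall>\<^sub>F (s, t) in near_diag T r. (y s, y t) \<in> D \<and>
      (\<forall>w. tnorm g (y s) (V (y s) (y t) (y' t w) - y' s w) \<le> C2 * \<omega> s t powr (real 1 / p) * norm w)"
  proof -
    have "\<exists>C\<ge>0. \<forall>\<^sub>F (s, t) in near_diag T r. (y s, y t) \<in> D \<and>
      (\<forall>w. tnorm g (y s) (V (y s) (y t) (y' t w) - y' s w) \<le> C * \<omega> s t powr (real 1 / p) * norm w)"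
      by (rule approx_localD[OF _ ap1]) (meson mult_right_mono norm_ge_zero order_trans)
    then show thesis using that by blast
  qed
  obtain Cq where Cq: "Cq \<ge> 0" "\<forall>\<^sub>F (a, b) in nhds (snd c (y r), snd c (y r)).
      norm (log_coord \<psi> c c (a, b) - (b - a)) \<le> Cq * norm (b - a)^2 \<and> norm (b - a) \<le> 2 * norm (log_coord \<psi> c c (a, b))"
    using log_coord_quadratic[OF G(2,1) cA(1) a0] by blast
  obtain L where L: "L \<ge> 0" "\<forall>\<^sub>F (a, b) in nhds (snd c (y r), snd c (y r)). par_bounds A V c L a b"
    using parallelism_local_bounds[OF G(3,1) cA(1) a0] by blast
  obtain K where K: "K > 0" "\<forall>\<^sub>F s in near_time T r. tnorm_comparable c K s"
    using eventually_path_tnorm[OF r c] by blast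
  obtain M where M: "M \<ge> 0" "\<forall>\<^sub>F s in near_time T r. \<forall>w. norm (y' s w c) \<le> M * norm w"
    using eventually_path_deriv_bounded[OF r c] by blast
  \<comment> \<open>\<open>norm \<phi>\<close> is at most M + K C1 times \<open>eps\<close>; the
    factor 2 comes from inverting the logarithm.\<close>
  define C3 where "C3 = 2 * (M + K * C1)"
  have C3: "C3 \<ge> 0" using M C1 K by (simp add: C3_def)
  define C where "C = C3 + (Cq * C3^2 + K * C1) + (L * C3 * M + K * C2)"
  have C: "C3 \<le> C" "Cq * C3^2 + K * C1 \<le> C" "L * C3 * M + K * C2 \<le> C" "C \<ge> 0"
    using C3 Cq(1) K(1) C1(1) C2(1) L(1) M(1) by (auto simp: C_def)
  have "\<forall>\<^sub>F (s, t) in near_diag T r.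
    increment_bounds c C s t"
    using C1(2) C2(2) eventually_path_coords[OF r c Cq(2)] eventually_path_coords[OF r c L(2)]
      eventually_near_diag_fst_snd[OF K(2)] eventually_near_diag_fst_snd[OF M(2)]
      eventually_near_diag_fst_snd[OF eventually_path_chart[OF r c]] eventually_simplex2 eventually_eps_le_1[OF r]
  proof (eventually_elim, unfold split_paired_all prod.case)
    fix s t
    assume ap2: "(y s, y t) \<in> D \<and> tnorm g (y s) (\<psi> (y s) (y t) - y' s (x t - x s)) \<le> C1 * \<omega> s t powr (real 2 / p)"
      and ap1: "(y s, y t) \<in> D \<and> (\<forall>w. tnorm g (y s) (V (y s) (y t) (y' t w) - y' s w) \<le> C2 * \<omega> s t powr (real 1 / p) * norm w)"
      and q: "(norm (log_coord \<psi> c c (snd c (y s), snd c (y t)) - (snd c (y t) - snd c (y s)))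
          \<le> Cq * norm (snd c (y t) - snd c (y s))^2 \<and>
        norm (snd c (y t) - snd c (y s)) \<le> 2 * norm (log_coord \<psi> c c (snd c (y s), snd c (y t)))) \<and>
        norm (log_coord \<psi> c c (snd c (y t), snd c (y s)) - (snd c (y s) - snd c (y t)))
          \<le> Cq * norm (snd c (y s) - snd c (y t))^2 \<and>
        norm (snd c (y s) - snd c (y t)) \<le> 2 * norm (log_coord \<psi> c c (snd c (y t), snd c (y s)))"
      and pb: "par_bounds A V c L (snd c (y s)) (snd c (y t)) \<and> par_bounds A V c L (snd c (y t)) (snd c (y s))"
      and k: "tnorm_comparable c K s \<and>
         tnorm_comparable c K t"
      and m: "(\<forall>w. norm (y' s w c) \<le> M * norm w) \<and> (\<forall>w. norm (y' t w c) \<le> M * norm w)"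
      and ch: "c \<in> charts_at A (y s) \<and> c \<in> charts_at A (y t)" and S: "(s, t) \<in> simplex2 T" and e1: "eps s t \<le> 1"
    define e where "e = eps s t"
    define h where "h = snd c (y t) - snd c (y s)"
    define \<phi> where "\<phi> = log_coord \<psi> c c (snd c (y s), snd c (y t))"
    define \<eta> where "\<eta> = y' s (x t - x s) c"
    have e: "0 \<le> e" "e \<le> 1" using e1 eps_nonneg by (simp_all add: e_def)
    have ee: "e^2 \<le> e" using e by (simp add: power2_eq_square mult_left_le)
    have st: "s \<in> {0..T}" "t \<in> {0..T}" using S by (auto simp: simplex2_iff)
    have \<phi>_eq: "\<phi> = \<psi> (y s) (y t) c"
      using ch by (simp add: \<phi>_def log_coord_def cinv_chart charts_at_def)
    have tan: "\<psi> (y s) (y t) - y' s (x t - x s) \<in> tangent_space A (y s)"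
      by (rule subspace_diff[OF subspace_tangent_space logarithm_in_tangent_space[OF G(2)] path_deriv(1)[OF st(1)]])
        (use ap2 in blast)
    have "norm ((\<psi> (y s) (y t) - y' s (x t - x s)) c) \<le> K * tnorm g (y s) (\<psi> (y s) (y t) - y' s (x t - x s))"
      using k tan by blast
    also have "\<dots> \<le> K * (C1 * e^2)"
      using ap2 K(1) eps_power[OF S, of 2] by (intro mult_left_mono) (auto simp: e_def)
    finally have n1: "norm (\<phi> - \<eta>) \<le> K * C1 * e^2" by (simp add: \<phi>_eq \<eta>_def)
    have "norm \<eta> \<le> M * norm (x t - x s)" using m by (simp add: \<eta>_def)
    also have "\<dots> \<le> M * e" using path_bounds(1)[OF S] M(1) by (intro mult_left_mono) (auto simp: e_def)
    finally have n2: "norm \<eta> \<le> M * e" .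
    have "norm \<phi> \<le> norm (\<phi> - \<eta>) + norm \<eta>" by (metis diff_add_cancel norm_triangle_ineq)
    also have "\<dots> \<le> K * C1 * e + M * e"
    proof (rule add_mono[OF order_trans[OF n1] n2])
      show "K * C1 * e^2 \<le> K * C1 * e" using K(1) C1(1) by (intro mult_left_mono[OF ee]) simp
    qed
    finally have "2 * norm \<phi> \<le> C3 * e" by (simp add: C3_def algebra_simps)
    then have h: "norm h \<le> C3 * e" using q by (simp add: h_def \<phi>_def)
    have "norm (h - \<eta>) \<le> norm (\<phi> - \<eta>) + norm (\<phi> - h)"
      using norm_triangle_ineq4[of "\<phi> - \<eta>" "\<phi> - h"] by simp
    also have "\<dots> \<le> K * C1 * e^2 + Cq * (C3 * e)^2"
      using n1 q power_mono[OF h, of 2] mult_left_mono[OF _ Cq(1)]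
      by (intro add_mono n1) (force simp: h_def \<phi>_def)
    finally have h\<eta>: "norm (h - \<eta>) \<le> (Cq * C3^2 + K * C1) * e^2" by (simp add: algebra_simps power_mult_distrib)
    have dw: "norm (y' t w c - y' s w c) \<le> (L * C3 * M + K * C2) * e * norm w" for w
    proof -
      have yt: "y' t w \<in> tangent_space A (y t)" by (rule path_deriv(1)[OF st(2)])
      have tan: "V (y s) (y t) (y' t w) - y' s w \<in> tangent_space A (y s)"
        by (rule subspace_diff[OF subspace_tangent_space parallelism_in_tangent_space[OF G(3) _ yt] path_deriv(1)[OF st(1)]])
          (use ap2 in blast)
      have "norm ((V (y s) (y t) (y' t w) - y' s w) c) \<le> K * tnorm g (y s) (V (y s) (y t) (y' t w) - y' s w)"
        using k tan by blast
      also have "\<dots> \<le> K * (C2 * e * norm w)"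
        using ap1 K(1) eps_power[OF S, of 1] by (intro mult_left_mono) (auto simp: e_def)
      finally have 1: "norm (V (y s) (y t) (y' t w) c - y' s w c) \<le> K * (C2 * e * norm w)" by simp
      have "norm (V (y s) (y t) (y' t w) c - y' t w c) \<le> L * norm (snd c (y s) - snd c (y t)) * norm (y' t w c)"
        using pb ch yt by (simp add: parallelism_coord par_bounds_def)
      also have "\<dots> \<le> L * (C3 * e) * (M * norm w)"
        using h m L(1) C3 e by (intro mult_mono mult_nonneg_nonneg) (auto simp: h_def norm_minus_commute)
      finally have 2: "norm (V (y s) (y t) (y' t w) c - y' t w c) \<le> L * (C3 * e) * (M * norm w)" .
      have "norm (y' t w c - y' s w c) \<le> norm (V (y s) (y t) (y' t w) c - y' s w c) + norm (V (y s) (y t) (y' t w) c - y' t w c)"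
        using norm_triangle_ineq4[of "V (y s) (y t) (y' t w) c - y' s w c" "V (y s) (y t) (y' t w) c - y' t w c"] by simp
      also have "\<dots> \<le> K * (C2 * e * norm w) + L * (C3 * e) * (M * norm w)" by (rule add_mono[OF 1 2])
      finally show ?thesis by (simp add: algebra_simps)
    qed
    have "norm h \<le> C * e" using h mult_right_mono[OF C(1) e(1)] by linarith
    moreover have "norm (h - \<eta>) \<le> C * e^2"
      using h\<eta> mult_right_mono[OF C(2), of "e^2"] by force
    moreover have "norm (y' t w c - y' s w c) \<le> C * e * norm w" for w
      using dw[of w] mult_right_mono[OF mult_right_mono[OF C(3) e(1)], of "norm w"] by force
    ultimately show "increment_bounds c C s t"
      by (simp add: e_def h_def \<eta>_def)
  qed
  then show ?thesis using C(4) by blast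
qed

section \<open>Controlled paths along \<open>y\<close> in a chart\<close>

lemma crp_alongD:
  assumes "(\<alpha>, \<alpha>') \<in> crp_along A g T p \<omega> x y D U" "s \<in> {0..T}"
  shows "tangent_linear A (y s) (\<alpha> s)" "tangent_linear A (y s) (\<alpha>' s w)"
    "v \<in> tangent_space A (y s) \<Longrightarrow> linear (\<lambda>w. \<alpha>' s w v)"
    "\<alpha>' s w \<in> extensional (tangent_space A (y s))" "\<alpha> s \<in> extensional (tangent_space A (y s))"
    "\<alpha> \<in> extensional {0..T}" "\<alpha>' \<in> extensional {0..T}"
  using assms unfolding crp_along_def by blast+

lemma crp_along_local_expansion:
  assumes r: "r \<in> {0..T}" and c: "c \<in> charts_at A (y r)"
    and \<alpha>: "(\<alpha>, \<alpha>') \<in> crp_along A g T p \<omega> x y D U"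
  shows "\<exists>C\<ge>0. \<forall>\<^sub>F (s, t) in near_diag T r. (y t, y s) \<in> D \<and> crp_expansion \<alpha> \<alpha>' U c C s t"
proof -
  obtain K where K: "K > 0" "\<forall>\<^sub>F s in near_time T r. tnorm_comparable c K s"
    using eventually_path_tnorm[OF r c] by blast
  have ap: "approx T p \<omega> 2 (\<lambda>s t. (y t, y s) \<in> D)
          (\<lambda>s t K. \<forall>v\<in>tangent_space A (y s).
             norm (\<alpha> t (U (y t) (y s) v) - \<alpha> s v - \<alpha>' s (x t - x s) v) \<le> K * tnorm g (y s) v)"
    "approx T p \<omega> 1 (\<lambda>s t. (y t, y s) \<in> D)
          (\<lambda>s t K. \<forall>w. \<forall>v\<in>tangent_space A (y s).
             norm (\<alpha>' t w (U (y t) (y s) v) - \<alpha>' s w v) \<le> K * norm w * tnorm g (y s) v)"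
    using \<alpha> unfolding crp_along_def by blast+
  have "\<exists>C\<ge>0. \<forall>\<^sub>F (s, t) in near_diag T r. (y t, y s) \<in> D \<and> (\<forall>v\<in>tangent_space A (y s).
     norm (\<alpha> t (U (y t) (y s) v) - \<alpha> s v - \<alpha>' s (x t - x s) v) \<le> C * \<omega> s t powr (real 2 / p) * tnorm g (y s) v)"
    by (rule approx_localD[OF _ ap(1)]) (meson mult_right_mono tnorm_nonneg order_trans)
  then obtain C1 where C1: "C1 \<ge> 0" "\<forall>\<^sub>F (s, t) in near_diag T r. (y t, y s) \<in> D \<and> (\<forall>v\<in>tangent_space A (y s).
     norm (\<alpha> t (U (y t) (y s) v) - \<alpha> s v - \<alpha>' s (x t - x s) v) \<le> C1 * \<omega> s t powr (real 2 / p) * tnorm g (y s) v)"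
    by blast
  have "\<exists>C\<ge>0. \<forall>\<^sub>F (s, t) in near_diag T r. (y t, y s) \<in> D \<and> (\<forall>w. \<forall>v\<in>tangent_space A (y s).
     norm (\<alpha>' t w (U (y t) (y s) v) - \<alpha>' s w v) \<le> C * \<omega> s t powr (real 1 / p) * norm w * tnorm g (y s) v)"
    by (rule approx_localD[OF _ ap(2)]) (meson mult_right_mono tnorm_nonneg norm_ge_zero order_trans)
  then obtain C2 where C2: "C2 \<ge> 0" "\<forall>\<^sub>F (s, t) in near_diag T r. (y t, y s) \<in> D \<and> (\<forall>w. \<forall>v\<in>tangent_space A (y s).
     norm (\<alpha>' t w (U (y t) (y s) v) - \<alpha>' s w v) \<le> C2 * \<omega> s t powr (real 1 / p) * norm w * tnorm g (y s) v)"
    by blast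
  define C where "C = (C1 + C2) * K"
  have C: "C1 * K \<le> C" "C2 * K \<le> C" "C \<ge> 0" using C1 C2 K by (auto simp: C_def distrib_right)
  have "\<forall>\<^sub>F (s, t) in near_diag T r. (y t, y s) \<in> D \<and> crp_expansion \<alpha> \<alpha>' U c C s t"
    using C1(2) C2(2) eventually_near_diag_fst_snd[OF K(2)] eventually_simplex2
  proof (eventually_elim, unfold split_paired_all prod.case, intro conjI ballI allI)
    fix s t v w
    assume 1: "(y t, y s) \<in> D \<and> (\<forall>v\<in>tangent_space A (y s).
       norm (\<alpha> t (U (y t) (y s) v) - \<alpha> s v - \<alpha>' s (x t - x s) v) \<le> C1 * \<omega> s t powr (real 2 / p) * tnorm g (y s) v)"
     and 2: "(y t, y s) \<in> D \<and> (\<forall>w. \<forall>v\<in>tangent_space A (y s).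
       norm (\<alpha>' t w (U (y t) (y s) v) - \<alpha>' s w v) \<le> C2 * \<omega> s t powr (real 1 / p) * norm w * tnorm g (y s) v)"
     and k: "tnorm_comparable c K s \<and>
         tnorm_comparable c K t"
     and S: "(s, t) \<in> simplex2 T"
    show "(y t, y s) \<in> D" using 1 by blast
    assume v: "v \<in> tangent_space A (y s)"
    have tn: "tnorm g (y s) v \<le> K * norm (v c)" using k v by blast
    note e = eps_nonneg[of s t]
    have "norm (\<alpha> t (U (y t) (y s) v) - \<alpha> s v - \<alpha>' s (x t - x s) v) \<le> C1 * eps s t ^ 2 * tnorm g (y s) v"
      using 1 v eps_power[OF S, of 2] by auto
    also have "\<dots> \<le> C1 * eps s t ^ 2 * (K * norm (v c))" using tn C1(1) by (intro mult_left_mono) auto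
    also have "\<dots> = C1 * K * (eps s t ^ 2 * norm (v c))" by simp
    also have "\<dots> \<le> C * (eps s t ^ 2 * norm (v c))" by (rule mult_right_mono[OF C(1)]) simp
    finally show "norm (\<alpha> t (U (y t) (y s) v) - \<alpha> s v - \<alpha>' s (x t - x s) v) \<le> C * eps s t ^ 2 * norm (v c)"
      by (simp add: mult.assoc)
    have "norm (\<alpha>' t w (U (y t) (y s) v) - \<alpha>' s w v) \<le> C2 * eps s t * norm w * tnorm g (y s) v"
      using 2 v eps_power[OF S, of 1] by auto
    also have "\<dots> \<le> C2 * eps s t * norm w * (K * norm (v c))" using tn C2(1) e by (intro mult_left_mono) auto
    also have "\<dots> = C2 * K * (eps s t * norm w * norm (v c))" by simp
    also have "\<dots> \<le> C * (eps s t * norm w * norm (v c))" by (rule mult_right_mono[OF C(2)]) (simp add: e)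
    finally show "norm (\<alpha>' t w (U (y t) (y s) v) - \<alpha>' s w v) \<le> C * eps s t * norm w * norm (v c)"
      by (simp add: mult.assoc)
  qed
  then show ?thesis using C(3) by blast
qed

text \<open>Both components are transported from one base time in the past, where they are bounded because the
  tangent space is finite-dimensional.\<close>

lemma crp_along_locally_bounded:
  assumes r: "r \<in> {0..T}" and c: "c \<in> charts_at A (y r)" and U: "parallelism A D U" "diagonal_domain D"
    and \<alpha>: "(\<alpha>, \<alpha>') \<in> crp_along A g T p \<omega> x y D U"
  shows "\<exists>C\<ge>0. \<forall>\<^sub>F s in near_time T r. crp_bounded \<alpha> \<alpha>' c C s"
proof -
  note cA = charts_atD[OF c]
  obtain C where C: "C \<ge> 0" "\<forall>\<^sub>F (s, t) in near_diag T r. (y t, y s) \<in> D \<and> crp_expansion \<alpha> \<alpha>' U c C s t"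
    using crp_along_local_expansion[OF r c \<alpha>] by blast
  obtain L where L: "\<forall>\<^sub>F (a, b) in nhds (snd c (y r), snd c (y r)). par_bounds A U c L a b"
    using parallelism_local_bounds[OF U cA(1) chart_in_crange[OF cA(2)]] by blast
  have "\<forall>\<^sub>F (s, t) in near_diag T r. (c \<in> charts_at A (y s) \<and> c \<in> charts_at A (y t)) \<and>
      (s, t) \<in> simplex2 T \<and> eps s t \<le> 1 \<and> par_bounds A U c L (snd c (y t)) (snd c (y s)) \<and>
      (y t, y s) \<in> D \<and> crp_expansion \<alpha> \<alpha>' U c C s t"
    using C(2) eventually_path_coords[OF r c L] eventually_near_diag_fst_snd[OF eventually_path_chart[OF r c]]
      eventually_simplex2 eventually_eps_le_1[OF r]
    by eventually_elim auto
  from eventually_near_diag_base_point[OF this r]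
  obtain s where s: "s \<in> {0..T}" and ev: "\<forall>\<^sub>F t in near_time T r. (c \<in> charts_at A (y s) \<and> c \<in> charts_at A (y t)) \<and>
      (s, t) \<in> simplex2 T \<and> eps s t \<le> 1 \<and> par_bounds A U c L (snd c (y t)) (snd c (y s)) \<and>
      (y t, y s) \<in> D \<and> crp_expansion \<alpha> \<alpha>' U c C s t"
    by blast
  show ?thesis
  \<comment> \<open>This condition does not involve t. If it fails, the eventual property is
    eventually false and the claim is trivial, so the filter need not be shown to be proper.\<close>
  proof (cases "c \<in> charts_at A (y s)")
    case False
    then have "\<forall>\<^sub>F t in near_time T r. False" using ev by (auto elim: eventually_mono)
    then have "\<forall>\<^sub>F t in near_time T r. crp_bounded \<alpha> \<alpha>' c 0 t"
      by (rule eventually_mono) blast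
    then show ?thesis by blast
  next
    case ch: True
    have lin: "linear (\<lambda>e. \<alpha> s (coord_vec A c (y s) e))"
      by (rule tangent_linear_coord_vec[OF crp_alongD(1)[OF \<alpha> s] ch])
    define B1 where "B1 = (\<Sum>i\<in>Basis. norm (\<alpha> s (coord_vec A c (y s) i)))"
    have B1: "B1 \<ge> 0" "norm (\<alpha> s v) \<le> B1 * norm (v c)" if "v \<in> tangent_space A (y s)" for v
      using norm_linear_basis_le[OF lin, of "v c"] coord_vec_of[OF ch that]
      by (auto simp: B1_def intro: sum_nonneg)
    have B10: "B1 \<ge> 0" by (simp add: B1_def sum_nonneg)
    obtain B2 where B2: "B2 \<ge> 0" "\<forall>w e. norm (\<alpha>' s w (coord_vec A c (y s) e)) \<le> B2 * norm w * norm e"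
      using norm_bilinear_basis_le[of "\<lambda>w e. \<alpha>' s w (coord_vec A c (y s) e)",
          OF crp_alongD(3)[OF \<alpha> s coord_vec_in_tangent_space[OF ch]]
            tangent_linear_coord_vec[OF crp_alongD(2)[OF \<alpha> s] ch]]
      by blast
    have B2': "norm (\<alpha>' s w v) \<le> B2 * norm w * norm (v c)" if "v \<in> tangent_space A (y s)" for v w
      using B2(2)[rule_format, of w "v c"] coord_vec_of[OF ch that] by simp
    define K where "K = 2 * (B1 + B2 + C)"
    have K: "K \<ge> 0" using B10 B2 C by (simp add: K_def)
    from ev have "\<forall>\<^sub>F t in near_time T r. crp_bounded \<alpha> \<alpha>' c K t"
    proof (rule eventually_mono, intro ballI conjI allI)
      fix t v w
      assume H: "(c \<in> charts_at A (y s) \<and> c \<in> charts_at A (y t)) \<and>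
      (s, t) \<in> simplex2 T \<and> eps s t \<le> 1 \<and> par_bounds A U c L (snd c (y t)) (snd c (y s)) \<and>
      (y t, y s) \<in> D \<and> crp_expansion \<alpha> \<alpha>' U c C s t"
      assume v: "v \<in> tangent_space A (y t)"
      \<comment> \<open>The relations between s and t are applied to the pulled back vector
        \<open>q\<close>; its bound by \<open>2 * norm (v c)\<close> explains the factor 2 in
        \<open>K\<close>.\<close>
      obtain q where q: "q \<in> tangent_space A (y s)" "U (y t) (y s) q = v" "norm (q c) \<le> 2 * norm (v c)"
        using parallelism_surj[OF U(1) _ ch _ _ v, of L] H by blast
      have e: "0 \<le> eps s t" "eps s t \<le> 1" using H eps_nonneg by auto
      then have e2: "eps s t ^ 2 \<le> 1" by (simp add: power_le_one)
      have dx: "norm (x t - x s) \<le> 1" using path_bounds(1)[of s t] H e by auto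
      have "norm (\<alpha> t v - \<alpha> s q - \<alpha>' s (x t - x s) q) \<le> C * eps s t ^ 2 * norm (q c)" using H q by blast
      also have "\<dots> \<le> C * 1 * norm (q c)" using e2 C(1) by (intro mult_right_mono mult_left_mono) auto
      finally have 1: "norm (\<alpha> t v - \<alpha> s q - \<alpha>' s (x t - x s) q) \<le> C * norm (q c)" by simp
      have "norm (\<alpha>' s (x t - x s) q) \<le> B2 * norm (x t - x s) * norm (q c)" by (rule B2'[OF q(1)])
      also have "\<dots> \<le> B2 * 1 * norm (q c)" using dx B2(1) by (intro mult_right_mono mult_left_mono) auto
      finally have 2: "norm (\<alpha>' s (x t - x s) q) \<le> B2 * norm (q c)" by simp
      have "\<alpha> t v = (\<alpha> t v - \<alpha> s q - \<alpha>' s (x t - x s) q) + \<alpha> s q + \<alpha>' s (x t - x s) q" by simp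
      also have "norm \<dots> \<le> C * norm (q c) + B1 * norm (q c) + B2 * norm (q c)"
        by (intro norm_triangle_le add_mono 1 2 B1(2) q(1))
      also have "\<dots> = (B1 + B2 + C) * norm (q c)" by (simp add: algebra_simps)
      also have "\<dots> \<le> (B1 + B2 + C) * (2 * norm (v c))" using q(3) B10 B2 C by (intro mult_left_mono) auto
      finally show "norm (\<alpha> t v) \<le> K * norm (v c)" by (simp add: K_def algebra_simps)
      have "norm (\<alpha>' t w v - \<alpha>' s w q) \<le> C * eps s t * norm w * norm (q c)" using H q by blast
      also have "\<dots> \<le> C * 1 * norm w * norm (q c)" using e C(1) by (intro mult_right_mono mult_left_mono) auto
      finally have 3: "norm (\<alpha>' t w v - \<alpha>' s w q) \<le> C * norm w * norm (q c)" by simp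
      have "\<alpha>' t w v = (\<alpha>' t w v - \<alpha>' s w q) + \<alpha>' s w q" by simp
      also have "norm \<dots> \<le> C * norm w * norm (q c) + B2 * norm w * norm (q c)"
        by (intro norm_triangle_le add_mono 3 B2' q(1))
      also have "\<dots> = (B2 + C) * norm w * norm (q c)" by (simp add: algebra_simps)
      also have "\<dots> \<le> (B1 + B2 + C) * norm w * (2 * norm (v c))"
        using q(3) B10 B2 C by (intro mult_mono) auto
      finally show "norm (\<alpha>' t w v) \<le> K * norm w * norm (v c)" by (simp add: K_def algebra_simps)
    qed
    then show ?thesis using K by blast
  qed
qed

end

section \<open>Change of parallelism\<close>

lemma tensor_lift_apply: "tensor_lift B X c = tensor_lift (\<lambda>a b. B a b c) X"
  by (simp add: tensor_lift_def sum_fun_apply)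

lemma tensor_lift_add: "tensor_lift (\<lambda>a b. B a b + B' a b) X = tensor_lift B X + tensor_lift B' X"
  by (simp add: tensor_lift_def scaleR_add_right sum.distrib)

lemma tensor_lift_diff: "tensor_lift (\<lambda>a b. B a b - B' a b) X = tensor_lift B X - tensor_lift B' X"
  by (simp add: tensor_lift_def scaleR_diff_right sum_subtractf)

lemma tensor_lift_tensor:
  fixes B :: "real^'k \<Rightarrow> real^'k \<Rightarrow> 'b::real_vector"
  assumes "\<And>e. linear (\<lambda>v. B v e)" "\<And>v. linear (B v)"
  shows "tensor_lift B (tensor u v) = B u v"
proof -
  have u: "(\<Sum>i\<in>UNIV. (u $ i) *\<^sub>R axis i 1) = u" for u :: "real^'k"
    using basis_expansion[of u] by (simp add: scalar_mult_eq_scaleR)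
  have "B u v = B (\<Sum>i\<in>UNIV. (u $ i) *\<^sub>R axis i 1) (\<Sum>j\<in>UNIV. (v $ j) *\<^sub>R axis j 1)" by (simp only: u)
  also have "\<dots> = (\<Sum>i\<in>UNIV. (u $ i) *\<^sub>R B (axis i 1) (\<Sum>j\<in>UNIV. (v $ j) *\<^sub>R axis j 1))"
    by (simp only: linear_sum[OF assms(1)] linear_scale[OF assms(1)])
  also have "\<dots> = (\<Sum>i\<in>UNIV. (u $ i) *\<^sub>R (\<Sum>j\<in>UNIV. (v $ j) *\<^sub>R B (axis i 1) (axis j 1)))"
    by (simp only: linear_sum[OF assms(2)] linear_scale[OF assms(2)])
  also have "\<dots> = tensor_lift B (tensor u v)"
    by (simp add: tensor_lift_def tensor_def scaleR_sum_right)
  finally show ?thesis by simp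
qed

text \<open>A symmetric bilinear map sees only the symmetric part of \<open>X\<close>, since
  transposition swaps its arguments; that part is half the tensor square of
  \<open>u\<close>.\<close>

lemma tensor_lift_symmetric:
  fixes B :: "real^'k \<Rightarrow> real^'k \<Rightarrow> 'b::real_vector"
  assumes "\<And>e. linear (\<lambda>v. B v e)" "\<And>v. linear (B v)" "\<And>v e. B v e = B e v"
    and "X + transpose X = tensor u u"
  shows "tensor_lift B X = (1/2) *\<^sub>R B u u"
proof -
  have "tensor_lift B (transpose X) = tensor_lift (\<lambda>a b. B b a) X"
    unfolding tensor_lift_def transpose_def by (subst sum.swap) simp
  also have "\<dots> = tensor_lift B X" using assms(3) by (intro arg_cong2[where f = tensor_lift]) (auto simp: fun_eq_iff)
  finally have "tensor_lift B X + tensor_lift B X = tensor_lift B X + tensor_lift B (transpose X)" by simp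
  also have "\<dots> = tensor_lift B (X + transpose X)"
    by (simp add: tensor_lift_def scaleR_add_left sum.distrib)
  also have "\<dots> = B u u" unfolding assms(4) by (rule tensor_lift_tensor[OF assms(1,2)])
  finally have "2 *\<^sub>R tensor_lift B X = B u u" by (simp add: scaleR_2)
  then show ?thesis by (metis scaleR_half_double scaleR_2 scaleR_scaleR mult.commute)
qed

context smooth_manifold
begin

lemma tangent_linear_diff:
  assumes "tangent_linear A m f" "v \<in> tangent_space A m" "w \<in> tangent_space A m"
  shows "f (v - w) = f v - f w"
  using tangent_linearD(1)[OF assms(1) subspace_diff[OF subspace_tangent_space assms(2,3)] assms(3)] by simp

lemma tangent_linear_zero: "tangent_linear A m f \<Longrightarrow> f 0 = 0"
  using tangent_linearD(2)[of m f 0 0] subspace_0[OF subspace_tangent_space] by simp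

text \<open>\<open>f\<close> is known to be linear on the tangent space only, so every partial sum
  has to be kept inside it.\<close>

lemma tangent_linear_tensor_lift:
  assumes f: "tangent_linear A m f" and B: "\<And>a b. B a b \<in> tangent_space A m"
  shows "f (tensor_lift B X) = tensor_lift (\<lambda>a b. f (B a b)) X"
    and "tensor_lift B X \<in> tangent_space A m"
proof -
  note ts = subspace_tangent_space
  have sum: "f (\<Sum>i\<in>I. h i) = (\<Sum>i\<in>I. f (h i))" if "\<And>i. h i \<in> tangent_space A m" for I :: "'i set" and h
  proof (induction I rule: infinite_finite_induct)
    case (insert i I)
    have "f (h i + (\<Sum>i\<in>I. h i)) = f (h i) + f (\<Sum>i\<in>I. h i)"
      by (intro tangent_linearD(1)[OF f] that subspace_sum[OF ts])
    then show ?case unfolding sum.insert[OF insert.hyps(1,2)] insert.IH .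
  next
    case (infinite I)
    show ?case unfolding sum.infinite[OF infinite] by (rule tangent_linear_zero[OF f])
  next
    case empty
    show ?case unfolding sum.empty by (rule tangent_linear_zero[OF f])
  qed
  have in1: "(\<Sum>j\<in>UNIV. (X $ i $ j) *\<^sub>R B (axis i 1) (axis j 1)) \<in> tangent_space A m" for i
    by (intro subspace_sum[OF ts] subspace_scale[OF ts] B)
  show "tensor_lift B X \<in> tangent_space A m"
    unfolding tensor_lift_def by (intro subspace_sum[OF ts] in1)
  show "f (tensor_lift B X) = tensor_lift (\<lambda>a b. f (B a b)) X"
    unfolding tensor_lift_def
    by (simp add: sum in1 subspace_scale[OF ts] B tangent_linearD(2)[OF f])
qed

lemma compat_in_tangent_space:
  assumes U: "parallelism A D U" "diagonal_domain D" and U': "parallelism A D' U'" "diagonal_domain D'"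
    and "v \<in> tangent_space A m" "w \<in> tangent_space A m"
  shows "compat A U' U m v w \<in> tangent_space A m"
proof -
  obtain c where c: "c \<in> charts_at A m" using exists_chart .
  show ?thesis unfolding compat_chart[OF U U' c assms(5,6)] by (rule coord_vec_in_tangent_space[OF c])
qed

lemma compat_coord:
  assumes U: "parallelism A D U" "diagonal_domain D" and U': "parallelism A D' U'" "diagonal_domain D'"
    and c: "c \<in> charts_at A m" and "v \<in> tangent_space A m" "w \<in> tangent_space A m"
  shows "compat A U' U m v w c = christoffel A U' c (snd c m) (v c) (w c) - christoffel A U c (snd c m) (v c) (w c)"
  unfolding compat_chart[OF assms] by (rule coord_vec_self[OF c])

lemma compat_swap:
  assumes U: "parallelism A D U" "diagonal_domain D" and U': "parallelism A D' U'" "diagonal_domain D'"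
    and v: "v \<in> tangent_space A m" and w: "w \<in> tangent_space A m"
  shows "compat A U U' m v w + compat A U' U m v w = 0"
proof -
  obtain c where c: "c \<in> charts_at A m" using exists_chart .
  show ?thesis
  proof (rule tangent_eqI[OF c])
    show "compat A U U' m v w + compat A U' U m v w \<in> tangent_space A m"
      by (rule subspace_add[OF subspace_tangent_space compat_in_tangent_space[OF U' U v w]
            compat_in_tangent_space[OF U U' v w]])
    show "(compat A U U' m v w + compat A U' U m v w) c = 0 c"
      using compat_coord[OF U U' c v w] compat_coord[OF U' U c v w] by simp
  qed (rule subspace_0[OF subspace_tangent_space])
qed

text \<open>Bilinearity is hidden in the definition by a derivative of an inverse; in a chart it is
  that of the Christoffel symbols.\<close>

lemma compat_linear:
  assumes U: "parallelism A D U" "diagonal_domain D" and U': "parallelism A D' U'" "diagonal_domain D'"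
  shows "v \<in> tangent_space A m \<Longrightarrow> w \<in> tangent_space A m \<Longrightarrow> w' \<in> tangent_space A m \<Longrightarrow>
      compat A U' U m v (w + w') = compat A U' U m v w + compat A U' U m v w'"
    and "v \<in> tangent_space A m \<Longrightarrow> w \<in> tangent_space A m \<Longrightarrow>
      compat A U' U m v (a *\<^sub>R w) = a *\<^sub>R compat A U' U m v w"
    and "v \<in> tangent_space A m \<Longrightarrow> v' \<in> tangent_space A m \<Longrightarrow> w \<in> tangent_space A m \<Longrightarrow>
      compat A U' U m (v + v') w = compat A U' U m v w + compat A U' U m v' w"
    and "v \<in> tangent_space A m \<Longrightarrow> w \<in> tangent_space A m \<Longrightarrow>
      compat A U' U m (a *\<^sub>R v) w = a *\<^sub>R compat A U' U m v w"
proof -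
  obtain c where c: "c \<in> charts_at A m" using exists_chart .
  note cA = charts_atD[OF c]
  note lin = linear_christoffel[OF U cA(1) chart_in_crange[OF cA(2)]]
    linear_christoffel[OF U' cA(1) chart_in_crange[OF cA(2)]]
  note ts = subspace_add[OF subspace_tangent_space] subspace_scale[OF subspace_tangent_space]
  note cp = compat_in_tangent_space[OF U U'] compat_coord[OF U U' c]
  show "compat A U' U m v (w + w') = compat A U' U m v w + compat A U' U m v w'"
    if "v \<in> tangent_space A m" "w \<in> tangent_space A m" "w' \<in> tangent_space A m"
    using that by (intro tangent_eqI[OF c]) (simp_all add: ts cp linear_add[OF lin(2)] linear_add[OF lin(4)])
  show "compat A U' U m v (a *\<^sub>R w) = a *\<^sub>R compat A U' U m v w"
    if "v \<in> tangent_space A m" "w \<in> tangent_space A m"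
    using that by (intro tangent_eqI[OF c])
      (simp_all add: ts cp linear_scale[OF lin(2)] linear_scale[OF lin(4)] scaleR_diff_right)
  show "compat A U' U m (v + v') w = compat A U' U m v w + compat A U' U m v' w"
    if "v \<in> tangent_space A m" "v' \<in> tangent_space A m" "w \<in> tangent_space A m"
    using that by (intro tangent_eqI[OF c]) (simp_all add: ts cp linear_add[OF lin(1)] linear_add[OF lin(3)])
  show "compat A U' U m (a *\<^sub>R v) w = a *\<^sub>R compat A U' U m v w"
    if "v \<in> tangent_space A m" "w \<in> tangent_space A m"
    using that by (intro tangent_eqI[OF c])
      (simp_all add: ts cp linear_scale[OF lin(1)] linear_scale[OF lin(3)] scaleR_diff_right)
qed

end

context controlled_setting
begin

text \<open>By \<open>parallelism_compare\<close> the first order part of \<sigma> is the difference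
  of the Christoffel symbols at the coordinate increment; replacing the increment by
  \<open>y' s (x t - x s)\<close> costs order 2. The transport of the tensor is compared by changing
  one ingredient at a time, each by order 1.\<close>

lemma parallelism_change_expansion:
  assumes r: "r \<in> {0..T}" and c: "c \<in> charts_at A (y r)"
    and U: "parallelism A D U" "diagonal_domain D" and U': "parallelism A D' U'" "diagonal_domain D'"
  shows "\<exists>C\<ge>0. \<forall>\<^sub>F (s, t) in near_diag T r. change_expansion U U' c C s t"
proof -
  note cA = charts_atD[OF c]
  note a0 = chart_in_crange[OF cA(2)]
  obtain C2 where C2: "C2 \<ge> 0" "\<forall>\<^sub>F (a, b) in nhds (snd c (y r), snd c (y r)). compare_bounds U U' c C2 a b"
    using parallelism_compare[OF U U' cA(1) a0] by blast
  obtain L1 where L1: "L1 \<ge> 0" "\<forall>\<^sub>F (a, b) in nhds (snd c (y r), snd c (y r)). par_bounds A U c L1 a b"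
    using parallelism_local_bounds[OF U cA(1) a0] by blast
  obtain L2 where L2: "L2 \<ge> 0" "\<forall>\<^sub>F (a, b) in nhds (snd c (y r), snd c (y r)). par_bounds A U' c L2 a b"
    using parallelism_local_bounds[OF U' cA(1) a0] by blast
  obtain C3 where C3: "C3 \<ge> 0" "\<forall>\<^sub>F (s, t) in near_diag T r.
    increment_bounds c C3 s t"
    using eventually_path_increments[OF r c] by blast
  obtain M where M: "M \<ge> 0" "\<forall>\<^sub>F s in near_time T r. \<forall>w. norm (y' s w c) \<le> M * norm w"
    using eventually_path_deriv_bounded[OF r c] by blast
  define L where "L = L1 + L2"
  have L: "L \<ge> 0" "L1 \<le> L" "L2 \<le> L" using L1 L2 by (auto simp: L_def)
  \<comment> \<open>Bounds the difference of two Christoffel symbols that are each bounded by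
    \<open>L\<close>.\<close>
  define \<Lambda> where "\<Lambda> = 2 * L"
  have \<Lambda>: "\<Lambda> \<ge> 0" using L by (simp add: \<Lambda>_def)
  define N where "N = 1 + L * C3"
  have N: "N \<ge> 0" using L C3 by (simp add: N_def)
  \<comment> \<open>One summand for each of the four errors in the transport of the tensor;
    \<open>N\<close> bounds U' v relative to v.\<close>
  define P where "P = \<Lambda> * C3 * M * N + \<Lambda> * C3 * N + \<Lambda> * M * L * C3 + L * C3 * \<Lambda> * M"
  define C where "C = C2 * C3 + (C2 * C3^2 + \<Lambda> * C3) + \<Lambda> * M + P"
  have P: "P \<ge> 0" using \<Lambda> C3 M N L by (simp add: P_def)
  have C: "C2 * C3 \<le> C" "C2 * C3^2 + \<Lambda> * C3 \<le> C" "\<Lambda> * M \<le> C" "P \<le> C" "C \<ge> 0"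
    using C2 C3 \<Lambda> M P by (auto simp: C_def)
  have "\<forall>\<^sub>F (s, t) in near_diag T r. change_expansion U U' c C s t"
    using eventually_path_coords[OF r c C2(2)] eventually_path_coords[OF r c L1(2)]
      eventually_path_coords[OF r c L2(2)] C3(2) eventually_near_diag_fst_snd[OF M(2)]
      eventually_near_diag_fst_snd[OF eventually_path_chart[OF r c]] eventually_simplex2 eventually_eps_le_1[OF r]
      eventually_path_domain[OF r U(2)] eventually_path_domain[OF r U'(2)]
  proof (eventually_elim, unfold split_paired_all prod.case, intro ballI)
    fix s t v
    let ?a = "snd c (y t)" and ?b = "snd c (y s)"
    let ?S = "\<lambda>b v e. christoffel A U' c b v e - christoffel A U c b v e"
    assume "(\<forall>e. \<exists>q. par_coord A U c q (?b, ?a) = par_coord A U' c e (?b, ?a) \<and> norm (q - e) \<le> C2 * norm (?b - ?a) * norm e \<and>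
       norm (q - e - ?S ?a (?b - ?a) e) \<le> C2 * norm (?b - ?a)^2 * norm e) \<and>
      (\<forall>e. \<exists>q. par_coord A U c q (?a, ?b) = par_coord A U' c e (?a, ?b) \<and> norm (q - e) \<le> C2 * norm (?a - ?b) * norm e \<and>
       norm (q - e - ?S ?b (?a - ?b) e) \<le> C2 * norm (?a - ?b)^2 * norm e)"
    then obtain q where q: "par_coord A U c q (?a, ?b) = par_coord A U' c (v c) (?a, ?b)"
       "norm (q - v c) \<le> C2 * norm (?a - ?b) * norm (v c)"
       "norm (q - v c - ?S ?b (?a - ?b) (v c)) \<le> C2 * norm (?a - ?b)^2 * norm (v c)" by blast
    assume pb1: "par_bounds A U c L1 ?b ?a \<and> par_bounds A U c L1 ?a ?b"
      and pb2: "par_bounds A U' c L2 ?b ?a \<and> par_bounds A U' c L2 ?a ?b"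
      and inc: "norm (?a - ?b) \<le> C3 * eps s t \<and> norm (?a - ?b - y' s (x t - x s) c) \<le> C3 * eps s t ^ 2 \<and>
        (\<forall>w. norm (y' t w c - y' s w c) \<le> C3 * eps s t * norm w)"
      and m: "(\<forall>w. norm (y' s w c) \<le> M * norm w) \<and> (\<forall>w. norm (y' t w c) \<le> M * norm w)"
      and ch: "c \<in> charts_at A (y s) \<and> c \<in> charts_at A (y t)" and S: "(s, t) \<in> simplex2 T" and e1: "eps s t \<le> 1"
      and D: "(y s, y t) \<in> D \<and> (y t, y s) \<in> D" and D': "(y s, y t) \<in> D' \<and> (y t, y s) \<in> D'"
      and v: "v \<in> tangent_space A (y s)"
    have chs: "c \<in> charts_at A (y s)" and cht: "c \<in> charts_at A (y t)" using ch by auto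
    have st: "s \<in> {0..T}" "t \<in> {0..T}" using S by (auto simp: simplex2_iff)
    define e where "e = eps s t"
    have e: "0 \<le> e" "e \<le> 1" using e1 eps_nonneg by (simp_all add: e_def)
    define h where "h = ?a - ?b"
    define \<eta> where "\<eta> = y' s (x t - x s) c"
    have h: "norm h \<le> C3 * e" "norm (h - \<eta>) \<le> C3 * e^2" using inc by (auto simp: h_def \<eta>_def e_def)
    have h2: "norm h^2 \<le> (C3 * e)^2" using h(1) by (intro power_mono) auto
    have pU: "par_bounds A U c L ?a ?b" using pb1 L(2) par_bounds_mono by blast
    have pU': "par_bounds A U' c L ?a ?b" using pb2 L(3) par_bounds_mono by blast
    note ts = subspace_tangent_space
    have Sb: "norm (?S ?b p e') \<le> \<Lambda> * norm p * norm e'" for p e'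
    proof -
      have "norm (?S ?b p e') \<le> L * norm p * norm e' + L * norm p * norm e'"
        using pU pU' by (intro norm_triangle_le_diff add_mono) (auto simp: par_bounds_def)
      then show ?thesis by (simp add: \<Lambda>_def ac_simps)
    qed
    have Sd: "norm (?S ?a p e' - ?S ?b p e') \<le> \<Lambda> * (C3 * e) * norm p * norm e'" for p e'
    proof -
      have "?S ?a p e' - ?S ?b p e' = (christoffel A U' c ?a p e' - christoffel A U' c ?b p e')
          - (christoffel A U c ?a p e' - christoffel A U c ?b p e')" by simp
      also have "norm \<dots> \<le> L * norm h * norm p * norm e' + L * norm h * norm p * norm e'"
        using pU pU' unfolding h_def
        by (intro norm_triangle_le_diff[OF add_mono]) (auto simp: par_bounds_def)
      also have "\<dots> = \<Lambda> * norm h * norm p * norm e'" by (simp add: \<Lambda>_def)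
      also have "\<dots> \<le> \<Lambda> * (C3 * e) * norm p * norm e'"
        using h(1) \<Lambda> by (intro mult_right_mono mult_left_mono) auto
      finally show ?thesis .
    qed
    note linS = linear_christoffel[OF U cA(1) chart_in_crange[OF charts_atD(2)[OF chs]]]
      linear_christoffel[OF U' cA(1) chart_in_crange[OF charts_atD(2)[OF chs]]]
    have S1: "?S ?b (p - p') e' = ?S ?b p e' - ?S ?b p' e'" for p p' e'
      by (simp add: linear_diff[OF linS(1)] linear_diff[OF linS(3)])
    have S2: "?S ?b p (e' - e'') = ?S ?b p e' - ?S ?b p e''" for p e' e''
      by (simp add: linear_diff[OF linS(2)] linear_diff[OF linS(4)])
    note yt = path_deriv(1)[OF st(2)] and ys = path_deriv(1)[OF st(1)]
    have cs: "compat A U' U (y s) (y' s w) v c = ?S ?b (y' s w c) (v c)" for w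
      by (rule compat_coord[OF U U' chs ys v])
    have cst: "compat A U' U (y s) (y' s w) v \<in> tangent_space A (y s)" for w
      by (rule compat_in_tangent_space[OF U U' ys v])
    define \<sigma> where "\<sigma> = coord_vec A c (y s) (q - v c)"
    have \<sigma>: "\<sigma> \<in> tangent_space A (y s)" "\<sigma> c = q - v c"
      by (simp_all add: \<sigma>_def coord_vec_in_tangent_space[OF chs] coord_vec_self[OF chs])
    have v\<sigma>: "v + \<sigma> = coord_vec A c (y s) q"
      by (rule tangent_eqI[OF chs subspace_add[OF ts v \<sigma>(1)] coord_vec_in_tangent_space[OF chs]])
        (simp add: \<sigma>(2) coord_vec_self[OF chs])
    have "U (y t) (y s) (v + \<sigma>) = U' (y t) (y s) v"
      unfolding v\<sigma> by (rule parallelism_factor[OF U(1) U'(1) cht chs _ _ v]) (use D D' q in auto)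
    moreover have "norm (\<sigma> c) \<le> C * e * norm (v c)"
    proof -
      have "norm (\<sigma> c) \<le> C2 * norm h * norm (v c)" using q(2) by (simp add: \<sigma>(2) h_def)
      also have "\<dots> \<le> C2 * (C3 * e) * norm (v c)" using h(1) C2(1) by (intro mult_right_mono mult_left_mono) auto
      also have "\<dots> = C2 * C3 * (e * norm (v c))" by simp
      also have "\<dots> \<le> C * (e * norm (v c))" by (rule mult_right_mono[OF C(1)]) (simp add: e)
      finally show ?thesis by (simp add: mult.assoc)
    qed
    moreover have "norm ((\<sigma> - compat A U' U (y s) (y' s (x t - x s)) v) c) \<le> C * e^2 * norm (v c)"
    proof -
      have "(\<sigma> - compat A U' U (y s) (y' s (x t - x s)) v) c
          = (q - v c - ?S ?b h (v c)) + ?S ?b (h - \<eta>) (v c)"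
        by (simp add: cs \<sigma>(2) S1 \<eta>_def)
      also have "norm \<dots> \<le> C2 * norm h^2 * norm (v c) + \<Lambda> * norm (h - \<eta>) * norm (v c)"
        using q(3) by (intro norm_triangle_le add_mono Sb) (simp add: h_def)
      also have "\<dots> \<le> C2 * (C3 * e)^2 * norm (v c) + \<Lambda> * (C3 * e^2) * norm (v c)"
        using h(2) h2 C2(1) \<Lambda> by (intro add_mono mult_right_mono mult_left_mono) auto
      also have "\<dots> = (C2 * C3^2 + \<Lambda> * C3) * (e^2 * norm (v c))" by (simp add: algebra_simps power_mult_distrib)
      also have "\<dots> \<le> C * (e^2 * norm (v c))" by (rule mult_right_mono[OF C(2)]) simp
      finally show ?thesis by (simp add: mult.assoc)
    qed
    moreover have cb: "norm (compat A U' U (y s) (y' s w) v c) \<le> \<Lambda> * M * norm w * norm (v c)" for w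
    proof -
      have "norm (compat A U' U (y s) (y' s w) v c) \<le> \<Lambda> * norm (y' s w c) * norm (v c)"
        unfolding cs by (rule Sb)
      also have "\<dots> \<le> \<Lambda> * (M * norm w) * norm (v c)" using m \<Lambda> by (intro mult_right_mono mult_left_mono) auto
      finally show ?thesis by simp
    qed
    moreover have "\<Lambda> * M * norm w * norm (v c) \<le> C * norm w * norm (v c)" for w
      by (intro mult_right_mono C(3)) auto
    moreover have "norm ((compat A U' U (y t) (y' t w) (U' (y t) (y s) v)
        - U (y t) (y s) (compat A U' U (y s) (y' s w) v)) c) \<le> C * e * norm w * norm (v c)" for w
    proof -
      define u where "u = U' (y t) (y s) v c"
      define Y where "Y = compat A U' U (y s) (y' s w) v c"
      have Ut: "U' (y t) (y s) v \<in> tangent_space A (y t)"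
        by (rule parallelism_in_tangent_space[OF U'(1) _ v]) (use D' in blast)
      have u1: "norm (u - v c) \<le> L * (C3 * e) * norm (v c)"
      proof -
        have "norm (u - v c) \<le> L * norm h * norm (v c)"
          using pU' unfolding u_def parallelism_coord[OF cht chs v] par_bounds_def h_def by blast
        also have "\<dots> \<le> L * (C3 * e) * norm (v c)" using h(1) L(1) by (intro mult_right_mono mult_left_mono) auto
        finally show ?thesis .
      qed
      have "norm u \<le> norm (v c) + norm (u - v c)" by (rule norm_triangle_sub)
      also have "\<dots> \<le> norm (v c) + L * (C3 * 1) * norm (v c)"
        using u1 e L(1) C3(1) by (intro add_left_mono order_trans[OF u1] mult_right_mono mult_left_mono) auto
      finally have u2: "norm u \<le> N * norm (v c)" by (simp add: N_def algebra_simps)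
      have mt: "norm (y' t w c) \<le> M * norm w" and ms: "norm (y' s w c) \<le> M * norm w" using m by blast+
      have iw: "norm (y' t w c - y' s w c) \<le> C3 * e * norm w" using inc by (simp add: e_def)
      have hY: "norm Y \<le> \<Lambda> * M * norm w * norm (v c)" unfolding Y_def by (rule cb)
      have uY: "norm (par_coord A U c Y (?a, ?b) - Y) \<le> L * norm h * norm Y"
        using pU unfolding par_bounds_def h_def by blast
      \<comment> \<open>In this order: base point of the symbols, increment of y', distance of U' v
        from v, distance of U from the identity.\<close>
      have split: "?S ?a (y' t w c) u - par_coord A U c Y (?a, ?b)
          = (?S ?a (y' t w c) u - ?S ?b (y' t w c) u) + ?S ?b (y' t w c - y' s w c) u
          + ?S ?b (y' s w c) (u - v c) - (par_coord A U c Y (?a, ?b) - Y)"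
        by (simp add: S1 S2 Y_def cs)
      have coord: "(compat A U' U (y t) (y' t w) (U' (y t) (y s) v) - U (y t) (y s) (compat A U' U (y s) (y' s w) v)) c
          = ?S ?a (y' t w c) u - par_coord A U c Y (?a, ?b)"
        using compat_coord[OF U U' cht yt Ut] parallelism_coord[OF cht chs cst, of U]
        by (simp add: u_def Y_def)
      have "norm ((compat A U' U (y t) (y' t w) (U' (y t) (y s) v)
          - U (y t) (y s) (compat A U' U (y s) (y' s w) v)) c)
        \<le> \<Lambda> * (C3 * e) * norm (y' t w c) * norm u + \<Lambda> * norm (y' t w c - y' s w c) * norm u
          + \<Lambda> * norm (y' s w c) * norm (u - v c) + L * norm h * norm Y"
        unfolding coord split
        by (rule norm_triangle_le_diff[OF add_mono[OF norm_triangle_le[OF add_mono[OF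
          norm_triangle_le[OF add_mono[OF Sd Sb]] Sb]] uY]])
      also have "\<dots> \<le> \<Lambda> * (C3 * e) * (M * norm w) * (N * norm (v c)) + \<Lambda> * (C3 * e * norm w) * (N * norm (v c))
          + \<Lambda> * (M * norm w) * (L * (C3 * e) * norm (v c)) + L * (C3 * e) * (\<Lambda> * M * norm w * norm (v c))"
        by (intro add_mono mult_mono mult_nonneg_nonneg order_refl mt ms iw hY u1 u2 h(1)
            \<Lambda> L(1) C3(1) M(1) N e(1) norm_ge_zero)
      also have "\<dots> = P * (e * norm w * norm (v c))" by (simp add: P_def algebra_simps)
      also have "\<dots> \<le> C * (e * norm w * norm (v c))" by (rule mult_right_mono[OF C(4)]) (simp add: e)
      finally show ?thesis by (simp add: mult.assoc)
    qed
    ultimately show "(\<exists>\<sigma>\<in>tangent_space A (y s). U' (y t) (y s) v = U (y t) (y s) (v + \<sigma>) \<and>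
        norm (\<sigma> c) \<le> C * eps s t * norm (v c) \<and>
        norm ((\<sigma> - compat A U' U (y s) (y' s (x t - x s)) v) c) \<le> C * eps s t ^ 2 * norm (v c)) \<and>
      (\<forall>w. norm (compat A U' U (y s) (y' s w) v c) \<le> C * norm w * norm (v c) \<and>
        norm ((compat A U' U (y t) (y' t w) (U' (y t) (y s) v)
          - U (y t) (y s) (compat A U' U (y s) (y' s w) v)) c) \<le> C * eps s t * norm w * norm (v c))"
      unfolding e_def using \<sigma>(1) order_trans by (intro conjI allI bexI[of _ \<sigma>]) (simp_all, blast)
  qed
  then show ?thesis using C(5) by blast
qed

lemma change_parallelism_apply:
  "change_parallelism A T (y, y') U U' (\<alpha>, \<alpha>') = (\<alpha>, \<lambda>s\<in>{0..T}. \<lambda>w. \<lambda>v\<in>tangent_space A (y s).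
     \<alpha>' s w v + \<alpha> s (compat A U' U (y s) (y' s w) v))"
  by (simp add: change_parallelism_def)

text \<open>Write U' v as U (v + \<sigma>) and use the relations for U at v + \<sigma>. The first
  order part of \<sigma> is absorbed by the added tensor; the rest has the required order because
  \<alpha> and \<alpha>' are locally bounded.\<close>

lemma change_parallelism_in_crp_along:
  assumes U: "parallelism A D U" "diagonal_domain D" and U': "parallelism A D' U'" "diagonal_domain D'"
    and \<alpha>: "(\<alpha>, \<alpha>') \<in> crp_along A g T p \<omega> x y D U"
  shows "change_parallelism A T (y, y') U U' (\<alpha>, \<alpha>') \<in> crp_along A g T p \<omega> x y D' U'"
proof -
  define \<beta> where "\<beta> = (\<lambda>s\<in>{0..T}. \<lambda>w. \<lambda>v\<in>tangent_space A (y s).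
     \<alpha>' s w v + \<alpha> s (compat A U' U (y s) (y' s w) v))"
  note ts = subspace_tangent_space
  have \<beta>: "\<beta> s w v = \<alpha>' s w v + \<alpha> s (compat A U' U (y s) (y' s w) v)"
    if "s \<in> {0..T}" "v \<in> tangent_space A (y s)" for s w v using that by (simp add: \<beta>_def)
  have cst: "compat A U' U (y s) (y' s w) v \<in> tangent_space A (y s)"
    if "s \<in> {0..T}" "v \<in> tangent_space A (y s)" for s w v
    by (rule compat_in_tangent_space[OF U U' path_deriv(1)[OF that(1)] that(2)])
  have loc: "\<exists>c\<in>charts_at A (y r). \<exists>C\<ge>0. \<forall>\<^sub>F (s, t) in near_diag T r. (y t, y s) \<in> D' \<and> crp_expansion \<alpha> \<beta> U' c C s t"
    if r: "r \<in> {0..T}" for r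
  proof -
    obtain c where c: "c \<in> charts_at A (y r)" using exists_chart .
    obtain C0 where C0: "C0 \<ge> 0" "\<forall>\<^sub>F (s, t) in near_diag T r. (y t, y s) \<in> D \<and> crp_expansion \<alpha> \<alpha>' U c C0 s t"
      using crp_along_local_expansion[OF r c \<alpha>] by blast
    obtain C1 where C1: "C1 \<ge> 0" "\<forall>\<^sub>F s in near_time T r. crp_bounded \<alpha> \<alpha>' c C1 s"
      using crp_along_locally_bounded[OF r c U \<alpha>] by blast
    obtain C2 where C2: "C2 \<ge> 0" "\<forall>\<^sub>F (s, t) in near_diag T r. change_expansion U U' c C2 s t"
      using parallelism_change_expansion[OF r c U U'] by blast
    define C where "C = C0 * (1 + C2) + 2 * C1 * C2 + (C0 * C2 + 2 * C1 * C2)"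
    have "\<forall>\<^sub>F (s, t) in near_diag T r. (y t, y s) \<in> D' \<and> crp_expansion \<alpha> \<beta> U' c C s t"
      using C0(2) eventually_near_diag_fst_snd[OF C1(2)] C2(2) eventually_simplex2 eventually_eps_le_1[OF r]
        eventually_path_domain[OF r U'(2)]
    proof (eventually_elim, unfold split_paired_all prod.case, intro ballI conjI allI)
      fix s t v w
      assume A0: "(y t, y s) \<in> D \<and> crp_expansion \<alpha> \<alpha>' U c C0 s t"
       and A1: "crp_bounded \<alpha> \<alpha>' c C1 s \<and>
        crp_bounded \<alpha> \<alpha>' c C1 t"
       and A2: "change_expansion U U' c C2 s t"
       and S: "(s, t) \<in> simplex2 T" and e1: "eps s t \<le> 1" and D': "(y s, y t) \<in> D' \<and> (y t, y s) \<in> D'"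
      show "(y t, y s) \<in> D'" using D' by blast
      assume v: "v \<in> tangent_space A (y s)"
      have st: "s \<in> {0..T}" "t \<in> {0..T}" using S by (auto simp: simplex2_iff)
      define e where "e = eps s t"
      define dx where "dx = x t - x s"
      have e: "0 \<le> e" "e \<le> 1" using e1 eps_nonneg by (simp_all add: e_def)
      have ee: "e^2 \<le> e" using e by (simp add: power2_eq_square mult_left_le)
      have dx: "norm dx \<le> e" using path_bounds(1)[OF S] by (simp add: dx_def e_def)
      have U't: "U' (y t) (y s) v \<in> tangent_space A (y t)"
        by (rule parallelism_in_tangent_space[OF U'(1) _ v]) (use D' in blast)
      obtain \<sigma> where \<sigma>: "\<sigma> \<in> tangent_space A (y s)" "U' (y t) (y s) v = U (y t) (y s) (v + \<sigma>)"
        "norm (\<sigma> c) \<le> C2 * e * norm (v c)"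
        "norm ((\<sigma> - compat A U' U (y s) (y' s dx) v) c) \<le> C2 * e^2 * norm (v c)"
        using A2 v unfolding e_def dx_def by blast
      have v\<sigma>: "v + \<sigma> \<in> tangent_space A (y s)" by (rule subspace_add[OF ts v \<sigma>(1)])
      have "norm ((v + \<sigma>) c) \<le> norm (v c) + C2 * e * norm (v c)"
        using norm_triangle_ineq[of "v c" "\<sigma> c"] \<sigma>(3) by simp
      also have "\<dots> \<le> norm (v c) + C2 * 1 * norm (v c)"
        using e C2(1) by (intro add_left_mono mult_right_mono mult_left_mono) auto
      finally have nv\<sigma>: "norm ((v + \<sigma>) c) \<le> (1 + C2) * norm (v c)" by (simp add: algebra_simps)
      note \<alpha>s = crp_alongD(1)[OF \<alpha> st(1)] and \<alpha>t = crp_alongD(1)[OF \<alpha> st(2)] and \<alpha>'s = crp_alongD(2)[OF \<alpha> st(1)]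
      \<comment> \<open>Three terms of order 2: the relation for U, a product of two factors of
        order 1, and the error in the expansion of \<sigma>.\<close>
      have split1: "\<alpha> t (U' (y t) (y s) v) - \<alpha> s v - \<beta> s dx v
        = (\<alpha> t (U (y t) (y s) (v + \<sigma>)) - \<alpha> s (v + \<sigma>) - \<alpha>' s dx (v + \<sigma>)) + \<alpha>' s dx \<sigma>
          + \<alpha> s (\<sigma> - compat A U' U (y s) (y' s dx) v)"
        by (simp add: \<sigma>(2) \<beta>[OF st(1) v] tangent_linear_diff[OF \<alpha>s \<sigma>(1) cst[OF st(1) v]]
            tangent_linearD(1)[OF \<alpha>s v \<sigma>(1)] tangent_linearD(1)[OF \<alpha>'s v \<sigma>(1)])
      have "norm (\<alpha> t (U' (y t) (y s) v) - \<alpha> s v - \<beta> s dx v)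
        \<le> C0 * e^2 * norm ((v + \<sigma>) c) + C1 * norm dx * norm (\<sigma> c)
          + C1 * norm ((\<sigma> - compat A U' U (y s) (y' s dx) v) c)"
        unfolding split1
      proof (intro norm_triangle_le add_mono)
        show "norm (\<alpha> t (U (y t) (y s) (v + \<sigma>)) - \<alpha> s (v + \<sigma>) - \<alpha>' s dx (v + \<sigma>)) \<le> C0 * e^2 * norm ((v + \<sigma>) c)"
          using A0 v\<sigma> unfolding e_def dx_def by blast
        show "norm (\<alpha>' s dx \<sigma>) \<le> C1 * norm dx * norm (\<sigma> c)" using A1 \<sigma>(1) by blast
        show "norm (\<alpha> s (\<sigma> - compat A U' U (y s) (y' s dx) v)) \<le> C1 * norm ((\<sigma> - compat A U' U (y s) (y' s dx) v) c)"
          using A1 subspace_diff[OF ts \<sigma>(1) cst[OF st(1) v]] by blast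
      qed
      also have "\<dots> \<le> C0 * e^2 * ((1 + C2) * norm (v c)) + C1 * e * (C2 * e * norm (v c)) + C1 * (C2 * e^2 * norm (v c))"
        by (intro add_mono mult_mono mult_nonneg_nonneg order_refl nv\<sigma> dx \<sigma>(3,4) C0(1) C1(1) e(1)
            norm_ge_zero zero_le_power)
      also have "\<dots> = (C0 * (1 + C2) + 2 * C1 * C2) * (e^2 * norm (v c))" by (simp add: algebra_simps power2_eq_square)
      also have "\<dots> \<le> C * (e^2 * norm (v c))"
        using C0(1) C1(1) C2(1) by (intro mult_right_mono) (auto simp: C_def)
      finally show "norm (\<alpha> t (U' (y t) (y s) v) - \<alpha> s v - \<beta> s (x t - x s) v) \<le> C * eps s t ^ 2 * norm (v c)"
        by (simp add: e_def dx_def mult.assoc)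
      define Y where "Y = compat A U' U (y s) (y' s w) v"
      define X where "X = compat A U' U (y t) (y' t w) (U' (y t) (y s) v)"
      have Y: "Y \<in> tangent_space A (y s)" "norm (Y c) \<le> C2 * norm w * norm (v c)"
        using cst[OF st(1) v] A2 v unfolding Y_def by blast+
      have X: "X \<in> tangent_space A (y t)" unfolding X_def by (rule cst[OF st(2) U't])
      have UY: "U (y t) (y s) Y \<in> tangent_space A (y t)"
        by (rule parallelism_in_tangent_space[OF U(1) _ Y(1)]) (use A0 in blast)
      have XU: "norm ((X - U (y t) (y s) Y) c) \<le> C2 * e * norm w * norm (v c)"
        using A2 v unfolding X_def Y_def e_def by blast
      \<comment> \<open>All of order 1: the relation for \<alpha>', the effect of \<sigma>, the
        transport defect of the tensor, and the relation for \<alpha> at \<open>Y\<close> with the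
        term in \<alpha>' that it leaves over.\<close>
      have split2: "\<beta> t w (U' (y t) (y s) v) - \<beta> s w v
        = (\<alpha>' t w (U (y t) (y s) (v + \<sigma>)) - \<alpha>' s w (v + \<sigma>)) + \<alpha>' s w \<sigma> + \<alpha> t (X - U (y t) (y s) Y)
          + (\<alpha> t (U (y t) (y s) Y) - \<alpha> s Y - \<alpha>' s dx Y) + \<alpha>' s dx Y"
        by (simp add: \<beta>[OF st(1) v] \<beta>[OF st(2) U't] tangent_linear_diff[OF \<alpha>t X UY]
            tangent_linearD(1)[OF \<alpha>'s v \<sigma>(1)] flip: \<sigma>(2) X_def Y_def)
      have "norm (\<beta> t w (U' (y t) (y s) v) - \<beta> s w v)
        \<le> C0 * e * norm w * norm ((v + \<sigma>) c) + C1 * norm w * norm (\<sigma> c)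
          + C1 * norm ((X - U (y t) (y s) Y) c) + C0 * e^2 * norm (Y c) + C1 * norm dx * norm (Y c)"
        unfolding split2
      proof (intro norm_triangle_le add_mono)
        show "norm (\<alpha>' t w (U (y t) (y s) (v + \<sigma>)) - \<alpha>' s w (v + \<sigma>)) \<le> C0 * e * norm w * norm ((v + \<sigma>) c)"
          using A0 v\<sigma> unfolding e_def by blast
        show "norm (\<alpha>' s w \<sigma>) \<le> C1 * norm w * norm (\<sigma> c)" using A1 \<sigma>(1) by blast
        show "norm (\<alpha> t (X - U (y t) (y s) Y)) \<le> C1 * norm ((X - U (y t) (y s) Y) c)"
          using A1 subspace_diff[OF ts X UY] by blast
        show "norm (\<alpha> t (U (y t) (y s) Y) - \<alpha> s Y - \<alpha>' s dx Y) \<le> C0 * e^2 * norm (Y c)"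
          using A0 Y(1) unfolding e_def dx_def by blast
        show "norm (\<alpha>' s dx Y) \<le> C1 * norm dx * norm (Y c)" using A1 Y(1) by blast
      qed
      also have "\<dots> \<le> C0 * e * norm w * ((1 + C2) * norm (v c)) + C1 * norm w * (C2 * e * norm (v c))
          + C1 * (C2 * e * norm w * norm (v c)) + C0 * e * (C2 * norm w * norm (v c)) + C1 * e * (C2 * norm w * norm (v c))"
        by (intro add_mono mult_mono mult_nonneg_nonneg order_refl nv\<sigma> dx \<sigma>(3) XU Y(2) ee C0(1) C1(1) e(1)
            norm_ge_zero zero_le_power)
      also have "\<dots> = (C0 * (1 + C2) + C1 * C2 + C1 * C2 + (C0 * C2 + C1 * C2)) * (e * norm w * norm (v c))"
        by (simp add: algebra_simps)
      also have "\<dots> \<le> C * (e * norm w * norm (v c))"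
        using C0(1) C1(1) C2(1) e by (intro mult_right_mono) (auto simp: C_def)
      finally show "norm (\<beta> t w (U' (y t) (y s) v) - \<beta> s w v) \<le> C * eps s t * norm w * norm (v c)"
        by (simp add: e_def mult.assoc)
    qed
    moreover have "C \<ge> 0" using C0 C1 C2 by (simp add: C_def)
    ultimately show ?thesis using c by blast
  qed
  \<comment> \<open>Returns from coordinates to the metric norm at the cost of the factor
    \<open>K\<close>.\<close>
  have loc': "\<exists>C. \<forall>\<^sub>F (s, t) in near_diag T r. (y t, y s) \<in> D' \<and> (\<forall>v\<in>tangent_space A (y s).
    norm (\<alpha> t (U' (y t) (y s) v) - \<alpha> s v - \<beta> s (x t - x s) v) \<le> C * \<omega> s t powr (real 2 / p) * tnorm g (y s) v \<and>
    (\<forall>w. norm (\<beta> t w (U' (y t) (y s) v) - \<beta> s w v) \<le> C * \<omega> s t powr (real 1 / p) * norm w * tnorm g (y s) v))"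
    if r: "r \<in> {0..T}" for r
  proof -
    obtain c C where c: "c \<in> charts_at A (y r)" and C: "C \<ge> 0" "\<forall>\<^sub>F (s, t) in near_diag T r. (y t, y s) \<in> D' \<and> crp_expansion \<alpha> \<beta> U' c C s t"
      using loc[OF r] by blast
    obtain K where K: "K > 0" "\<forall>\<^sub>F s in near_time T r. tnorm_comparable c K s"
      using eventually_path_tnorm[OF r c] by blast
    have "\<forall>\<^sub>F (s, t) in near_diag T r. (y t, y s) \<in> D' \<and> (\<forall>v\<in>tangent_space A (y s).
      norm (\<alpha> t (U' (y t) (y s) v) - \<alpha> s v - \<beta> s (x t - x s) v) \<le> (C * K) * \<omega> s t powr (real 2 / p) * tnorm g (y s) v \<and>
      (\<forall>w. norm (\<beta> t w (U' (y t) (y s) v) - \<beta> s w v) \<le> (C * K) * \<omega> s t powr (real 1 / p) * norm w * tnorm g (y s) v))"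
      using C(2) eventually_near_diag_fst_snd[OF K(2)] eventually_simplex2
    proof (eventually_elim, unfold split_paired_all prod.case, intro ballI conjI allI)
      fix s t v w
      assume B: "(y t, y s) \<in> D' \<and> crp_expansion \<alpha> \<beta> U' c C s t"
       and k: "tnorm_comparable c K s \<and>
         tnorm_comparable c K t"
       and S: "(s, t) \<in> simplex2 T"
      show "(y t, y s) \<in> D'" using B by blast
      assume v: "v \<in> tangent_space A (y s)"
      have nv: "norm (v c) \<le> K * tnorm g (y s) v" using k v by blast
      have ep: "\<omega> s t powr (real 2 / p) = eps s t ^ 2" by (rule eps_power[OF S]) simp
      have "norm (\<alpha> t (U' (y t) (y s) v) - \<alpha> s v - \<beta> s (x t - x s) v) \<le> C * eps s t ^ 2 * norm (v c)" using B v by blast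
      also have "\<dots> \<le> C * eps s t ^ 2 * (K * tnorm g (y s) v)" using nv C(1) by (intro mult_left_mono) auto
      finally show "norm (\<alpha> t (U' (y t) (y s) v) - \<alpha> s v - \<beta> s (x t - x s) v) \<le> (C * K) * \<omega> s t powr (real 2 / p) * tnorm g (y s) v"
        unfolding ep by (simp add: ac_simps)
      have "norm (\<beta> t w (U' (y t) (y s) v) - \<beta> s w v) \<le> C * eps s t * norm w * norm (v c)" using B v by blast
      also have "\<dots> \<le> C * eps s t * norm w * (K * tnorm g (y s) v)"
        using nv C(1) eps_nonneg by (intro mult_left_mono) auto
      finally show "norm (\<beta> t w (U' (y t) (y s) v) - \<beta> s w v) \<le> (C * K) * \<omega> s t powr (real 1 / p) * norm w * tnorm g (y s) v"
        by (simp add: eps_def ac_simps)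
    qed
    then show ?thesis by blast
  qed
  have "approx T p \<omega> 2 (\<lambda>s t. (y t, y s) \<in> D') (\<lambda>s t K. \<forall>v\<in>tangent_space A (y s).
      norm (\<alpha> t (U' (y t) (y s) v) - \<alpha> s v - \<beta> s (x t - x s) v) \<le> K * tnorm g (y s) v)"
  proof (rule approx_localI[OF control])
    fix r assume "r \<in> {0..T}"
    from loc'[OF this] show "\<exists>C. \<forall>\<^sub>F (s, t) in near_diag T r. (y t, y s) \<in> D' \<and> (\<forall>v\<in>tangent_space A (y s).
      norm (\<alpha> t (U' (y t) (y s) v) - \<alpha> s v - \<beta> s (x t - x s) v) \<le> C * \<omega> s t powr (real 2 / p) * tnorm g (y s) v)"
      by (elim exE, intro exI) (erule eventually_mono, auto)
  qed (meson mult_right_mono tnorm_nonneg order_trans)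
  moreover have "approx T p \<omega> 1 (\<lambda>s t. (y t, y s) \<in> D') (\<lambda>s t K. \<forall>w. \<forall>v\<in>tangent_space A (y s).
      norm (\<beta> t w (U' (y t) (y s) v) - \<beta> s w v) \<le> K * norm w * tnorm g (y s) v)"
  proof (rule approx_localI[OF control])
    fix r assume "r \<in> {0..T}"
    from loc'[OF this] show "\<exists>C. \<forall>\<^sub>F (s, t) in near_diag T r. (y t, y s) \<in> D' \<and> (\<forall>w. \<forall>v\<in>tangent_space A (y s).
      norm (\<beta> t w (U' (y t) (y s) v) - \<beta> s w v) \<le> C * \<omega> s t powr (real 1 / p) * norm w * tnorm g (y s) v)"
      by (elim exE, intro exI) (erule eventually_mono, auto)
  qed (meson mult_right_mono tnorm_nonneg norm_ge_zero order_trans)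
  moreover have "\<beta> \<in> extensional {0..T}" "\<alpha> \<in> extensional {0..T}"
    using \<alpha> by (auto simp: \<beta>_def crp_along_def)
  moreover have "\<alpha> s \<in> extensional (tangent_space A (y s)) \<and> tangent_linear A (y s) (\<alpha> s) \<and>
       (\<forall>w. \<beta> s w \<in> extensional (tangent_space A (y s)) \<and> tangent_linear A (y s) (\<beta> s w)) \<and>
       (\<forall>v\<in>tangent_space A (y s). linear (\<lambda>w. \<beta> s w v))" if s: "s \<in> {0..T}" for s
  proof (intro conjI allI ballI)
    note \<alpha>s = crp_alongD(1)[OF \<alpha> s] and \<alpha>'s = crp_alongD(2)[OF \<alpha> s]
    note cl = compat_linear[OF U U']
    show "\<alpha> s \<in> extensional (tangent_space A (y s))" "tangent_linear A (y s) (\<alpha> s)"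
      using crp_alongD[OF \<alpha> s] by auto
    fix w
    show "\<beta> s w \<in> extensional (tangent_space A (y s))" using s by (simp add: \<beta>_def)
    show "tangent_linear A (y s) (\<beta> s w)"
      unfolding tangent_linear_def
      by (simp add: \<beta>[OF s] subspace_add[OF ts] subspace_scale[OF ts] cl path_deriv(1)[OF s] cst[OF s]
          tangent_linearD[OF \<alpha>s] tangent_linearD[OF \<alpha>'s] algebra_simps)
  next
    fix v assume v: "v \<in> tangent_space A (y s)"
    note \<alpha>s = crp_alongD(1)[OF \<alpha> s] and \<alpha>'v = crp_alongD(3)[OF \<alpha> s v]
    note cl = compat_linear[OF U U']
    show "linear (\<lambda>w. \<beta> s w v)"
      by (rule linearI)
        (simp_all add: \<beta>[OF s v] linear_add[OF \<alpha>'v] linear_scale[OF \<alpha>'v] linear_add[OF path_deriv(2)[OF s]]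
          linear_scale[OF path_deriv(2)[OF s]] cl path_deriv(1)[OF s] v cst[OF s v] tangent_linearD[OF \<alpha>s] algebra_simps)
  qed
  ultimately show ?thesis
    unfolding change_parallelism_apply \<beta>_def[symmetric] crp_along_def by blast
qed

text \<open>On tangent vectors the two added tensors cancel by \<open>compat_swap\<close>. Equality
  of the pairs as functions also needs agreement off [0, T] and off the tangent spaces, which
  extensionality provides.\<close>

lemma change_parallelism_inverse:
  assumes U: "parallelism A D U" "diagonal_domain D" and U': "parallelism A D' U'" "diagonal_domain D'"
    and \<alpha>: "(\<alpha>, \<alpha>') \<in> crp_along A g T p \<omega> x y D U"
  shows "change_parallelism A T (y, y') U' U (change_parallelism A T (y, y') U U' (\<alpha>, \<alpha>')) = (\<alpha>, \<alpha>')"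
proof -
  have "(\<lambda>s\<in>{0..T}. \<lambda>w. \<lambda>v\<in>tangent_space A (y s).
     (\<lambda>s\<in>{0..T}. \<lambda>w. \<lambda>v\<in>tangent_space A (y s). \<alpha>' s w v + \<alpha> s (compat A U' U (y s) (y' s w) v)) s w v
       + \<alpha> s (compat A U U' (y s) (y' s w) v)) = \<alpha>'" (is "?l = _")
  proof (rule extensionalityI[of _ "{0..T}"])
    fix s assume s: "s \<in> {0..T}"
    show "?l s = \<alpha>' s"
    proof
      fix w
      show "?l s w = \<alpha>' s w"
      proof (rule extensionalityI[of _ "tangent_space A (y s)"])
        fix v assume v: "v \<in> tangent_space A (y s)"
        note ys = path_deriv(1)[OF s]
        note \<alpha>s = crp_alongD(1)[OF \<alpha> s]
        have "\<alpha> s (compat A U' U (y s) (y' s w) v) + \<alpha> s (compat A U U' (y s) (y' s w) v)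
          = \<alpha> s (compat A U U' (y s) (y' s w) v + compat A U' U (y s) (y' s w) v)"
          using tangent_linearD(1)[OF \<alpha>s compat_in_tangent_space[OF U' U ys v] compat_in_tangent_space[OF U U' ys v]]
          by (simp add: add.commute)
        also have "\<dots> = 0" by (simp only: compat_swap[OF U U' ys v] tangent_linear_zero[OF \<alpha>s])
        finally show "?l s w v = \<alpha>' s w v" using s v by (simp add: add.assoc)
      qed (use s crp_alongD(4)[OF \<alpha> s] in auto)
    qed
  qed (use \<alpha> in \<open>auto simp: crp_along_def\<close>)
  then show ?thesis by (simp add: change_parallelism_apply)
qed

end

section \<open>The rough integral\<close>

context controlled_setting
begin

text \<open>The terms linear in the coordinate increment h cancel between the logarithms and leave
  -1/2 B h h, with B the difference of their Christoffel symbols. Contraction with XX gives 1/2 B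
  \<eta> \<eta>, where \<eta> is the controlled increment. Since h and \<eta> have order 1 and
  differ by order 2, the sum has order 3.\<close>

lemma log_difference_expansion:
  assumes r: "r \<in> {0..T}" and c: "c \<in> charts_at A (y r)"
    and \<psi>: "logarithm A D \<psi>" "diagonal_domain D" and \<psi>': "logarithm A D' \<psi>'" "diagonal_domain D'"
  shows "\<exists>C\<ge>0. \<forall>\<^sub>F (s, t) in near_diag T r.
    norm (log_difference \<psi> \<psi>' c s t)
    \<le> C * eps s t ^ 3"
proof -
  note cA = charts_atD[OF c]
  note a0 = chart_in_crange[OF cA(2)]
  note P = parallelism_log_parallelism[OF \<psi>] and P' = parallelism_log_parallelism[OF \<psi>']
  obtain C1 where C1: "C1 \<ge> 0" "\<forall>\<^sub>F (a, b) in nhds (snd c (y r), snd c (y r)). log_expansion \<psi> c C1 a b"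
    using log_coord_taylor[OF \<psi> cA(1) a0] by blast
  obtain C2 where C2: "C2 \<ge> 0" "\<forall>\<^sub>F (a, b) in nhds (snd c (y r), snd c (y r)). log_expansion \<psi>' c C2 a b"
    using log_coord_taylor[OF \<psi>' cA(1) a0] by blast
  obtain L1 where L1: "L1 \<ge> 0" "\<forall>\<^sub>F (a, b) in nhds (snd c (y r), snd c (y r)). par_bounds A (log_parallelism A \<psi>) c L1 a b"
    using parallelism_local_bounds[OF P \<psi>(2) cA(1) a0] by blast
  obtain L2 where L2: "L2 \<ge> 0" "\<forall>\<^sub>F (a, b) in nhds (snd c (y r), snd c (y r)). par_bounds A (log_parallelism A \<psi>') c L2 a b"
    using parallelism_local_bounds[OF P' \<psi>'(2) cA(1) a0] by blast
  obtain C3 where C3: "C3 \<ge> 0" "\<forall>\<^sub>F (s, t) in near_diag T r.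
    increment_bounds c C3 s t"
    using eventually_path_increments[OF r c] by blast
  obtain M where M: "M \<ge> 0" "\<forall>\<^sub>F s in near_time T r. \<forall>w. norm (y' s w c) \<le> M * norm w"
    using eventually_path_deriv_bounded[OF r c] by blast
  define \<Lambda> where "\<Lambda> = L1 + L2"
  have \<Lambda>: "\<Lambda> \<ge> 0" using L1 L2 by (simp add: \<Lambda>_def)
  define C where "C = (C1 + C2) * C3^3 + (\<Lambda> * C3 * C3 + \<Lambda> * M * C3)"
  have "\<forall>\<^sub>F (s, t) in near_diag T r.
    norm (log_difference \<psi> \<psi>' c s t)
    \<le> C * eps s t ^ 3"
    using eventually_path_coords[OF r c C1(2)] eventually_path_coords[OF r c C2(2)]
      eventually_path_coords[OF r c L1(2)] eventually_path_coords[OF r c L2(2)]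
      C3(2) eventually_near_diag_fst_snd[OF M(2)]
      eventually_near_diag_fst_snd[OF eventually_path_chart[OF r c]] eventually_simplex2
  proof (eventually_elim, unfold split_paired_all prod.case)
    fix s t
    let ?\<Gamma> = "christoffel A (log_parallelism A \<psi>) c (snd c (y s))"
    let ?\<Gamma>' = "christoffel A (log_parallelism A \<psi>') c (snd c (y s))"
    let ?h = "snd c (y t) - snd c (y s)"
    let ?k = "snd c (y s) - snd c (y t)"
    assume t1: "norm (log_coord \<psi> c c (snd c (y s), snd c (y t)) - ?h + (1/2) *\<^sub>R ?\<Gamma> ?h ?h) \<le> C1 * norm ?h^3 \<and>
        norm (log_coord \<psi> c c (snd c (y t), snd c (y s)) - ?k
          + (1/2) *\<^sub>R christoffel A (log_parallelism A \<psi>) c (snd c (y t)) ?k ?k) \<le> C1 * norm ?k^3"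
      and t2: "norm (log_coord \<psi>' c c (snd c (y s), snd c (y t)) - ?h + (1/2) *\<^sub>R ?\<Gamma>' ?h ?h) \<le> C2 * norm ?h^3 \<and>
        norm (log_coord \<psi>' c c (snd c (y t), snd c (y s)) - ?k
          + (1/2) *\<^sub>R christoffel A (log_parallelism A \<psi>') c (snd c (y t)) ?k ?k) \<le> C2 * norm ?k^3"
      and p1: "par_bounds A (log_parallelism A \<psi>) c L1 (snd c (y s)) (snd c (y t)) \<and>
        par_bounds A (log_parallelism A \<psi>) c L1 (snd c (y t)) (snd c (y s))"
      and p2: "par_bounds A (log_parallelism A \<psi>') c L2 (snd c (y s)) (snd c (y t)) \<and>
        par_bounds A (log_parallelism A \<psi>') c L2 (snd c (y t)) (snd c (y s))"
      and inc: "norm ?h \<le> C3 * eps s t \<and> norm (?h - y' s (x t - x s) c) \<le> C3 * eps s t ^ 2 \<and>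
        (\<forall>w. norm (y' t w c - y' s w c) \<le> C3 * eps s t * norm w)"
      and m: "(\<forall>w. norm (y' s w c) \<le> M * norm w) \<and> (\<forall>w. norm (y' t w c) \<le> M * norm w)"
      and ch: "c \<in> charts_at A (y s) \<and> c \<in> charts_at A (y t)" and S: "(s, t) \<in> simplex2 T"
    define e where "e = eps s t"
    define h where "h = ?h"
    define \<eta> where "\<eta> = y' s (x t - x s) c"
    define B where "B v w = ?\<Gamma> v w - ?\<Gamma>' v w" for v w
    have e: "0 \<le> e" using eps_nonneg by (simp add: e_def)
    have st: "s \<in> {0..T}" "t \<in> {0..T}" using S by (auto simp: simplex2_iff)
    have chs: "c \<in> charts_at A (y s)" using ch by blast
    note aS = chart_in_crange[OF charts_atD(2)[OF chs]]
    note lin = linear_christoffel[OF P \<psi>(2) cA(1) aS] linear_christoffel[OF P' \<psi>'(2) cA(1) aS]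
    have linB: "linear (\<lambda>v. B v w)" "linear (B v)" for v w
      unfolding B_def[abs_def] by (intro linear_compose_sub lin)+
    have symB: "B v w = B w v" for v w
      unfolding B_def
      using christoffel_log_symmetric[OF \<psi> cA(1) aS, of v w] christoffel_log_symmetric[OF \<psi>' cA(1) aS, of v w] by simp
    have bB: "norm (B v w) \<le> \<Lambda> * norm v * norm w" for v w
    proof -
      have "norm (B v w) \<le> L1 * norm v * norm w + L2 * norm v * norm w"
        unfolding B_def by (rule norm_triangle_le_diff[OF add_mono]) (use p1 p2 in \<open>auto simp: par_bounds_def\<close>)
      then show ?thesis by (simp add: \<Lambda>_def algebra_simps)
    qed
    have ylin: "linear (\<lambda>w. y' s w c)" by (rule path_deriv(3)[OF st(1)])
    have "tensor_lift (\<lambda>a b. B (y' s a c) (y' s b c)) (XX s t) = (1/2) *\<^sub>R B \<eta> \<eta>"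
      unfolding \<eta>_def
    proof (rule tensor_lift_symmetric[where B = "\<lambda>a b. B (y' s a c) (y' s b c)"])
      show "linear (\<lambda>v. B (y' s v c) (y' s w c))" for w
        using linear_compose[OF ylin linB(1)] by (simp add: o_def)
      show "linear (\<lambda>w. B (y' s v c) (y' s w c))" for v
        using linear_compose[OF ylin linB(2)] by (simp add: o_def)
      show "B (y' s v c) (y' s w c) = B (y' s w c) (y' s v c)" for v w by (rule symB)
      show "XX s t + transpose (XX s t) = tensor (x t - x s) (x t - x s)" by (rule path_bounds(3)[OF S])
    qed
    then have tl: "tensor_lift (\<lambda>a b. ?\<Gamma> (y' s a c) (y' s b c) - ?\<Gamma>' (y' s a c) (y' s b c)) (XX s t) = (1/2) *\<^sub>R B \<eta> \<eta>"
      by (simp only: B_def)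
    define F where "F = \<psi> (y s) (y t) c - h + (1/2) *\<^sub>R ?\<Gamma> h h"
    define F' where "F' = \<psi>' (y s) (y t) c - h + (1/2) *\<^sub>R ?\<Gamma>' h h"
    have lc: "log_coord \<psi> c c (snd c (y s), snd c (y t)) = \<psi> (y s) (y t) c"
      "log_coord \<psi>' c c (snd c (y s), snd c (y t)) = \<psi>' (y s) (y t) c"
      using ch by (simp_all add: log_coord_def cinv_chart charts_at_def)
    have h3: "norm h^3 \<le> (C3 * e)^3" using inc by (intro power_mono) (auto simp: h_def e_def)
    have "norm F \<le> C1 * norm h^3" using t1 unfolding F_def h_def lc by blast
    also have "\<dots> \<le> C1 * (C3 * e)^3" by (rule mult_left_mono[OF h3 C1(1)])
    finally have F: "norm F \<le> C1 * (C3 * e)^3" .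
    have "norm F' \<le> C2 * norm h^3" using t2 unfolding F'_def h_def lc by blast
    also have "\<dots> \<le> C2 * (C3 * e)^3" by (rule mult_left_mono[OF h3 C2(1)])
    finally have F': "norm F' \<le> C2 * (C3 * e)^3" .
    have hn: "norm h \<le> C3 * e" "norm (h - \<eta>) \<le> C3 * e^2" using inc by (auto simp: h_def \<eta>_def e_def)
    have "norm \<eta> \<le> M * norm (x t - x s)" using m by (simp add: \<eta>_def)
    also have "\<dots> \<le> M * e" using path_bounds(1)[OF S] M(1) by (intro mult_left_mono) (auto simp: e_def)
    finally have \<eta>n: "norm \<eta> \<le> M * e" .
    \<comment> \<open>Each term has one factor \<open>h - \<eta>\<close> of order 2 and one factor
      of order 1.\<close>
    have "B h h - B \<eta> \<eta> = B (h - \<eta>) h + B \<eta> (h - \<eta>)"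
      by (simp add: linear_diff[OF linB(1)] linear_diff[OF linB(2)])
    then have "norm (B h h - B \<eta> \<eta>) \<le> \<Lambda> * norm (h - \<eta>) * norm h + \<Lambda> * norm \<eta> * norm (h - \<eta>)"
      by (simp only:) (rule norm_triangle_le[OF add_mono[OF bB bB]])
    also have "\<dots> \<le> \<Lambda> * (C3 * e^2) * (C3 * e) + \<Lambda> * (M * e) * (C3 * e^2)"
      by (intro add_mono mult_mono mult_nonneg_nonneg order_refl hn \<eta>n \<Lambda> C3(1) M(1) e norm_ge_zero zero_le_power)
    finally have Bn: "norm (B h h - B \<eta> \<eta>) \<le> \<Lambda> * (C3 * e^2) * (C3 * e) + \<Lambda> * (M * e) * (C3 * e^2)" .
    have "norm ((1/2) *\<^sub>R (B h h - B \<eta> \<eta>)) \<le> norm (B h h - B \<eta> \<eta>)" by simp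
    note Bn' = order_trans[OF this Bn]
    have split: "\<psi> (y s) (y t) c - \<psi>' (y s) (y t) c + (1/2) *\<^sub>R B \<eta> \<eta> = F - F' - (1/2) *\<^sub>R (B h h - B \<eta> \<eta>)"
      by (simp add: F_def F'_def B_def algebra_simps)
    have "norm (\<psi> (y s) (y t) c - \<psi>' (y s) (y t) c + (1/2) *\<^sub>R B \<eta> \<eta>)
        \<le> C1 * (C3 * e)^3 + C2 * (C3 * e)^3 + (\<Lambda> * (C3 * e^2) * (C3 * e) + \<Lambda> * (M * e) * (C3 * e^2))"
      unfolding split
      by (rule norm_triangle_le_diff[OF add_mono[OF norm_triangle_le_diff[OF add_mono[OF F F']] Bn']])
    also have "\<dots> = C * e^3"
      by (simp add: C_def algebra_simps power_mult_distrib power2_eq_square power3_eq_cube)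
    finally show "norm (\<psi> (y s) (y t) c - \<psi>' (y s) (y t) c
      + tensor_lift (\<lambda>a b. ?\<Gamma> (y' s a c) (y' s b c) - ?\<Gamma>' (y' s a c) (y' s b c)) (XX s t)) \<le> C * eps s t ^ 3"
      unfolding tl e_def .
  qed
  moreover have "C \<ge> 0" using C1 C2 C3 \<Lambda> M by (simp add: C_def)
  ultimately show ?thesis by blast
qed

text \<open>By linearity the integrands differ by \<open>\<alpha> s\<close> applied to one tangent
  vector \<open>W\<close> whose coordinate is \<open>log_difference\<close>; local boundedness of
  \<alpha> carries its order 3 over.\<close>

lemma integrand_difference:
  fixes \<alpha> :: "real \<Rightarrow> ('m, 'e) tvec \<Rightarrow> 'v::banach"
  assumes \<psi>: "logarithm A D \<psi>" "diagonal_domain D" and U: "parallelism A D U"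
    and \<psi>': "logarithm A D' \<psi>'" "diagonal_domain D'" and U': "parallelism A D' U'"
    and \<alpha>: "(\<alpha>, \<alpha>') \<in> crp_along A g T p \<omega> x y D U"
    and \<beta>: "change_parallelism A T (y, y') U U' (\<alpha>, \<alpha>') = (\<alpha>, \<beta>)"
  shows "approx T p \<omega> 3 (\<lambda>s t. (y s, y t) \<in> D \<and> (y s, y t) \<in> D') (\<lambda>s t K. norm (
     (integrand \<psi> U \<alpha> \<alpha>' s t)
     - (integrand \<psi>' U' \<alpha> \<beta> s t)) \<le> K)"
proof (rule approx_localI[OF control])
  fix r assume r: "r \<in> {0..T}"
  obtain c where c: "c \<in> charts_at A (y r)" using exists_chart .
  note P = parallelism_log_parallelism[OF \<psi>] and P' = parallelism_log_parallelism[OF \<psi>']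
  obtain C where C: "C \<ge> 0" "\<forall>\<^sub>F (s, t) in near_diag T r.
    norm (log_difference \<psi> \<psi>' c s t)
    \<le> C * eps s t ^ 3"
    using log_difference_expansion[OF r c \<psi> \<psi>'] by blast
  obtain K where K: "K \<ge> 0" "\<forall>\<^sub>F s in near_time T r. crp_bounded \<alpha> \<alpha>' c K s"
    using crp_along_locally_bounded[OF r c U \<psi>(2) \<alpha>] by blast
  have "\<forall>\<^sub>F (s, t) in near_diag T r. ((y s, y t) \<in> D \<and> (y s, y t) \<in> D') \<and> norm (
     (integrand \<psi> U \<alpha> \<alpha>' s t)
     - (integrand \<psi>' U' \<alpha> \<beta> s t)) \<le> K * C * \<omega> s t powr (real 3 / p)"
    using C(2) eventually_near_diag_fst_snd[OF K(2)] eventually_path_domain[OF r \<psi>(2)]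
      eventually_path_domain[OF r \<psi>'(2)]
      eventually_near_diag_fst_snd[OF eventually_path_chart[OF r c]] eventually_simplex2
  proof (eventually_elim, unfold split_paired_all prod.case, intro conjI)
    fix s t
    assume est: "norm (log_difference \<psi> \<psi>' c s t)
      \<le> C * eps s t ^ 3"
      and k: "crp_bounded \<alpha> \<alpha>' c K s \<and>
        crp_bounded \<alpha> \<alpha>' c K t"
      and D: "(y s, y t) \<in> D \<and> (y t, y s) \<in> D" and D': "(y s, y t) \<in> D' \<and> (y t, y s) \<in> D'"
      and ch: "c \<in> charts_at A (y s) \<and> c \<in> charts_at A (y t)" and S: "(s, t) \<in> simplex2 T"
    show "(y s, y t) \<in> D" "(y s, y t) \<in> D'" using D D' by blast+
    have st: "s \<in> {0..T}" using S by (auto simp: simplex2_iff)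
    have chs: "c \<in> charts_at A (y s)" using ch by blast
    note ys = path_deriv(1)[OF st] and \<alpha>s = crp_alongD(1)[OF \<alpha> st]
    note ts = subspace_tangent_space
    define G where "G a b = gauge_compat A \<psi> U (y s) (y' s a) (y' s b)" for a b
    define G' where "G' a b = gauge_compat A \<psi>' U' (y s) (y' s a) (y' s b)" for a b
    define H where "H a b = compat A U' U (y s) (y' s a) (y' s b)" for a b
    define Q where "Q = \<psi> (y s) (y t)"
    define Q' where "Q' = \<psi>' (y s) (y t)"
    have tan: "G a b \<in> tangent_space A (y s)" "G' a b \<in> tangent_space A (y s)" "H a b \<in> tangent_space A (y s)" for a b
      unfolding G_def G'_def H_def gauge_compat_def
      by (rule compat_in_tangent_space[OF U \<psi>(2) P \<psi>(2) ys ys]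
          compat_in_tangent_space[OF U' \<psi>'(2) P' \<psi>'(2) ys ys]
          compat_in_tangent_space[OF U \<psi>(2) U' \<psi>'(2) ys ys])+
    have Q: "Q \<in> tangent_space A (y s)" "Q' \<in> tangent_space A (y s)"
      unfolding Q_def Q'_def using D D' logarithm_in_tangent_space \<psi>(1) \<psi>'(1) by blast+
    note tl = tangent_linear_tensor_lift[OF \<alpha>s]
    have QG: "Q + tensor_lift G (XX s t) \<in> tangent_space A (y s)" "Q' + tensor_lift G' (XX s t) \<in> tangent_space A (y s)"
      by (intro subspace_add[OF ts] Q tl(2) tan)+
    define W where "W = Q + tensor_lift G (XX s t) - (Q' + tensor_lift G' (XX s t)) - tensor_lift H (XX s t)"
    have W: "W \<in> tangent_space A (y s)"
      unfolding W_def by (intro subspace_diff[OF ts] QG tl(2) tan)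
    have \<beta>s: "\<beta> s a (y' s b) = \<alpha>' s a (y' s b) + \<alpha> s (H a b)" for a b
      using \<beta> st ys[of b] by (auto simp: change_parallelism_apply H_def)
    have "(\<alpha> s (Q + tensor_lift G (XX s t)) + tensor_lift (\<lambda>a b. \<alpha>' s a (y' s b)) (XX s t))
       - (\<alpha> s (Q' + tensor_lift G' (XX s t)) + tensor_lift (\<lambda>a b. \<beta> s a (y' s b)) (XX s t))
      = \<alpha> s (Q + tensor_lift G (XX s t)) - \<alpha> s (Q' + tensor_lift G' (XX s t)) - \<alpha> s (tensor_lift H (XX s t))"
      by (simp add: \<beta>s tensor_lift_add tl(1)[OF tan(3)])
    also have "\<dots> = \<alpha> s W"
      unfolding W_def
      by (simp only: tangent_linear_diff[OF \<alpha>s QG] tl(2)[OF tan(3)]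
          tangent_linear_diff[OF \<alpha>s subspace_diff[OF ts QG] tl(2)[OF tan(3)]])
    finally have E: "(\<alpha> s (Q + tensor_lift G (XX s t)) + tensor_lift (\<lambda>a b. \<alpha>' s a (y' s b)) (XX s t))
       - (\<alpha> s (Q' + tensor_lift G' (XX s t)) + tensor_lift (\<lambda>a b. \<beta> s a (y' s b)) (XX s t)) = \<alpha> s W" .
    \<comment> \<open>With \<Gamma> for Christoffel symbols, G is \<Gamma>(\<psi>) - \<Gamma>(U), G'
      is \<Gamma>(\<psi>') - \<Gamma>(U') and H is \<Gamma>(U') - \<Gamma>(U), so the parallelisms
      cancel.\<close>
    have Gc: "G a b c - G' a b c - H a b c
        = christoffel A (log_parallelism A \<psi>) c (snd c (y s)) (y' s a c) (y' s b c)
          - christoffel A (log_parallelism A \<psi>') c (snd c (y s)) (y' s a c) (y' s b c)" for a b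
      unfolding G_def G'_def H_def gauge_compat_def
        compat_coord[OF U \<psi>(2) P \<psi>(2) chs ys ys] compat_coord[OF U' \<psi>'(2) P' \<psi>'(2) chs ys ys]
        compat_coord[OF U \<psi>(2) U' \<psi>'(2) chs ys ys] by simp
    have "W c = Q c - Q' c + (tensor_lift G (XX s t) c - tensor_lift G' (XX s t) c - tensor_lift H (XX s t) c)"
      by (simp add: W_def)
    also have "tensor_lift G (XX s t) c - tensor_lift G' (XX s t) c - tensor_lift H (XX s t) c
        = tensor_lift (\<lambda>a b. G a b c - G' a b c - H a b c) (XX s t)"
      by (simp only: tensor_lift_apply tensor_lift_diff)
    finally have "norm (W c) \<le> C * eps s t ^ 3" using est by (simp only: Gc Q_def Q'_def)
    moreover have "norm (\<alpha> s W) \<le> K * norm (W c)" using k W by blast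
    ultimately have "norm (\<alpha> s W) \<le> K * (C * eps s t ^ 3)" using K(1) mult_left_mono order_trans by blast
    also have "\<dots> = K * C * \<omega> s t powr (real 3 / p)" using eps_power[OF S, of 3] by simp
    finally show "norm (
     (integrand \<psi> U \<alpha> \<alpha>' s t)
     - (integrand \<psi>' U' \<alpha> \<beta> s t)) \<le> K * C * \<omega> s t powr (real 3 / p)"
      unfolding E[unfolded Q_def Q'_def G_def[abs_def] G'_def[abs_def]] .
  qed
  then show "\<exists>C. \<forall>\<^sub>F (s, t) in near_diag T r. ((y s, y t) \<in> D \<and> (y s, y t) \<in> D') \<and> norm (
     (integrand \<psi> U \<alpha> \<alpha>' s t)
     - (integrand \<psi>' U' \<alpha> \<beta> s t)) \<le> C * \<omega> s t powr (real 3 / p)" by blast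
qed simp

end

text \<open>The condition \<open>d'\<close> of the comparison implies the target condition
  \<open>d''\<close>, so replacing \<open>E\<close> by \<open>E'\<close> also moves the definedness
  requirement from one gauge to the other.\<close>

lemma approx_norm_transfer:
  fixes f E E' :: "real \<Rightarrow> real \<Rightarrow> 'v::real_normed_vector"
  assumes "approx T p \<omega> i d (\<lambda>s t K. norm (f s t - E s t) \<le> K)"
    and "approx T p \<omega> i d' (\<lambda>s t K. norm (E s t - E' s t) \<le> K)"
    and "\<And>s t. d' s t \<Longrightarrow> d'' s t"
  shows "approx T p \<omega> i d'' (\<lambda>s t K. norm (f s t - E' s t) \<le> K)"
proof -
  obtain C1 \<delta>1 where 1: "\<delta>1 > 0" "\<forall>s t. 0 \<le> s \<and> s \<le> t \<and> t \<le> T \<and> t - s \<le> \<delta>1 \<longrightarrow>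
      d s t \<and> norm (f s t - E s t) \<le> C1 * \<omega> s t powr (real i / p)"
    using assms(1) unfolding approx_def by blast
  obtain C2 \<delta>2 where 2: "\<delta>2 > 0" "\<forall>s t. 0 \<le> s \<and> s \<le> t \<and> t \<le> T \<and> t - s \<le> \<delta>2 \<longrightarrow>
      d' s t \<and> norm (E s t - E' s t) \<le> C2 * \<omega> s t powr (real i / p)"
    using assms(2) unfolding approx_def by blast
  show ?thesis unfolding approx_def
  proof (rule exI[of _ "C1 + C2"], rule exI[of _ "min \<delta>1 \<delta>2"], intro conjI allI impI)
    fix s t assume st: "0 \<le> s \<and> s \<le> t \<and> t \<le> T \<and> t - s \<le> min \<delta>1 \<delta>2"
    then have a: "norm (f s t - E s t) \<le> C1 * \<omega> s t powr (real i / p)"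
      and b: "d' s t" "norm (E s t - E' s t) \<le> C2 * \<omega> s t powr (real i / p)" using 1(2) 2(2) by auto
    show "d'' s t" using assms(3) b(1) .
    show "norm (f s t - E' s t) \<le> (C1 + C2) * \<omega> s t powr (real i / p)"
      using norm_triangle_ineq[of "f s t - E s t" "E s t - E' s t"] a b(2) by (simp add: distrib_right)
  qed (use 1 2 in simp)
qed

text \<open>The component \<alpha> is unchanged, so apart from the relation of order 3 the
  conditions on \<open>zz\<close> are literally the same for both gauges.\<close>

lemma (in controlled_setting) is_rough_integral_change_parallelism:
  fixes \<alpha> :: "real \<Rightarrow> ('m, 'e) tvec \<Rightarrow> 'v::banach"
  assumes \<psi>: "logarithm A D \<psi>" "diagonal_domain D" and U: "parallelism A D U"
    and \<psi>': "logarithm A D' \<psi>'" "diagonal_domain D'" and U': "parallelism A D' U'"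
    and \<alpha>: "(\<alpha>, \<alpha>') \<in> crp_along A g T p \<omega> x y D U"
  shows "is_rough_integral A T p \<omega> x XX (y, y') D \<psi> U (\<alpha>, \<alpha>') zz \<longleftrightarrow>
    is_rough_integral A T p \<omega> x XX (y, y') D' \<psi>' U' (change_parallelism A T (y, y') U U' (\<alpha>, \<alpha>')) zz"
proof -
  obtain z z' where zz: "zz = (z, z')" by (cases zz)
  define \<beta> where "\<beta> = snd (change_parallelism A T (y, y') U U' (\<alpha>, \<alpha>'))"
  have \<beta>: "change_parallelism A T (y, y') U U' (\<alpha>, \<alpha>') = (\<alpha>, \<beta>)"
    by (simp add: \<beta>_def change_parallelism_apply)
  define E where "E s t = integrand \<psi> U \<alpha> \<alpha>' s t" for s t
  define E' where "E' s t = integrand \<psi>' U' \<alpha> \<beta> s t" for s t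
  have d: "approx T p \<omega> 3 (\<lambda>s t. (y s, y t) \<in> D \<and> (y s, y t) \<in> D') (\<lambda>s t K. norm (E s t - E' s t) \<le> K)"
    unfolding E_def E'_def by (rule integrand_difference[OF \<psi> U \<psi>' U' \<alpha> \<beta>])
  then have d': "approx T p \<omega> 3 (\<lambda>s t. (y s, y t) \<in> D \<and> (y s, y t) \<in> D') (\<lambda>s t K. norm (E' s t - E s t) \<le> K)"
    by (simp only: norm_minus_commute)
  have "approx T p \<omega> 3 (\<lambda>s t. (y s, y t) \<in> D) (\<lambda>s t K. norm (z t - z s - E s t) \<le> K)
    \<longleftrightarrow> approx T p \<omega> 3 (\<lambda>s t. (y s, y t) \<in> D') (\<lambda>s t K. norm (z t - z s - E' s t) \<le> K)"
  proof
    assume "approx T p \<omega> 3 (\<lambda>s t. (y s, y t) \<in> D) (\<lambda>s t K. norm (z t - z s - E s t) \<le> K)"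
    then show "approx T p \<omega> 3 (\<lambda>s t. (y s, y t) \<in> D') (\<lambda>s t K. norm (z t - z s - E' s t) \<le> K)"
      by (rule approx_norm_transfer[where f = "\<lambda>s t. z t - z s", OF _ d]) blast
  next
    assume "approx T p \<omega> 3 (\<lambda>s t. (y s, y t) \<in> D') (\<lambda>s t K. norm (z t - z s - E' s t) \<le> K)"
    then show "approx T p \<omega> 3 (\<lambda>s t. (y s, y t) \<in> D) (\<lambda>s t K. norm (z t - z s - E s t) \<le> K)"
      by (rule approx_norm_transfer[where f = "\<lambda>s t. z t - z s", OF _ d']) blast
  qed
  then show ?thesis
    by (simp only: zz \<beta> is_rough_integral_def prod.case E_def E'_def)
qed

theorem theorem3p32:
  fixes A :: "('m::{t2_space,second_countable_topology}, 'e::euclidean_space) chart set"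
    and g :: "'m \<Rightarrow> ('m, 'e) tvec \<Rightarrow> ('m, 'e) tvec \<Rightarrow> real"
    and T p :: real
    and \<omega> :: "real \<Rightarrow> real \<Rightarrow> real"
    and x :: "real \<Rightarrow> real^'k"
    and XX :: "real \<Rightarrow> real \<Rightarrow> real^'k^'k"
    and D D' :: "('m \<times> 'm) set"
    and \<psi> \<psi>' :: "'m \<Rightarrow> 'm \<Rightarrow> ('m, 'e) tvec"
    and U U' :: "'m \<Rightarrow> 'm \<Rightarrow> ('m, 'e) tvec \<Rightarrow> ('m, 'e) tvec"
    and y :: "real \<Rightarrow> 'm"
    and y' :: "real \<Rightarrow> real^'k \<Rightarrow> ('m, 'e) tvec"
  assumes "smooth_atlas A"
    and "riemannian_metric A g"
    and "0 < T" and "1 \<le> p" and "p < 3"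
    and "weak_geometric_rough_path T p \<omega> x XX"
    and "manifold_gauge A D \<psi> U"
    and "manifold_gauge A D' \<psi>' U'"
    and "(y, y') \<in> crp_manifold A g T p \<omega> x"
  shows
    "bij_betw (change_parallelism A T (y, y') U U')
       (crp_along A g T p \<omega> x y D U ::
          ((real \<Rightarrow> ('m, 'e) tvec \<Rightarrow> 'v::banach) \<times> (real \<Rightarrow> real^'k \<Rightarrow> ('m, 'e) tvec \<Rightarrow> 'v)) set)
       (crp_along A g T p \<omega> x y D' U') \<and>
     (\<forall>\<alpha> \<in> (crp_along A g T p \<omega> x y D U ::
          ((real \<Rightarrow> ('m, 'e) tvec \<Rightarrow> 'v) \<times> (real \<Rightarrow> real^'k \<Rightarrow> ('m, 'e) tvec \<Rightarrow> 'v)) set).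
        rough_integral A T p \<omega> x XX (y, y') D \<psi> U \<alpha> =
        rough_integral A T p \<omega> x XX (y, y') D' \<psi>' U' (change_parallelism A T (y, y') U U' \<alpha>))"
proof -
  interpret controlled_setting A g T p \<omega> x XX y y'
    using assms(1,2,4,6,9) by unfold_locales
  have G: "logarithm A D \<psi>" "diagonal_domain D" "parallelism A D U"
    and G': "logarithm A D' \<psi>'" "diagonal_domain D'" "parallelism A D' U'"
    using assms(7,8) by (simp_all add: manifold_gauge_def)
  show ?thesis
  proof (intro conjI ballI)
    show "bij_betw (change_parallelism A T (y, y') U U')
       (crp_along A g T p \<omega> x y D U ::
          ((real \<Rightarrow> ('m, 'e) tvec \<Rightarrow> 'v) \<times> (real \<Rightarrow> real^'k \<Rightarrow> ('m, 'e) tvec \<Rightarrow> 'v)) set)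
       (crp_along A g T p \<omega> x y D' U')"
    \<comment> \<open>The inverse is the same map with the parallelisms exchanged, so each lemma is
      used once in either direction.\<close>
    proof (rule bij_betw_byWitness[where f' = "change_parallelism A T (y, y') U' U"])
      show "\<forall>\<alpha>\<in>crp_along A g T p \<omega> x y D U. change_parallelism A T (y, y') U' U (change_parallelism A T (y, y') U U' \<alpha>) = \<alpha>"
        using change_parallelism_inverse[OF G(3,2) G'(3,2)] by auto
      show "\<forall>\<alpha>\<in>crp_along A g T p \<omega> x y D' U'. change_parallelism A T (y, y') U U' (change_parallelism A T (y, y') U' U \<alpha>) = \<alpha>"
        using change_parallelism_inverse[OF G'(3,2) G(3,2)] by auto
      show "change_parallelism A T (y, y') U U' ` crp_along A g T p \<omega> x y D U \<subseteq> crp_along A g T p \<omega> x y D' U'"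
        using change_parallelism_in_crp_along[OF G(3,2) G'(3,2)] by auto
      show "change_parallelism A T (y, y') U' U ` crp_along A g T p \<omega> x y D' U' \<subseteq> crp_along A g T p \<omega> x y D U"
        using change_parallelism_in_crp_along[OF G'(3,2) G(3,2)] by auto
    qed
  next
    fix \<alpha> assume "\<alpha> \<in> (crp_along A g T p \<omega> x y D U ::
          ((real \<Rightarrow> ('m, 'e) tvec \<Rightarrow> 'v) \<times> (real \<Rightarrow> real^'k \<Rightarrow> ('m, 'e) tvec \<Rightarrow> 'v)) set)"
    then have "is_rough_integral A T p \<omega> x XX (y, y') D \<psi> U \<alpha> =
        is_rough_integral A T p \<omega> x XX (y, y') D' \<psi>' U' (change_parallelism A T (y, y') U U' \<alpha>)"
      using is_rough_integral_change_parallelism[OF G G'] by (cases \<alpha>) (auto simp: fun_eq_iff)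
    \<comment> \<open>Definite descriptions of equal predicates coincide, also when nothing
      satisfies them.\<close>
    then show "rough_integral A T p \<omega> x XX (y, y') D \<psi> U \<alpha> =
        rough_integral A T p \<omega> x XX (y, y') D' \<psi>' U' (change_parallelism A T (y, y') U U' \<alpha>)"
      by (simp add: rough_integral_def)
  qed
qed

end
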